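(* Let $(G,M)$ be a planar trivalent graph $G$ with perfect matching $M$. Let $\Gamma$ and $\tilde\Gamma$ be perfect matching graphs of $(G,M)$ related by local isotopies and a sequence of flip moves, each of which is a $0$-flip move, a $1$-flip move, or a $2$-flip move of the two connected edges type. Then $(C^{i,j}(\Gamma),\partial)\cong(C^{i,j}(\tilde\Gamma),\tilde\partial)$ as cochain complexes; that is, there exist isomorphisms $S:C^{i,j}(\Gamma)\to C^{i,j}(\tilde\Gamma)$ for all $i$ and $j$ such that $S\circ\partial=\tilde\partial\circ S$.
   Context: Graphs are finite multigraphs; loops, multiple edges, vertexless "circle" edges (edges with no endpoints) and the empty graph are allowed. A graph is trivalent if every vertex has degree $3$ (loops counted twice), and planar if it embeds in $S^2$. A plane graph of $G$ is (the image $\Gamma\subset S^2$ of) an embedding $G\to S^2$. A perfect matching of $G$ is a set $M$ of edges, none of which is a loop or a vertexless circle, such that every vertex is an endpoint of exactly one edge of $M$. A perfect matching graph for $(G,M)$ is a plane graph $\Gamma$ of $G$ together with $M$. Flip moves. Let $S^1\subset S^2$ be a Jordan curve meeting $\Gamma$ transversely in $0$, $1$ or $2$ points, all in interiors of edges, and let $D$ be one of the two disks it bounds. A flip move removes $D$ (with the part of $\Gamma$ in it) and re-glues it by an orientation-reversing homeomorphism of $S^1$ fixing the points of $S^1\cap\Gamma$; this yields another plane graph of $G$ (with the same $M$). $0$-flip: $S^1\cap\Gamma=\emptyset$. $1$-flip: $S^1$ meets the interior of one edge once (this edge is then necessarily in $M$). $2$-flip, two connected edges type: $S^1$ meets the interiors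 of two distinct edges $e,f$ once each, and there is a path of edges in $D$ from the endpoint of $e$ in $D$ to the endpoint of $f$ in $D$ (then necessarily either both $e,f\in M$ or neither is). A local isotopy is an ambient isotopy of the plane graph in $S^2$. States. Write $M=\{e_1,\dots,e_n\}$ (the same ordering is used for $\Gamma$ and $\tilde\Gamma$). Let $e\in M$ have end vertices $u,v$. Going counterclockwise around $u$ in $\Gamma$ starting from $e$, let $x_1,x_2$ be the other two half-edges; going counterclockwise around $v$ starting from $e$, let $y_1,y_2$ be the other two half-edges. The $0$-smoothing of $e$ replaces a small neighborhood of $e$ by two disjoint arcs parallel to $e$ joining $x_1$ to $y_2$ and $x_2$ to $y_1$; the $1$-smoothing replaces it by two arcs crossing once transversely, joining $x_1$ to $y_1$ and $x_2$ to $y_2$. For $\alpha\in\{0,1\}^n$ the state $\Gamma_\alpha$ is the collection of (possibly immersed) circles obtained by performing the $\alpha_i$-smoothing at $e_i$ for every $i$; $k_\alpha$ is the number of circles and $|\alpha|=\sum\alpha_i$. Cochain complex. Let $V=\mathbb{Z}_2[x]/(x^2)$, graded by $\deg 1=1$, $\deg x=-1$; $(W\{\ell\})^m=W^{m-\ell}$. To $\alpha$ associate $V_\alpha=V^{\otimes k_\alpha}\{|\alpha|\}$, with one tensor factor for each circle of $\Gamma_\alpha$. Set $C^{i,*}(\Gamma)=\bigoplus_{|\alpha|=i}V_\alpha$, where the second grading $j$ is the grading of $V_\alpha$. If $\alpha'$ is obtained from $\alpha$ by changing a single $\alpha_k$ from $0$ to $1$, define $\partial_{\alpha\alpha'}:V_\alpha\to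 V_{\alpha'}$ as the tensor product of the identity on factors of circles not passing through the smoothing of $e_k$ with: (a) if two circles fuse into one, multiplication $m$: $1\otimes1\mapsto1$, $1\otimes x,\ x\otimes1\mapsto x$, $x\otimes x\mapsto0$; (b) if one circle splits into two, $\Delta$: $1\mapsto 1\otimes x+x\otimes1$, $x\mapsto x\otimes x$; (c) if one circle becomes one circle, the zero map. The differential $\partial:C^{i,*}(\Gamma)\to C^{i+1,*}(\Gamma)$ is the sum of all the maps $\partial_{\alpha\alpha'}$ with $|\alpha|=i$. $\tilde\partial$ is the differential for $\tilde\Gamma$. *)

theory Defs
  imports
    "HOL-Analysis.Analysis"
    "HOL-Complex_Analysis.Winding_Numbers"
    "HOL-Library.Z2"
begin

section \<open>Trivalent multigraphs and perfect matchings\<close>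

text \<open>
  The edges of a multigraph are its links, which have two (possibly equal) ends, and its
  vertexless circles. The two ends of a link are indexed by booleans; this reference direction
  has no meaning beyond giving the two half-edges \<open>(e, False)\<close> and \<open>(e, True)\<close> of
  \<open>e\<close> distinct names, also when \<open>e\<close> is a loop.
\<close>

record ('v, 'e) mgraph =
  verts :: "'v set"
  links :: "'e set"
  circs :: "'e set"
  ends :: "'e \<Rightarrow> bool \<Rightarrow> 'v"

definition multigraph :: "('v, 'e) mgraph \<Rightarrow> bool" where
  "multigraph G \<longleftrightarrow>
     finite (verts G) \<and> finite (links G) \<and> finite (circs G) \<and> links G \<inter> circs G = {} \<and>
     (\<forall>e\<in>links G. \<forall>b. ends G e b \<in> verts G)"

definition half_edges_at :: "('v, 'e) mgraph \<Rightarrow> 'v \<Rightarrow> ('e \<times> bool) set" where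
  "half_edges_at G v = {(e, b). e \<in> links G \<and> ends G e b = v}"

definition trivalent :: "('v, 'e) mgraph \<Rightarrow> bool" where
  "trivalent G \<longleftrightarrow> multigraph G \<and> (\<forall>v\<in>verts G. card (half_edges_at G v) = 3)"

definition perfect_matching :: "('v, 'e) mgraph \<Rightarrow> 'e set \<Rightarrow> bool" where
  "perfect_matching G M \<longleftrightarrow>
     M \<subseteq> links G \<and> (\<forall>e\<in>M. ends G e False \<noteq> ends G e True) \<and>
     (\<forall>v\<in>verts G. \<exists>!e. e \<in> M \<and> v \<in> range (ends G e))"

section \<open>Plane graphs\<close>

abbreviation S2 :: "(real ^ 3) set" where
  "S2 \<equiv> sphere 0 1"

text \<open>
  An embedding of the topological realization of a multigraph is given by the positions of
  the vertices together with a parametrization of every edge. A plane graph is the image of an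
  embedding; accordingly all relations between plane graphs below refer to the positions of the
  vertices and to the point sets of the edges, never to the parametrizations.
\<close>

record ('v, 'e) drawing =
  vpos :: "'v \<Rightarrow> real ^ 3"
  curve :: "'e \<Rightarrow> real \<Rightarrow> real ^ 3"

definition plane_graph :: "('v, 'e) mgraph \<Rightarrow> ('v, 'e) drawing \<Rightarrow> bool" where
  "plane_graph G P \<longleftrightarrow>
     inj_on (vpos P) (verts G) \<and> vpos P ` verts G \<subseteq> S2 \<and>
     (\<forall>e\<in>links G \<union> circs G. simple_path (curve P e) \<and> path_image (curve P e) \<subseteq> S2) \<and>
     (\<forall>e\<in>links G.
        pathstart (curve P e) = vpos P (ends G e False) \<and>
        pathfinish (curve P e) = vpos P (ends G e True) \<and>
        path_image (curve P e) \<inter> vpos P ` verts G = vpos P ` range (ends G e)) \<and>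
     (\<forall>e\<in>circs G.
        pathfinish (curve P e) = pathstart (curve P e) \<and>
        path_image (curve P e) \<inter> vpos P ` verts G = {}) \<and>
     (\<forall>e\<in>links G \<union> circs G. \<forall>f\<in>links G \<union> circs G. e \<noteq> f \<longrightarrow>
        path_image (curve P e) \<inter> path_image (curve P f) \<subseteq> vpos P ` verts G)"

definition planar :: "('v, 'e) mgraph \<Rightarrow> bool" where
  "planar G \<longleftrightarrow> (\<exists>P. plane_graph G P)"

definition point_set :: "('v, 'e) mgraph \<Rightarrow> ('v, 'e) drawing \<Rightarrow> (real ^ 3) set" where
  "point_set G P = vpos P ` verts G \<union> (\<Union>e\<in>links G \<union> circs G. path_image (curve P e))"

definition moved_by ::
  "('v, 'e) mgraph \<Rightarrow> (real ^ 3 \<Rightarrow> real ^ 3) \<Rightarrow> ('v, 'e) drawing \<Rightarrow> ('v, 'e) drawing \<Rightarrow> bool" where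
  "moved_by G F P Q \<longleftrightarrow>
     (\<forall>v\<in>verts G. vpos Q v = F (vpos P v)) \<and>
     (\<forall>e\<in>links G \<union> circs G. path_image (curve Q e) = F ` path_image (curve P e))"

definition isotopic :: "('v, 'e) mgraph \<Rightarrow> ('v, 'e) drawing \<Rightarrow> ('v, 'e) drawing \<Rightarrow> bool" where
  "isotopic G P Q \<longleftrightarrow>
     (\<exists>H :: real \<Rightarrow> real ^ 3 \<Rightarrow> real ^ 3.
        continuous_on ({0..1} \<times> S2) (\<lambda>(t, x). H t x) \<and>
        (\<forall>t\<in>{0..1}. \<exists>K. homeomorphism S2 S2 (H t) K) \<and>
        (\<forall>x\<in>S2. H 0 x = x) \<and>
        moved_by G (H 1) P Q)"

section \<open>Flip moves\<close>

text \<open>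
  \<open>C\<close> is a Jordan curve in the sphere and \<open>D\<close> is one of the two closed disks it bounds.
\<close>

definition jordan_disk :: "(real ^ 3) set \<Rightarrow> (real ^ 3) set \<Rightarrow> bool" where
  "jordan_disk C D \<longleftrightarrow> D \<subseteq> S2 \<and>
     (\<exists>k k'. homeomorphism (cball (0::complex) 1) D k k' \<and> k ` sphere 0 1 = C)"

definition orientation_reversing_on :: "(real ^ 3) set \<Rightarrow> (real ^ 3 \<Rightarrow> real ^ 3) \<Rightarrow> bool" where
  "orientation_reversing_on C h \<longleftrightarrow>
     (\<exists>h'. homeomorphism C C h h') \<and>
     (\<exists>k k'. homeomorphism (sphere (0::complex) 1) C k k' \<and>
        winding_number (k' \<circ> h \<circ> k \<circ> circlepath 0 1) 0 = -1)"

text \<open>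
  Removing \<open>D\<close> and gluing it back by \<open>h\<close> gives an abstract sphere. It is identified with the
  original one by the identity outside \<open>D\<close> and a homeomorphism \<open>r\<close> of \<open>D\<close> that restricts to
  \<open>h\<close> on the boundary; any other identification that respects the orientation outside \<open>D\<close>
  differs from this one by an isotopy.
\<close>

definition reglue ::
  "('v, 'e) mgraph \<Rightarrow> (real ^ 3) set \<Rightarrow> (real ^ 3) set \<Rightarrow>
    ('v, 'e) drawing \<Rightarrow> ('v, 'e) drawing \<Rightarrow> bool" where
  "reglue G C D P Q \<longleftrightarrow>
     (\<exists>h r r'. orientation_reversing_on C h \<and> (\<forall>x\<in>C \<inter> point_set G P. h x = x) \<and>
        homeomorphism D D r r' \<and> (\<forall>x\<in>C. r x = h x) \<and>
        moved_by G (\<lambda>x. if x \<in> D then r x else x) P Q)"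

text \<open>
  The curve \<open>C\<close> meets the edge \<open>e\<close> in a single interior point, transversely, that is, the edge
  passes there from one side of \<open>C\<close> to the other. Only links need to be considered, as a closed
  curve disjoint from the vertices cannot cross \<open>C\<close> exactly once.
\<close>

definition crosses_once ::
  "('v, 'e) mgraph \<Rightarrow> ('v, 'e) drawing \<Rightarrow> (real ^ 3) set \<Rightarrow> (real ^ 3) set \<Rightarrow> 'e \<Rightarrow> bool" where
  "crosses_once G P C D e \<longleftrightarrow> e \<in> links G \<and>
     (\<exists>t\<in>{0<..<1}. path_image (curve P e) \<inter> C = {curve P e t} \<and>
        (\<exists>\<delta>>0. (\<forall>\<eta>\<in>{0<..<\<delta>}. curve P e (t - \<eta>) \<in> D - C \<and> curve P e (t + \<eta>) \<in> S2 - D) \<or>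
               (\<forall>\<eta>\<in>{0<..<\<delta>}. curve P e (t - \<eta>) \<in> S2 - D \<and> curve P e (t + \<eta>) \<in> D - C)))"

definition flip0 :: "('v, 'e) mgraph \<Rightarrow> ('v, 'e) drawing \<Rightarrow> ('v, 'e) drawing \<Rightarrow> bool" where
  "flip0 G P Q \<longleftrightarrow>
     (\<exists>C D. jordan_disk C D \<and> point_set G P \<inter> C = {} \<and> reglue G C D P Q)"

definition flip1 :: "('v, 'e) mgraph \<Rightarrow> ('v, 'e) drawing \<Rightarrow> ('v, 'e) drawing \<Rightarrow> bool" where
  "flip1 G P Q \<longleftrightarrow>
     (\<exists>C D e. jordan_disk C D \<and> crosses_once G P C D e \<and>
        point_set G P \<inter> C = path_image (curve P e) \<inter> C \<and> reglue G C D P Q)"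

definition edge_path_in ::
  "('v, 'e) mgraph \<Rightarrow> ('v, 'e) drawing \<Rightarrow> (real ^ 3) set \<Rightarrow> 'v \<Rightarrow> 'v \<Rightarrow> bool" where
  "edge_path_in G P D =
     (\<lambda>u v. \<exists>e\<in>links G. \<exists>b. path_image (curve P e) \<subseteq> D \<and>
        u = ends G e b \<and> v = ends G e (\<not> b))\<^sup>*\<^sup>*"

definition flip2_connected ::
  "('v, 'e) mgraph \<Rightarrow> ('v, 'e) drawing \<Rightarrow> ('v, 'e) drawing \<Rightarrow> bool" where
  "flip2_connected G P Q \<longleftrightarrow>
     (\<exists>C D e f. jordan_disk C D \<and> e \<noteq> f \<and>
        crosses_once G P C D e \<and> crosses_once G P C D f \<and>
        point_set G P \<inter> C = (path_image (curve P e) \<union> path_image (curve P f)) \<inter> C \<and>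
        (\<exists>b c. vpos P (ends G e b) \<in> D \<and> vpos P (ends G f c) \<in> D \<and>
               edge_path_in G P D (ends G e b) (ends G f c)) \<and>
        reglue G C D P Q)"

definition move :: "('v, 'e) mgraph \<Rightarrow> ('v, 'e) drawing \<Rightarrow> ('v, 'e) drawing \<Rightarrow> bool" where
  "move G P Q \<longleftrightarrow> plane_graph G P \<and> plane_graph G Q \<and>
     (isotopic G P Q \<or> flip0 G P Q \<or> flip1 G P Q \<or> flip2_connected G P Q)"

section \<open>States\<close>

definition half_curve :: "('v, 'e) drawing \<Rightarrow> 'e \<times> bool \<Rightarrow> real \<Rightarrow> real ^ 3" where
  "half_curve P h = (if snd h then reversepath (curve P (fst h)) else curve P (fst h))"

text \<open>
  The point at which a curve first reaches distance \<open>\<epsilon>\<close> from its starting point.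
\<close>

definition exit_point :: "(real \<Rightarrow> real ^ 3) \<Rightarrow> real \<Rightarrow> real ^ 3" where
  "exit_point g \<epsilon> = g (Inf {t \<in> {0..1}. dist (g 0) (g t) = \<epsilon>})"

text \<open>
  Three half-edges at the same vertex \<open>u\<close> are in counterclockwise order, as seen from outside
  the sphere, if they leave every small disk around \<open>u\<close> in this order. Three points \<open>p\<close>,
  \<open>q\<close>, \<open>r\<close> on a round circle in the sphere centred at \<open>u\<close> follow each other counterclockwise iff
  the triangle \<open>p q r\<close> is positively oriented with respect to the outer normal \<open>u\<close>.
\<close>

definition ccw ::
  "('v, 'e) drawing \<Rightarrow> 'e \<times> bool \<Rightarrow> 'e \<times> bool \<Rightarrow> 'e \<times> bool \<Rightarrow> bool" where
  "ccw P h x y \<longleftrightarrow>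
     (\<forall>\<^sub>F \<epsilon> in at_right 0.
        let u = half_curve P h 0;
            p = exit_point (half_curve P h) \<epsilon>;
            q = exit_point (half_curve P x) \<epsilon>;
            r = exit_point (half_curve P y) \<epsilon>
        in u \<bullet> cross3 (q - p) (r - p) > 0)"

text \<open>
  \<open>x\<close>, \<open>y\<close> are the other two half-edges at the vertex of the half-edge \<open>h\<close>, in the order met
  when going counterclockwise from \<open>h\<close>.
\<close>

definition ccw_from ::
  "('v, 'e) mgraph \<Rightarrow> ('v, 'e) drawing \<Rightarrow>
    'e \<times> bool \<Rightarrow> 'e \<times> bool \<Rightarrow> 'e \<times> bool \<Rightarrow> bool" where
  "ccw_from G P h x y \<longleftrightarrow>
     half_edges_at G (ends G (fst h) (snd h)) = {h, x, y} \<and> distinct [h, x, y] \<and> ccw P h x y"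

text \<open>
  The half-edges \<open>h\<close>, \<open>k\<close> are joined by an arc of the 0-smoothing (\<open>\<not> s\<close>) or of the
  1-smoothing (\<open>s\<close>) of \<open>e\<close>.
\<close>

definition smoothing_arc ::
  "('v, 'e) mgraph \<Rightarrow> ('v, 'e) drawing \<Rightarrow> 'e \<Rightarrow> bool \<Rightarrow> 'e \<times> bool \<Rightarrow> 'e \<times> bool \<Rightarrow> bool" where
  "smoothing_arc G P e s h k \<longleftrightarrow>
     (\<exists>x1 x2 y1 y2. ccw_from G P (e, False) x1 x2 \<and> ccw_from G P (e, True) y1 y2 \<and>
        (if s then {h, k} = {x1, y1} \<or> {h, k} = {x2, y2}
              else {h, k} = {x1, y2} \<or> {h, k} = {x2, y1}))"

text \<open>
  A vector \<open>\<alpha>\<close> in \<open>{0,1}\<^sup>n\<close> is represented by the set \<open>A \<subseteq> M\<close> of those matching edges at which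
  it takes the value 1. The circles of the state are made of the smoothing arcs and of the edges
  outside \<open>M\<close>; a circle is represented by the set of edges outside \<open>M\<close> that it runs through.
  These sets are nonempty and disjoint for distinct circles.
\<close>

definition state_circles ::
  "('v, 'e) mgraph \<Rightarrow> ('v, 'e) drawing \<Rightarrow> 'e set \<Rightarrow> 'e set \<Rightarrow> 'e set set" where
  "state_circles G P M A =
     (\<lambda>a. {b. (\<lambda>a b. \<exists>e\<in>M. \<exists>c d. smoothing_arc G P e (e \<in> A) (a, c) (b, d))\<^sup>*\<^sup>* a b})
       ` ((links G - M) \<union> circs G)"

definition circles_through ::
  "('v, 'e) mgraph \<Rightarrow> ('v, 'e) drawing \<Rightarrow> 'e set \<Rightarrow> 'e set \<Rightarrow> 'e \<Rightarrow> 'e set set" where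
  "circles_through G P M A e =
     {Z \<in> state_circles G P M A. \<exists>a\<in>Z \<inter> links G. range (ends G a) \<inter> range (ends G e) \<noteq> {}}"

section \<open>The cochain complex\<close>

text \<open>
  The basis \<open>1, x\<close> of the algebra \<open>V = \<int>\<^sub>2[x]/(x\<^sup>2)\<close>. Values of the multiplication and of the
  comultiplication on basis vectors are given as the sets of basis vectors occurring in them.
\<close>

datatype gen = V1 | Vx

fun gen_deg :: "gen \<Rightarrow> int" where
  "gen_deg V1 = 1"
| "gen_deg Vx = -1"

fun vmult :: "gen \<Rightarrow> gen \<Rightarrow> gen set" where
  "vmult V1 V1 = {V1}"
| "vmult V1 Vx = {Vx}"
| "vmult Vx V1 = {Vx}"
| "vmult Vx Vx = {}"

fun vcomult :: "gen \<Rightarrow> (gen \<times> gen) set" where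
  "vcomult V1 = {(V1, Vx), (Vx, V1)}"
| "vcomult Vx = {(Vx, Vx)}"

text \<open>
  The tensor power of \<open>V\<close> over a finite set of circles has as basis the labellings of these
  circles by \<open>1\<close> and \<open>x\<close>.
\<close>

definition labellings ::
  "('v, 'e) mgraph \<Rightarrow> ('v, 'e) drawing \<Rightarrow> 'e set \<Rightarrow> 'e set \<Rightarrow> ('e set \<Rightarrow> gen) set" where
  "labellings G P M A = state_circles G P M A \<rightarrow>\<^sub>E UNIV"

definition cochain_basis ::
  "('v, 'e) mgraph \<Rightarrow> ('v, 'e) drawing \<Rightarrow> 'e set \<Rightarrow> nat \<Rightarrow> int \<Rightarrow>
    ('e set \<times> ('e set \<Rightarrow> gen)) set" where
  "cochain_basis G P M i j =
     {(A, l). A \<subseteq> M \<and> card A = i \<and> l \<in> labellings G P M A \<and>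
        (\<Sum>Z\<in>state_circles G P M A. gen_deg (l Z)) + int (card A) = j}"

type_synonym 'e cochain = "'e set \<times> ('e set \<Rightarrow> gen) \<Rightarrow> bit"

definition cochains ::
  "('v, 'e) mgraph \<Rightarrow> ('v, 'e) drawing \<Rightarrow> 'e set \<Rightarrow> nat \<Rightarrow> int \<Rightarrow> 'e cochain set" where
  "cochains G P M i j = {c. \<forall>b. c b \<noteq> 0 \<longrightarrow> b \<in> cochain_basis G P M i j}"

text \<open>
  The matrix entry at the labellings \<open>l\<close> and \<open>l'\<close> of the map from the state \<open>A\<close> to the state
  \<open>insert e A\<close>. The entry vanishes if one circle becomes one circle.
\<close>

definition edge_coeff ::
  "('v, 'e) mgraph \<Rightarrow> ('v, 'e) drawing \<Rightarrow> 'e set \<Rightarrow> 'e set \<Rightarrow> 'e \<Rightarrow>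
    ('e set \<Rightarrow> gen) \<Rightarrow> ('e set \<Rightarrow> gen) \<Rightarrow> bit" where
  "edge_coeff G P M A e l l' =
     (let T = circles_through G P M A e; T' = circles_through G P M (insert e A) e in
      of_bool
        ((\<forall>Z\<in>state_circles G P M A - T. l' Z = l Z) \<and>
         ((\<exists>Z1 Z2 Z. Z1 \<noteq> Z2 \<and> T = {Z1, Z2} \<and> T' = {Z} \<and> l' Z \<in> vmult (l Z1) (l Z2)) \<or>
          (\<exists>Z Z1 Z2. Z1 \<noteq> Z2 \<and> T = {Z} \<and> T' = {Z1, Z2} \<and> (l' Z1, l' Z2) \<in> vcomult (l Z)))))"

definition differential ::
  "('v, 'e) mgraph \<Rightarrow> ('v, 'e) drawing \<Rightarrow> 'e set \<Rightarrow> 'e cochain \<Rightarrow> 'e cochain" where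
  "differential G P M c =
     (\<lambda>(A, l').
        if A \<subseteq> M \<and> l' \<in> labellings G P M A
        then \<Sum>e\<in>A. \<Sum>l\<in>labellings G P M (A - {e}).
               edge_coeff G P M (A - {e}) e l l' * c (A - {e}, l)
        else 0)"

definition linear_iso :: "'e cochain set \<Rightarrow> 'e cochain set \<Rightarrow> ('e cochain \<Rightarrow> 'e cochain) \<Rightarrow> bool" where
  "linear_iso U W S \<longleftrightarrow> bij_betw S U W \<and>
     (\<forall>c\<in>U. \<forall>d\<in>U. S (\<lambda>b. c b + d b) = (\<lambda>b. S c b + S d b)) \<and>
     (\<forall>a. \<forall>c\<in>U. S (\<lambda>b. a * c b) = (\<lambda>b. a * S c b))"

end

theory Submission
  imports Defs
begin

text \<open>
  A move reverses the cyclic orders of the half-edges exactly at the vertices of some set \<open>W\<close> that at most two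
  edges leave: at all vertices or at none for an isotopy, at the vertices in the disk or at
  none for a flip. Indeed a homeomorphism of a sphere or disk preserves all cyclic orders or reverses all
  of them; which of the two happens is irrelevant, as is the path condition on 2-flips.

  Over \<open>\<int>\<^sub>2\<close> the space \<open>V\<^sub>\<alpha>\<close> is the ring generated by the edges outside \<open>M\<close> modulo the squares of edges and the
  differences of edges on the same circle. The component of the differential at \<open>e\<close> is the projection
  if two circles fuse, and multiplication by the sum \<open>p + q\<close> of the two edges next to \<open>e\<close> at one of its
  ends if a circle splits. If an edge \<open>e \<in> M\<close> leaves \<open>W\<close>, let \<open>p\<close>, \<open>q\<close> be the edges next to it in \<open>W\<close>. The substitution
  \<open>a \<mapsto> a + p + q\<close> for the edges \<open>a\<close> inside \<open>W\<close> is an involution, commutes with the differential, and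
  exchanges the relations of the two states: at \<open>e\<close> because it exchanges \<open>p\<close> and \<open>q\<close>, and at the second edge
  \<open>f\<close> that leaves \<open>W\<close> because the two edges next to \<open>f\<close> in \<open>W\<close> have the same sum \<open>p + q\<close>. For the sum of all
  half-edges outside \<open>M\<close> at the vertices of \<open>W\<close> vanishes, every edge being counted twice, while
  the smoothing arcs cancel all of its terms except those at \<open>e\<close> and \<open>f\<close>. The self-duality
  of \<open>V\<close> that exchanges \<open>1\<close> and \<open>x\<close> replaces ring elements by linear functionals; it turns
  fusion into contraction with \<open>p + q\<close> and splitting into an inclusion.
\<close>

section \<open>Contractions and shears\<close>

text \<open>The ring of a state is a quotient that changes with the smoothing, whereas its dual is a
  subspace of one fixed space: the functions \<phi> on sets \<open>K\<close> of edges, where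
  \<open>K\<close> stands for the product of its elements. \<open>contract a\<close> is the dual of
  multiplication by \<open>a\<close>; its value 0 for \<open>a \<in> K\<close> expresses that
  squares vanish. Hence a single linear map, the shear, acts on all states at once, and the circles
  enter the differential only through the question whether \<open>p\<close> and \<open>q\<close> lie
  on the same one. If no edge of \<open>M\<close> leaves \<open>W\<close>, each matching edge has
  its order reversed at both ends or at neither, and the smoothings do not change; if one does, a
  parity argument shows that all edges leaving \<open>W\<close> are in \<open>M\<close>. The
  geometric obstacle is that edges are merely continuous: they may spiral around a vertex, so there
  are no tangent directions. The order in which three of them leave a small disk has to be expressed
  by a quantity that does not depend on the disk and behaves well under homeomorphisms, and the
  total turning of their difference vectors is such a quantity.\<close>

definition contract :: "'e \<Rightarrow> ('e set \<Rightarrow> bit) \<Rightarrow> 'e set \<Rightarrow> bit" where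
  "contract a \<phi> K = (if a \<in> K then 0 else \<phi> (insert a K))"

text \<open>
  The dual of the substitution \<open>a \<mapsto> a + p + q\<close> for \<open>a \<in> I\<close>. Only terms of first order in \<open>p + q\<close> occur,
  since the square of \<open>p + q\<close> is 0.
\<close>

definition shear :: "'e set \<Rightarrow> 'e \<Rightarrow> 'e \<Rightarrow> ('e set \<Rightarrow> bit) \<Rightarrow> 'e set \<Rightarrow> bit" where
  "shear I p q \<phi> K = \<phi> K + (\<Sum>a\<in>K \<inter> I. contract p \<phi> (K - {a}) + contract q \<phi> (K - {a}))"

text \<open>The simplifier would turn sums of bits into conditions on their parities.\<close>

declare add_bit_eq_xor [simp del] mult_bit_eq_and [simp del]

lemma bit_double [simp]: "x + x = (0::bit)"
  by (cases x) (simp_all add: add_bit_eq_xor)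

lemma bit_double_left [simp]: "x + (x + y) = (y::bit)"
  by (simp flip: add.assoc)

lemma contract_commute: "contract a (contract b \<phi>) = contract b (contract a \<phi>)"
  by (auto simp: contract_def fun_eq_iff insert_commute)

lemma contract_self [simp]: "contract a (contract a \<phi>) = (\<lambda>K. 0)"
  by (auto simp: contract_def fun_eq_iff)

lemma contract_zero [simp]: "contract a (\<lambda>K. 0) = (\<lambda>K. 0)"
  by (auto simp: contract_def fun_eq_iff)

lemma contract_add: "contract a (\<lambda>K. \<phi> K + \<psi> K) = (\<lambda>K. contract a \<phi> K + contract a \<psi> K)"
  by (auto simp: contract_def fun_eq_iff)

lemma shear_add: "shear I p q (\<lambda>K. \<phi> K + \<psi> K) = (\<lambda>K. shear I p q \<phi> K + shear I p q \<psi> K)"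
  by (auto simp: shear_def fun_eq_iff contract_add sum.distrib algebra_simps)

lemma shear_zero [simp]: "shear I p q (\<lambda>K. 0) = (\<lambda>K. 0)"
  by (auto simp: shear_def fun_eq_iff)

lemma shear_scale: "shear I p q (\<lambda>K. c * \<phi> K) = (\<lambda>K. c * shear I p q \<phi> K)"
  by (cases c) simp_all

lemma shear_sum: "shear I p q (\<lambda>K. \<Sum>x\<in>X. \<phi> x K) = (\<lambda>K. \<Sum>x\<in>X. shear I p q (\<phi> x) K)"
proof (induction X rule: infinite_finite_induct)
  case (insert x X)
  then show ?case by (simp add: shear_add[of I p q "\<phi> x" "\<lambda>K. \<Sum>x\<in>X. \<phi> x K"])
qed simp_all

text \<open>The shear is dual to a ring substitution s, so the image of the product of
  \<open>b\<close> and \<open>K\<close> is s(b) times s(K). For \<open>b \<in> I\<close> the extra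
  summand is \<open>p + q\<close> times s(K), which equals \<open>p + q\<close> times
  \<open>K\<close> because \<open>p + q\<close> squares to 0; therefore the correction contracts
  \<phi> itself and not its shear.\<close>

lemma contract_shear:
  assumes "finite I"
  shows "contract b (shear I p q \<phi>) K =
    shear I p q (contract b \<phi>) K + (if b \<in> I then contract p \<phi> K + contract q \<phi> K else 0)"
proof (cases "b \<in> K")
  case True
  \<comment> \<open>The left side is 0 by \<open>b \<in> K\<close>. On the right only the summand
    \<open>a = b\<close> of the shear survives, since \<open>b\<close> occurs twice in all
    others.\<close>
  have other: "contract r (contract b \<phi>) (K - {a}) = 0" if "a \<noteq> b" for a r
    using True that by (auto simp: contract_def)
  have self: "contract r (contract b \<phi>) (K - {b}) = contract r \<phi> K" for r
  proof (cases "r = b")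
    case False
    have "insert b (insert r (K - {b})) = insert r K" using True by auto
    then show ?thesis using False by (simp add: contract_def)
  qed (use True in \<open>simp add: contract_def\<close>)
  have "(\<Sum>a\<in>K \<inter> I. contract p (contract b \<phi>) (K - {a}) + contract q (contract b \<phi>) (K - {a})) =
      (\<Sum>a\<in>K \<inter> I. if a = b then contract p \<phi> K + contract q \<phi> K else 0)"
    by (rule sum.cong) (auto simp: other self)
  also have "\<dots> = (if b \<in> I then contract p \<phi> K + contract q \<phi> K else 0)"
    using assms True by simp
  finally show ?thesis
    using True by (simp add: shear_def contract_def)
next
  case False
  have eq: "contract r \<phi> (insert b K - {a}) = contract r (contract b \<phi>) (K - {a})" if "a \<in> K" for a r
  proof -
    have "a \<noteq> b" using that False by auto
    then have "insert b K - {a} = insert b (K - {a})" by auto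
    then show ?thesis using False by (auto simp: contract_def insert_commute)
  qed
  have "(\<Sum>a\<in>insert b K \<inter> I. contract p \<phi> (insert b K - {a}) + contract q \<phi> (insert b K - {a})) =
      (if b \<in> I then contract p \<phi> K + contract q \<phi> K else 0) +
      (\<Sum>a\<in>K \<inter> I. contract p \<phi> (insert b K - {a}) + contract q \<phi> (insert b K - {a}))"
    using assms False by (simp add: Int_insert_left)
  also have "(\<Sum>a\<in>K \<inter> I. contract p \<phi> (insert b K - {a}) + contract q \<phi> (insert b K - {a})) =
      (\<Sum>a\<in>K \<inter> I. contract p (contract b \<phi>) (K - {a}) + contract q (contract b \<phi>) (K - {a}))"
    by (rule sum.cong) (auto simp: eq)
  finally show ?thesis
    using False by (simp add: shear_def contract_def algebra_simps)
qed

text \<open>The substitution fixes \<open>r + s\<close>: the two corrections \<open>p + q\<close>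
  are both present or both absent, and they cancel.\<close>

lemma contract2_shear:
  assumes "finite I" "p \<in> I \<longleftrightarrow> q \<in> I" "r \<in> I \<longleftrightarrow> s \<in> I"
  shows "contract r (shear I p q \<phi>) K + contract s (shear I p q \<phi>) K =
    shear I p q (\<lambda>K. contract r \<phi> K + contract s \<phi> K) K"
  using assms by (simp add: contract_shear shear_add algebra_simps)

text \<open>The increment \<open>p + q\<close> is itself fixed by the substitution, so a second
  application adds the same first-order term again, and it cancels in characteristic 2.\<close>

lemma shear_shear:
  assumes "finite I" "p \<in> I \<longleftrightarrow> q \<in> I"
  shows "shear I p q (shear I p q \<phi>) = \<phi>"
proof
  fix K
  let ?\<psi> = "\<lambda>K. contract p \<phi> K + contract q \<phi> K"
  have "contract p ?\<psi> L + contract q ?\<psi> L = 0" for L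
    by (simp add: contract_add contract_commute[of q p])
  then have inv: "shear I p q ?\<psi> = ?\<psi>"
    by (simp add: shear_def fun_eq_iff)
  have "contract p (shear I p q \<phi>) L + contract q (shear I p q \<phi>) L = ?\<psi> L" for L
    using contract2_shear[OF assms(1,2,2)] inv by simp
  then have "shear I p q (shear I p q \<phi>) K = shear I p q \<phi> K + (\<Sum>a\<in>K \<inter> I. ?\<psi> (K - {a}))"
    by (simp add: shear_def[of I p q "shear I p q \<phi>"])
  then show "shear I p q (shear I p q \<phi>) K = \<phi> K"
    by (simp add: shear_def add.assoc)
qed

text \<open>The condition on \<open>R\<close> says that \<phi> vanishes on the ideal generated by
  the differences of edges related by \<open>R\<close>. For the smoothing arcs of a state this gives
  the dual of the ring of the state.\<close>

definition state_space :: "'e set \<Rightarrow> ('e \<Rightarrow> 'e \<Rightarrow> bool) \<Rightarrow> ('e set \<Rightarrow> bit) set" where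
  "state_space E R = {\<phi>. (\<forall>K. \<phi> K \<noteq> 0 \<longrightarrow> K \<subseteq> E) \<and> (\<forall>a b. R a b \<longrightarrow> contract a \<phi> = contract b \<phi>)}"

lemma state_space_rtranclp: "state_space E R\<^sup>*\<^sup>* = state_space E R"
proof -
  have "contract a \<phi> = contract b \<phi>" if "\<forall>a b. R a b \<longrightarrow> contract a \<phi> = contract b \<phi>" "R\<^sup>*\<^sup>* a b" for \<phi> :: "'a set \<Rightarrow> bit" and a b
    using that(2)
  proof (induction rule: rtranclp_induct)
    case (step b c)
    then show ?case using that(1)[rule_format, OF step(2)] by simp
  qed simp
  then have "(\<forall>a b. R\<^sup>*\<^sup>* a b \<longrightarrow> contract a \<phi> = contract b \<phi>) \<longleftrightarrow> (\<forall>a b. R a b \<longrightarrow> contract a \<phi> = contract b \<phi>)"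
    for \<phi> :: "'a set \<Rightarrow> bit"
    by (metis r_into_rtranclp)
  then show ?thesis
    unfolding state_space_def by simp
qed

lemma shear_supp:
  assumes "\<forall>K. \<phi> K \<noteq> 0 \<longrightarrow> K \<subseteq> E" "I \<subseteq> E" "shear I p q \<phi> K \<noteq> 0"
  shows "K \<subseteq> E"
proof (rule ccontr)
  assume *: "\<not> K \<subseteq> E"
  then have "\<phi> K = 0" using assms(1) by blast
  moreover have "contract r \<phi> (K - {a}) = 0" if "a \<in> K \<inter> I" for a r
  proof -
    have "\<not> insert r (K - {a}) \<subseteq> E" using * that assms(2) by blast
    then have "\<phi> (insert r (K - {a})) = 0" using assms(1) by blast
    then show ?thesis by (simp add: contract_def)
  qed
  ultimately show False using assms(3) by (simp add: shear_def)
qed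

section \<open>Labellings of circles as functions on sets of edges\<close>

text \<open>
  A labelling of the circles by \<open>1\<close> and \<open>x\<close> is tested on sets \<open>K\<close> of edges: \<open>encode E \<C> c K\<close> is the
  coefficient of \<open>c\<close> at the labelling whose circles with label \<open>1\<close> are those met by \<open>K\<close>, and it is
  0 if \<open>K\<close> meets a circle twice. In this form the vector space of a state depends on the circles only
  through the linear equations of \<open>state_space\<close>.
\<close>

definition lab_of :: "'e set set \<Rightarrow> 'e set \<Rightarrow> 'e set \<Rightarrow> gen" where
  "lab_of \<C> K = (\<lambda>Z. if Z \<in> \<C> then (if Z \<inter> K = {} then Vx else V1) else undefined)"

definition thin :: "'e set set \<Rightarrow> 'e set \<Rightarrow> bool" where
  "thin \<C> K \<longleftrightarrow> (\<forall>Z\<in>\<C>. \<forall>a\<in>K \<inter> Z. \<forall>b\<in>K \<inter> Z. a = b)"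

definition encode :: "'e set \<Rightarrow> 'e set set \<Rightarrow> (('e set \<Rightarrow> gen) \<Rightarrow> bit) \<Rightarrow> 'e set \<Rightarrow> bit" where
  "encode E \<C> c K = (if K \<subseteq> E \<and> thin \<C> K then c (lab_of \<C> K) else 0)"

text \<open>The set on which \<open>encode\<close> reads off the coefficient at \<open>l\<close>:
  one edge from each circle labelled 1. On a state space the choice of the edge makes no
  difference.\<close>

definition transversal :: "'e set set \<Rightarrow> ('e set \<Rightarrow> gen) \<Rightarrow> 'e set" where
  "transversal \<C> l = (\<lambda>Z. SOME a. a \<in> Z) ` {Z \<in> \<C>. l Z = V1}"

definition part_rel :: "'e set set \<Rightarrow> 'e \<Rightarrow> 'e \<Rightarrow> bool" where
  "part_rel \<C> a b \<longleftrightarrow> (\<exists>Z\<in>\<C>. a \<in> Z \<and> b \<in> Z)"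

lemma lab_of_in: "lab_of \<C> K \<in> \<C> \<rightarrow>\<^sub>E UNIV"
  by (auto simp: lab_of_def)

lemma some_in_part: "partition_on E \<C> \<Longrightarrow> Z \<in> \<C> \<Longrightarrow> (SOME a. a \<in> Z) \<in> Z"
  by (metis partition_onD3 some_in_eq)

lemma transversal_Int:
  assumes "partition_on E \<C>" "Z \<in> \<C>"
  shows "transversal \<C> l \<inter> Z = (if l Z = V1 then {SOME a. a \<in> Z} else {})"
proof -
  have "Y = Z" if "Y \<in> \<C>" "(SOME a. a \<in> Y) \<in> Z" for Y
    using that assms(2) some_in_part[OF assms(1) that(1)] partition_onD2[OF assms(1)]
    unfolding disjoint_def by blast
  then show ?thesis
    using assms(2) some_in_part[OF assms] by (auto simp: transversal_def)
qed

lemma transversal_sub: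
  assumes "partition_on E \<C>" shows "transversal \<C> l \<subseteq> E"
  using some_in_part[OF assms] partition_onD1[OF assms] by (auto simp: transversal_def)

lemma thin_transversal:
  assumes "partition_on E \<C>" shows "thin \<C> (transversal \<C> l)"
  unfolding thin_def using transversal_Int[OF assms] by auto

lemma lab_of_transversal:
  assumes "partition_on E \<C>" "l \<in> \<C> \<rightarrow>\<^sub>E UNIV"
  shows "lab_of \<C> (transversal \<C> l) = l"
proof
  fix Z show "lab_of \<C> (transversal \<C> l) Z = l Z"
    using assms(2) transversal_Int[OF assms(1), of Z l]
    by (cases "l Z") (auto simp: lab_of_def Int_commute PiE_def extensional_def)
qed

lemma encode_transversal:
  assumes "partition_on E \<C>" "l \<in> \<C> \<rightarrow>\<^sub>E UNIV"
  shows "encode E \<C> c (transversal \<C> l) = c l"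
  using assms by (simp add: encode_def thin_transversal transversal_sub lab_of_transversal)

text \<open>For \<open>a\<close> and \<open>b\<close> on a circle \<open>Z\<close> and outside
  \<open>K\<close>, the sets \<open>insert a K\<close> and \<open>insert b K\<close> are thin under
  the same condition, namely that \<open>K\<close> is thin and misses \<open>Z\<close>, and they
  meet the same circles.\<close>

lemma encode_in_state_space:
  assumes "partition_on E \<C>"
  shows "encode E \<C> c \<in> state_space E (part_rel \<C>)"
proof -
  have *: "contract a (encode E \<C> c) K = contract b (encode E \<C> c) K" if Z: "Z \<in> \<C>" "a \<in> Z" "b \<in> Z" for a b Z K
  proof (cases "a = b")
    case False
    have uniq: "Y = Z" if "Y \<in> \<C>" "a \<in> Y \<or> b \<in> Y" for Y
      using that Z partition_onD2[OF assms] by (auto simp: disjoint_def)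
    have E: "a \<in> E" "b \<in> E" using Z partition_onD1[OF assms] by auto
    have zero: "encode E \<C> c L = 0" if "a \<in> L" "b \<in> L" for L
      using that Z False by (auto simp: encode_def thin_def)
    show ?thesis
    proof (cases "a \<in> K \<or> b \<in> K")
      \<comment> \<open>Each side is 0, either by definition of \<open>contract\<close> or because
        \<open>Z\<close> is met twice.\<close>
      case True
      then show ?thesis using zero[of "insert a K"] zero[of "insert b K"] by (auto simp: contract_def)
    next
      case nin: False
      have ins: "thin \<C> (insert x K) \<longleftrightarrow> thin \<C> K \<and> K \<inter> Z = {}"
        if "x \<in> Z" "\<And>Y. Y \<in> \<C> \<Longrightarrow> x \<in> Y \<Longrightarrow> Y = Z" "x \<notin> K" for x
      proof
        assume t: "thin \<C> (insert x K)"
        then have "thin \<C> K" unfolding thin_def by blast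
        moreover have "K \<inter> Z = {}"
          using t that(1,3) Z(1) unfolding thin_def by auto
        ultimately show "thin \<C> K \<and> K \<inter> Z = {}" ..
      next
        assume t: "thin \<C> K \<and> K \<inter> Z = {}"
        show "thin \<C> (insert x K)"
          unfolding thin_def
        proof (intro ballI)
          fix Y y z assume Y: "Y \<in> \<C>" "y \<in> insert x K \<inter> Y" "z \<in> insert x K \<inter> Y"
          show "y = z"
          proof (cases "x \<in> Y")
            case True
            then have "Y = Z" by (rule that(2)[OF Y(1)])
            then show ?thesis using t Y by auto
          next
            case False
            then have "y \<in> K \<inter> Y" "z \<in> K \<inter> Y" using Y by auto
            then show ?thesis using t Y(1) unfolding thin_def by blast
          qed
        qed
      qed
      have "thin \<C> (insert a K) \<longleftrightarrow> thin \<C> (insert b K)"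
        by (subst (1 2) ins) (use uniq Z nin in blast)+
      moreover have "lab_of \<C> (insert a K) = lab_of \<C> (insert b K)"
      proof
        fix Y show "lab_of \<C> (insert a K) Y = lab_of \<C> (insert b K) Y"
          using uniq[of Y] Z by (cases "Y = Z") (auto simp: lab_of_def)
      qed
      ultimately show ?thesis
        using nin E by (simp add: contract_def encode_def)
    qed
  qed simp
  then have "contract a (encode E \<C> c) = contract b (encode E \<C> c)" if "part_rel \<C> a b" for a b
    using that unfolding part_rel_def by blast
  moreover have "K \<subseteq> E" if "encode E \<C> c K \<noteq> 0" for K
    using that by (auto simp: encode_def split: if_splits)
  ultimately show ?thesis unfolding state_space_def by blast
qed

text \<open>The relations of the state space allow an edge of \<open>K\<close> to be replaced by an
  edge of \<open>L\<close> on the same circle, and the set stays thin; each replacement lowers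
  \<open>card (K - L)\<close>.\<close>

lemma state_space_exchange:
  assumes \<phi>: "\<phi> \<in> state_space E (part_rel \<C>)" and "partition_on E \<C>" and "finite E"
    and "K \<subseteq> E" "L \<subseteq> E" "thin \<C> K" "thin \<C> L"
    and "\<And>Z. Z \<in> \<C> \<Longrightarrow> Z \<inter> K = {} \<longleftrightarrow> Z \<inter> L = {}"
  shows "\<phi> K = \<phi> L"
  using assms(4-)
proof (induction "card (K - L)" arbitrary: K)
  case 0
  have "finite K" using 0 assms(3) finite_subset by blast
  then have "K \<subseteq> L" using 0 by simp
  \<comment> \<open>The circle of an edge of \<open>L\<close> is also met by \<open>K\<close>, in an
    edge of \<open>L\<close> by \<open>K \<subseteq> L\<close>; thinness of \<open>L\<close>
    identifies the two edges.\<close>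
  moreover have "L \<subseteq> K"
  proof
    fix x assume x: "x \<in> L"
    then obtain Z where Z: "Z \<in> \<C>" "x \<in> Z" using 0(3) partition_onD1[OF assms(2)] by blast
    then obtain y where "y \<in> Z" "y \<in> K" using 0(6)[of Z] x by blast
    moreover from this have "y = x" using \<open>K \<subseteq> L\<close> x Z 0(5) unfolding thin_def by auto
    ultimately show "x \<in> K" by simp
  qed
  ultimately show ?case by simp
next
  case (Suc n)
  have fin: "finite (K - L)" using Suc.prems(1) assms(3) finite_subset by blast
  from Suc(2) obtain a where a: "a \<in> K" "a \<notin> L" by (metis card.empty nat.distinct(1) DiffE ex_in_conv)
  then obtain Z where Z: "Z \<in> \<C>" "a \<in> Z" using Suc.prems(1) partition_onD1[OF assms(2)] by blast
  then obtain b where b: "b \<in> Z" "b \<in> L" using Suc.prems(5)[of Z] a by blast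
  have uniq: "Y = Z" if "Y \<in> \<C>" "a \<in> Y \<or> b \<in> Y" for Y
    using that Z b partition_onD2[OF assms(2)] by (auto simp: disjoint_def)
  have KZ: "K \<inter> Z = {a}" using Suc.prems(3) a Z unfolding thin_def by blast
  have nb: "b \<notin> K" using KZ a b by auto
  define K' where "K' = insert b (K - {a})"
  have "part_rel \<C> a b" using Z b unfolding part_rel_def by blast
  then have "contract a \<phi> = contract b \<phi>" using \<phi> unfolding state_space_def by blast
  then have "contract a \<phi> (K - {a}) = contract b \<phi> (K - {a})" by simp
  then have "\<phi> K = \<phi> K'" using a nb by (simp add: contract_def K'_def insert_absorb)
  moreover have "\<phi> K' = \<phi> L"
  proof (rule Suc.hyps(1))
    have "K' - L = (K - L) - {a}" using b by (auto simp: K'_def)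
    then show "n = card (K' - L)" using Suc(2) a fin by simp
    show "K' \<subseteq> E" using Suc.prems(1,2) b by (auto simp: K'_def)
    show "thin \<C> K'"
      unfolding thin_def
    proof (intro ballI)
      fix Y x y assume xy: "Y \<in> \<C>" "x \<in> K' \<inter> Y" "y \<in> K' \<inter> Y"
      show "x = y"
      proof (cases "Y = Z")
        case True
        then show ?thesis using xy KZ by (auto simp: K'_def)
      next
        case False
        then have "x \<in> K \<inter> Y" "y \<in> K \<inter> Y" using xy uniq[of Y] by (auto simp: K'_def)
        then show ?thesis using Suc.prems(3) xy(1) unfolding thin_def by blast
      qed
    qed
    show "Y \<inter> K' = {} \<longleftrightarrow> Y \<inter> L = {}" if "Y \<in> \<C>" for Y
    proof (cases "Y = Z")
      case True
      then show ?thesis using b by (auto simp: K'_def)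
    next
      case False
      then have "Y \<inter> K' = Y \<inter> K" using uniq[of Y] that by (auto simp: K'_def)
      then show ?thesis using Suc.prems(5)[OF that] by simp
    qed
  qed (use Suc.prems in auto)
  ultimately show ?case by simp
qed

text \<open>Together with \<open>encode_transversal\<close> this identifies the coefficients at
  labellings with the state space. Thin sets are exchanged for transversals, and on all other sets a
  member of the state space is 0.\<close>

lemma encode_dec:
  assumes \<phi>: "\<phi> \<in> state_space E (part_rel \<C>)" and part: "partition_on E \<C>" and "finite E"
    and c: "\<And>l. l \<in> \<C> \<rightarrow>\<^sub>E UNIV \<Longrightarrow> c l = \<phi> (transversal \<C> l)"
  shows "encode E \<C> c = \<phi>"
proof
  fix K
  show "encode E \<C> c K = \<phi> K"
  proof (cases "K \<subseteq> E \<and> thin \<C> K")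
    case True
    have "\<phi> (transversal \<C> (lab_of \<C> K)) = \<phi> K"
    proof (rule state_space_exchange[OF \<phi> part \<open>finite E\<close>])
      show "Z \<inter> transversal \<C> (lab_of \<C> K) = {} \<longleftrightarrow> Z \<inter> K = {}" if "Z \<in> \<C>" for Z
        using transversal_Int[OF part that, of "lab_of \<C> K"] that by (auto simp: lab_of_def Int_commute)
    qed (use True transversal_sub[OF part] thin_transversal[OF part] in auto)
    then show ?thesis using True c[OF lab_of_in] by (simp add: encode_def)
  next
    case False
    have "\<phi> K = 0"
    proof (cases "K \<subseteq> E")
      case True
      then obtain Z a b where Z: "Z \<in> \<C>" "a \<in> K \<inter> Z" "b \<in> K \<inter> Z" "a \<noteq> b"
        using False unfolding thin_def by blast
      then have "part_rel \<C> a b" unfolding part_rel_def by blast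
      \<comment> \<open>Two edges on one circle multiply to 0: exchanging \<open>a\<close> for
        \<open>b\<close> produces a square.\<close>
      then have "contract a \<phi> = contract b \<phi>" using \<phi> unfolding state_space_def by blast
      then have "contract a \<phi> (K - {a}) = contract b \<phi> (K - {a})" by simp
      then show ?thesis using Z by (simp add: contract_def insert_absorb)
    qed (use \<phi> in \<open>unfold state_space_def, blast\<close>)
    then show ?thesis using False by (auto simp: encode_def)
  qed
qed

text \<open>A thin set meets \<open>card K\<close> circles, each in a single edge; these carry the
  label 1 and the remaining ones the label \<open>x\<close>. Thus, for a fixed number of circles,
  the grading becomes the cardinality of \<open>K\<close>.\<close>

lemma gen_deg_lab_of:
  assumes "partition_on E \<C>" "finite E" "K \<subseteq> E" "thin \<C> K"
  shows "(\<Sum>Z\<in>\<C>. gen_deg (lab_of \<C> K Z)) = 2 * int (card K) - int (card \<C>)"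
proof -
  have fin: "finite \<C>" using assms(1,2) by (simp add: finite_elements)
  have "(\<Sum>Z\<in>\<C>. gen_deg (lab_of \<C> K Z)) = (\<Sum>Z\<in>\<C>. 2 * int (card (K \<inter> Z)) - 1)"
  proof (rule sum.cong)
    fix Z assume Z: "Z \<in> \<C>"
    show "gen_deg (lab_of \<C> K Z) = 2 * int (card (K \<inter> Z)) - 1"
    proof (cases "Z \<inter> K = {}")
      case True
      then show ?thesis using Z by (simp add: lab_of_def Int_commute)
    next
      case False
      then obtain a where "K \<inter> Z = {a}" using assms(4) Z unfolding thin_def by blast
      then show ?thesis using Z by (auto simp: lab_of_def)
    qed
  qed simp
  also have "\<dots> = 2 * int (\<Sum>Z\<in>\<C>. card (K \<inter> Z)) - int (card \<C>)"
    by (simp add: sum_subtractf sum_distrib_left)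
  also have "(\<Sum>Z\<in>\<C>. card (K \<inter> Z)) = card (\<Union>Z\<in>\<C>. K \<inter> Z)"
    using assms(2,3) partition_onD2[OF assms(1)] fin
    by (subst card_UN_disjoint) (auto simp: disjoint_def intro: finite_subset)
  also have "(\<Union>Z\<in>\<C>. K \<inter> Z) = K" using assms(3) partition_onD1[OF assms(1)] by auto
  finally show ?thesis .
qed

lemma state_spaceD: "\<phi> \<in> state_space E R \<Longrightarrow> R a b \<Longrightarrow> contract a \<phi> = contract b \<phi>"
  by (simp add: state_space_def)

lemma state_space_supp: "\<phi> \<in> state_space E R \<Longrightarrow> \<phi> K \<noteq> 0 \<Longrightarrow> K \<subseteq> E"
  by (simp add: state_space_def)

lemma state_spaceI:
  assumes "\<And>K. \<phi> K \<noteq> 0 \<Longrightarrow> K \<subseteq> E" "\<And>a b. R a b \<Longrightarrow> contract a \<phi> = contract b \<phi>"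
  shows "\<phi> \<in> state_space E R"
  using assms by (simp add: state_space_def)

text \<open>By exchange of edges it is enough to test on sets of representatives of the circles.
  Taking \<open>p\<close> and \<open>q\<close> as representatives of \<open>P1\<close> and
  \<open>P2\<close> makes the computations for fusion and splitting explicit.\<close>

lemma state_space_eqI:
  assumes \<phi>: "\<phi> \<in> state_space E (part_rel \<C>)" and \<psi>: "\<psi> \<in> state_space E (part_rel \<C>)"
    and part: "partition_on E \<C>" and "finite E"
    and P: "P1 \<in> \<C>" "P2 \<in> \<C>" "p \<in> P1" "q \<in> P2"
    and eq: "\<And>K. K \<subseteq> E \<Longrightarrow> thin \<C> K \<Longrightarrow> K \<inter> P1 \<subseteq> {p} \<Longrightarrow> P1 = P2 \<or> K \<inter> P2 \<subseteq> {q} \<Longrightarrow> \<phi> K = \<psi> K"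
  shows "\<phi> = \<psi>"
proof
  fix K
  \<comment> \<open>If \<open>P1 = P2\<close>, the representative is \<open>p\<close>; this is why
    \<open>eq\<close> restricts \<open>K \<inter> P2\<close> only for different blocks.\<close>
  define r where "r Z = (if Z = P1 then p else if Z = P2 then q else SOME a. a \<in> Z)" for Z
  have r: "r Z \<in> Z" if "Z \<in> \<C>" for Z
    using that P some_in_part[OF part that] by (auto simp: r_def)
  have r_eq: "Y = Z" if "Y \<in> \<C>" "Z \<in> \<C>" "r Y \<in> Z" for Y Z
    using that r[of Y] partition_onD2[OF part] unfolding disjoint_def by blast
  show "\<phi> K = \<psi> K"
  proof (cases "K \<subseteq> E \<and> thin \<C> K")
    case True
    define L where "L = r ` {Z \<in> \<C>. Z \<inter> K \<noteq> {}}"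
    have LZ: "L \<inter> Z \<subseteq> {r Z}" if "Z \<in> \<C>" for Z
      using r_eq that by (auto simp: L_def)
    have L: "L \<subseteq> E"
      using r partition_onD1[OF part] by (auto simp: L_def)
    have thL: "thin \<C> L"
      unfolding thin_def
    proof (intro ballI)
      fix Z a b assume "Z \<in> \<C>" "a \<in> L \<inter> Z" "b \<in> L \<inter> Z"
      then have "a = r Z" "b = r Z" using LZ by blast+
      then show "a = b" by simp
    qed
    have "Z \<inter> K = {} \<longleftrightarrow> Z \<inter> L = {}" if "Z \<in> \<C>" for Z
    proof
      assume "Z \<inter> K = {}"
      then show "Z \<inter> L = {}" using that r_eq by (auto simp: L_def)
    next
      assume *: "Z \<inter> L = {}"
      show "Z \<inter> K = {}"
      proof (rule ccontr)
        assume "Z \<inter> K \<noteq> {}"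
        then have "r Z \<in> L" using that by (auto simp: L_def)
        then show False using * r[OF that] by blast
      qed
    qed
    then have "\<phi> K = \<phi> L" "\<psi> K = \<psi> L"
      using state_space_exchange[OF \<phi> part \<open>finite E\<close>] state_space_exchange[OF \<psi> part \<open>finite E\<close>] True L thL by metis+
    moreover have "\<phi> L = \<psi> L"
    proof (rule eq[OF L thL])
      show "L \<inter> P1 \<subseteq> {p}" using LZ[OF P(1)] by (simp add: r_def)
      show "P1 = P2 \<or> L \<inter> P2 \<subseteq> {q}" using LZ[OF P(2)] by (cases "P1 = P2") (simp_all add: r_def)
    qed
    ultimately show ?thesis by simp
  next
    case False
    have "\<phi> K = 0" if "\<phi> \<in> state_space E (part_rel \<C>)" for \<phi>
      using False encode_dec[OF that part \<open>finite E\<close> refl] by (metis encode_def)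
    then show ?thesis using \<phi> \<psi> by metis
  qed
qed

section \<open>Fusions and splittings of circles\<close>

definition saddle_coeff :: "'e set set \<Rightarrow> 'e set set \<Rightarrow> 'e set set \<Rightarrow> ('e set \<Rightarrow> gen) \<Rightarrow> ('e set \<Rightarrow> gen) \<Rightarrow> bit" where
  "saddle_coeff \<C> T T' l l' =
      of_bool
        ((\<forall>Z\<in>\<C> - T. l' Z = l Z) \<and>
         ((\<exists>Z1 Z2 Z. Z1 \<noteq> Z2 \<and> T = {Z1, Z2} \<and> T' = {Z} \<and> l' Z \<in> vmult (l Z1) (l Z2)) \<or>
          (\<exists>Z Z1 Z2. Z1 \<noteq> Z2 \<and> T = {Z} \<and> T' = {Z1, Z2} \<and> (l' Z1, l' Z2) \<in> vcomult (l Z))))"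

text \<open>
  \<open>s\<close> and \<open>s'\<close> tell whether \<open>p\<close> and \<open>q\<close> lie on the same circle before and after the change of smoothing.
\<close>

definition saddle_map :: "bool \<Rightarrow> bool \<Rightarrow> 'e \<Rightarrow> 'e \<Rightarrow> ('e set \<Rightarrow> bit) \<Rightarrow> 'e set \<Rightarrow> bit" where
  "saddle_map s s' p q \<phi> K =
    (if \<not> s \<and> s' then contract p \<phi> K + contract q \<phi> K else if s \<and> \<not> s' then \<phi> K else 0)"

lemma vmult_comm: "vmult g h = vmult h g"
  by (cases g; cases h) auto

lemma vcomult_comm: "(g, h) \<in> vcomult k \<longleftrightarrow> (h, g) \<in> vcomult k"
  by (cases g; cases h; cases k) auto

text \<open>\<open>saddle_coeff\<close> admits either numbering of the two circles; by commutativity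
  of the product both give the same condition.\<close>

lemma saddle_coeff_merge:
  assumes "P1 \<noteq> P2"
  shows "saddle_coeff \<C> {P1, P2} {Z} l l' = of_bool ((\<forall>Y\<in>\<C> - {P1, P2}. l' Y = l Y) \<and> l' Z \<in> vmult (l P1) (l P2))"
proof -
  have "(\<exists>Z1 Z2 Z'. Z1 \<noteq> Z2 \<and> {P1, P2} = {Z1, Z2} \<and> {Z} = {Z'} \<and> l' Z' \<in> vmult (l Z1) (l Z2)) \<longleftrightarrow>
      l' Z \<in> vmult (l P1) (l P2)"
    using assms vmult_comm[of "l P1" "l P2"] by (auto simp: doubleton_eq_iff)
  moreover have "\<not> (\<exists>Z' Z1 Z2. Z1 \<noteq> Z2 \<and> {P1, P2} = {Z'} \<and> {Z} = {Z1, Z2} \<and> (l' Z1, l' Z2) \<in> vcomult (l Z'))"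
    using assms by auto
  ultimately show ?thesis unfolding saddle_coeff_def by simp
qed

lemma saddle_coeff_split:
  assumes "P1 \<noteq> P2"
  shows "saddle_coeff \<C> {Z} {P1, P2} l l' = of_bool ((\<forall>Y\<in>\<C> - {Z}. l' Y = l Y) \<and> (l' P1, l' P2) \<in> vcomult (l Z))"
proof -
  have "(\<exists>Z' Z1 Z2. Z1 \<noteq> Z2 \<and> {Z} = {Z'} \<and> {P1, P2} = {Z1, Z2} \<and> (l' Z1, l' Z2) \<in> vcomult (l Z')) \<longleftrightarrow>
      (l' P1, l' P2) \<in> vcomult (l Z)"
    using assms vcomult_comm[of "l' P1" "l' P2" "l Z"] by (auto simp: doubleton_eq_iff)
  moreover have "\<not> (\<exists>Z1 Z2 Z'. Z1 \<noteq> Z2 \<and> {Z} = {Z1, Z2} \<and> {P1, P2} = {Z'} \<and> l' Z' \<in> vmult (l Z1) (l Z2))"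
    using assms by auto
  ultimately show ?thesis unfolding saddle_coeff_def by simp
qed

text \<open>A fusion and a splitting both change the number of circles involved.\<close>

lemma saddle_coeff_other:
  assumes "card T = card T'"
  shows "saddle_coeff \<C> T T' l l' = 0"
proof -
  have "card T \<noteq> card T'"
    if "\<exists>Z1 Z2 Z. Z1 \<noteq> Z2 \<and> T = {Z1, Z2} \<and> T' = {Z} \<and> l' Z \<in> vmult (l Z1) (l Z2)"
    using that by (elim exE conjE) simp
  moreover have "card T \<noteq> card T'"
    if "\<exists>Z Z1 Z2. Z1 \<noteq> Z2 \<and> T = {Z} \<and> T' = {Z1, Z2} \<and> (l' Z1, l' Z2) \<in> vcomult (l Z)"
    using that by (elim exE conjE) simp
  ultimately show ?thesis using assms unfolding saddle_coeff_def of_bool_eq_0_iff by argo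
qed

lemma sum_of_bool_mult:
  assumes "finite X"
  shows "(\<Sum>l\<in>X. of_bool (Q l) * c l) = (\<Sum>l\<in>{l\<in>X. Q l}. c l :: bit)"
  using assms by (auto simp: sum.If_cases of_bool_def if_distrib[of "\<lambda>x. x * _"] Int_def cong: if_cong)

lemma vmult_Vx: "Vx \<in> vmult g h \<longleftrightarrow> g = V1 \<and> h = Vx \<or> g = Vx \<and> h = V1"
  by (cases g; cases h) auto

lemma vmult_V1: "V1 \<in> vmult g h \<longleftrightarrow> g = V1 \<and> h = V1"
  by (cases g; cases h) auto

text \<open>Two systems of circles that differ only in the circles through \<open>p\<close> and
  \<open>q\<close>. \<open>P1\<close> and \<open>P2\<close> may coincide, and so may
  \<open>P1'\<close> and \<open>P2'\<close>, so that fusion, splitting and the case of one circle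
  becoming one circle are treated together.\<close>

locale saddle =
  fixes E :: "'e set" and \<C> \<C>' :: "'e set set" and P1 P2 P1' P2' p q
  assumes fin: "finite E" and part: "partition_on E \<C>" and part': "partition_on E \<C>'"
    and P: "P1 \<in> \<C>" "P2 \<in> \<C>" "p \<in> P1" "q \<in> P2"
    and P': "P1' \<in> \<C>'" "P2' \<in> \<C>'" "p \<in> P1'" "q \<in> P2'"
    and off: "\<C> - {P1, P2} = \<C>' - {P1', P2'}"
begin

lemma uniq: "Y \<in> \<C> \<Longrightarrow> Z \<in> \<C> \<Longrightarrow> x \<in> Y \<Longrightarrow> x \<in> Z \<Longrightarrow> Y = Z"
  using partition_onD2[OF part] unfolding disjoint_def by blast

lemma uniq': "Y \<in> \<C>' \<Longrightarrow> Z \<in> \<C>' \<Longrightarrow> x \<in> Y \<Longrightarrow> x \<in> Z \<Longrightarrow> Y = Z"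
  using partition_onD2[OF part'] unfolding disjoint_def by blast

lemma off1:
  assumes "Y \<in> \<C>" "Y \<noteq> P1" "Y \<noteq> P2"
  shows "Y \<in> \<C>'" "Y \<noteq> P1'" "Y \<noteq> P2'" "p \<notin> Y" "q \<notin> Y"
proof -
  have "Y \<in> \<C>' - {P1', P2'}" using assms by (simp flip: off)
  then show "Y \<in> \<C>'" "Y \<noteq> P1'" "Y \<noteq> P2'" by auto
  show "p \<notin> Y" using assms uniq P by metis
  show "q \<notin> Y" using assms uniq P by metis
qed

lemma off2:
  assumes "Y \<in> \<C>'" "Y \<noteq> P1'" "Y \<noteq> P2'"
  shows "Y \<in> \<C>"
proof -
  have "Y \<in> \<C> - {P1, P2}" using assms by (simp add: off)
  then show ?thesis by auto
qed

text \<open>Both sides are what remains of \<open>E\<close> after the common circles are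
  removed.\<close>

lemma union: "P1 \<union> P2 = P1' \<union> P2'"
proof -
  have "P1 \<union> P2 = E - \<Union>(\<C> - {P1, P2})"
    using uniq P partition_onD1[OF part] by blast
  moreover have "P1' \<union> P2' = E - \<Union>(\<C>' - {P1', P2'})"
    using uniq' P' partition_onD1[OF part'] by blast
  ultimately show ?thesis using off by simp
qed

lemma pqE: "p \<in> E" "q \<in> E"
  using P partition_onD1[OF part] by auto

lemma finite_lab: "finite (\<C> \<rightarrow>\<^sub>E (UNIV :: gen set))"
proof -
  have "(UNIV :: gen set) = {V1, Vx}" using gen.exhaust by blast
  then have "finite (UNIV :: gen set)" by (metis finite.simps)
  then show ?thesis using part fin by (intro finite_PiE) (auto simp: finite_elements)
qed

text \<open>A fused circle labelled \<open>x\<close> comes from the label pairs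
  \<open>(1, x)\<close> and \<open>(x, 1)\<close>, which are tested by adding \<open>p\<close> or
  \<open>q\<close> to \<open>K\<close>. A fused circle labelled 1 comes only from
  \<open>(1, 1)\<close>, which is tested by adding \<open>q\<close> to a set that contains
  \<open>p\<close>; the contraction with \<open>p\<close> is then 0. Both cases are the contraction
  with \<open>p + q\<close>.\<close>

lemma encode_merge:
  assumes "P1 \<noteq> P2" "P1' = P2'"
  shows "encode E \<C>' (\<lambda>l'. \<Sum>l\<in>\<C> \<rightarrow>\<^sub>E UNIV. saddle_coeff \<C> {P1, P2} {P1', P2'} l l' * c l) =
    (\<lambda>K. contract p (encode E \<C> c) K + contract q (encode E \<C> c) K)"
    (is "encode E \<C>' ?c' = ?\<psi>")
proof (rule state_space_eqI[OF encode_in_state_space[OF part'] _ part' fin P'])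
  let ?\<phi> = "encode E \<C> c"
  have \<phi>: "?\<phi> \<in> state_space E (part_rel \<C>)" by (rule encode_in_state_space[OF part])
  have cls: "contract a ?\<phi> = contract b ?\<phi>" if "Z \<in> \<C>" "a \<in> Z" "b \<in> Z" for a b Z
  proof -
    have "part_rel \<C> a b" using that by (auto simp: part_rel_def)
    then show ?thesis by (rule state_spaceD[OF \<phi>])
  qed
  show "?\<psi> \<in> state_space E (part_rel \<C>')"
  proof (rule state_spaceI)
    fix K assume "?\<psi> K \<noteq> 0"
    then have "contract p ?\<phi> K \<noteq> 0 \<or> contract q ?\<phi> K \<noteq> 0" by auto
    then have "insert p K \<subseteq> E \<or> insert q K \<subseteq> E"
      using state_space_supp[OF \<phi>] unfolding contract_def by metis
    then show "K \<subseteq> E" by auto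
  next
    fix a b assume "part_rel \<C>' a b"
    then obtain Z where Z: "Z \<in> \<C>'" "a \<in> Z" "b \<in> Z" by (auto simp: part_rel_def)
    show "contract a ?\<psi> = contract b ?\<psi>"
    proof (cases "Z = P1'")
      case False
      then have "Z \<in> \<C>" using Z off2 assms by blast
      then have "contract a ?\<phi> = contract b ?\<phi>" using cls Z by blast
      then show ?thesis by (simp add: contract_add contract_commute[of _ p] contract_commute[of _ q])
    next
      case True
      \<comment> \<open>For \<open>a\<close> on either circle one of the two terms is a square and
        vanishes; the other is the contraction with \<open>p\<close> and \<open>q\<close>.\<close>
      have "contract a ?\<psi> = (\<lambda>K. contract p (contract q ?\<phi>) K)" if "a \<in> P1 \<union> P2" for a
      proof -
        from that have "contract a ?\<phi> = contract p ?\<phi> \<or> contract a ?\<phi> = contract q ?\<phi>" using cls P by blast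
        then show ?thesis
          by (auto simp: contract_add contract_commute[of a p] contract_commute[of a q] contract_commute[of q p])
      qed
      then show ?thesis using Z True union assms by auto
    qed
  qed
  fix K assume K: "K \<subseteq> E" "thin \<C>' K" "K \<inter> P1' \<subseteq> {p}"
  let ?l' = "lab_of \<C>' K"
  have nq: "p \<notin> P2" "q \<notin> P1" using assms P uniq by blast+
  have qK: "q \<notin> K" using K(3) P' assms nq P by auto
  have P12: "P1 \<inter> K = (if p \<in> K then {p} else {})" "P2 \<inter> K = {}"
    using K(3) union nq P assms by auto
  note off' = off1
  have thin: "thin \<C> (insert x K)" if "x = q \<or> x = p \<and> p \<notin> K" for x
    unfolding thin_def
  proof (intro ballI)
    fix Y y z assume Y: "Y \<in> \<C>" "y \<in> insert x K \<inter> Y" "z \<in> insert x K \<inter> Y"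
    have "K \<inter> P1 \<subseteq> {p}" "K \<inter> P2 = {}" using P12 by (auto split: if_splits)
    then have sub: "insert x K \<inter> P1 \<subseteq> {p}" "insert x K \<inter> P2 \<subseteq> {x}" using that nq by auto
    consider "Y = P1" | "Y = P2" | "Y \<noteq> P1" "Y \<noteq> P2" by blast
    then show "y = z"
    proof cases
      case 1
      then have "y = p" "z = p" using Y sub by blast+
      then show ?thesis by simp
    next
      case 2
      then have "y = x" "z = x" using Y sub by blast+
      then show ?thesis by simp
    next
      case 3
      then have "y \<in> K \<inter> Y" "z \<in> K \<inter> Y" using Y that off'[OF Y(1)] by auto
      then show ?thesis using K(2) off'[OF Y(1) 3] unfolding thin_def by blast
    qed
  qed
  have val: "lab_of \<C> (insert x K) Y = ?l' Y" if "Y \<in> \<C>" "Y \<noteq> P1" "Y \<noteq> P2" "x = p \<or> x = q" for x Y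
    using off'[OF that(1-3)] that by (auto simp: lab_of_def)
  have labp: "lab_of \<C> (insert p K) P1 = V1" "lab_of \<C> (insert p K) P2 = Vx"
    using P nq P12 by (auto simp: lab_of_def)
  have labq: "lab_of \<C> (insert q K) P2 = V1" "lab_of \<C> (insert q K) P1 = (if p \<in> K then V1 else Vx)"
    using P nq P12 by (auto simp: lab_of_def split: if_splits)
  have eqI: "l = lab_of \<C> (insert x K)"
    if "l \<in> \<C> \<rightarrow>\<^sub>E UNIV" "\<forall>Y\<in>\<C> - {P1, P2}. ?l' Y = l Y" "x = p \<or> x = q"
      "l P1 = lab_of \<C> (insert x K) P1" "l P2 = lab_of \<C> (insert x K) P2" for l x
  proof (rule PiE_ext[OF that(1) lab_of_in])
    fix Y assume "Y \<in> \<C>"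
    then show "l Y = lab_of \<C> (insert x K) Y" using that val by (cases "Y = P1 \<or> Y = P2") auto
  qed
  have enc1: "?\<phi> (insert x K) = c (lab_of \<C> (insert x K))" if "x = q \<or> x = p \<and> p \<notin> K" for x
    using thin[OF that] that K(1) pqE by (auto simp: encode_def)
  have "encode E \<C>' ?c' K = ?c' ?l'" using K by (simp add: encode_def)
  also have "\<dots> = (\<Sum>l\<in>{l \<in> \<C> \<rightarrow>\<^sub>E UNIV. (\<forall>Y\<in>\<C> - {P1, P2}. ?l' Y = l Y) \<and> ?l' P1' \<in> vmult (l P1) (l P2)}. c l)"
    unfolding assms(2)[symmetric] insert_absorb2 saddle_coeff_merge[OF assms(1)]
    by (rule sum_of_bool_mult[OF finite_lab])
  also have "\<dots> = ?\<psi> K"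
  proof (cases "p \<in> K")
    case True
    have l': "?l' P1' = V1" using True P' by (auto simp: lab_of_def)
    have "{l \<in> \<C> \<rightarrow>\<^sub>E UNIV. (\<forall>Y\<in>\<C> - {P1, P2}. ?l' Y = l Y) \<and> ?l' P1' \<in> vmult (l P1) (l P2)} =
        {lab_of \<C> (insert q K)}" (is "?A = ?B")
    proof
      show "?A \<subseteq> ?B" using eqI labq True by (auto simp: l' vmult_V1)
      show "?B \<subseteq> ?A" using labq True val by (simp add: l' vmult_V1 lab_of_in)
    qed
    then show ?thesis using enc1[of q] True qK by (simp add: contract_def)
  next
    case False
    have l': "?l' P1' = Vx" using False P' K(3) by (auto simp: lab_of_def)
    have "{l \<in> \<C> \<rightarrow>\<^sub>E UNIV. (\<forall>Y\<in>\<C> - {P1, P2}. ?l' Y = l Y) \<and> ?l' P1' \<in> vmult (l P1) (l P2)} =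
        {lab_of \<C> (insert p K), lab_of \<C> (insert q K)}" (is "?A = ?B")
    proof
      show "?A \<subseteq> ?B" using eqI labp labq False by (auto simp: l' vmult_Vx)
      show "?B \<subseteq> ?A" using labp labq False val by (simp add: l' vmult_Vx lab_of_in)
    qed
    moreover have "lab_of \<C> (insert p K) \<noteq> lab_of \<C> (insert q K)"
      using labp labq False by (metis gen.distinct(1))
    ultimately show ?thesis using enc1[of q] enc1[of p] False qK by (simp add: contract_def)
  qed
  finally show "encode E \<C>' ?c' K = ?\<psi> K" .
qed

text \<open>The relations of the two new circles follow from those of the old one, so the old state
  space is contained in the new one. The map is this inclusion: the label 1 gives
  \<open>(1, x)\<close> and \<open>(x, 1)\<close>, tested by sets that contain exactly one of
  \<open>p\<close> and \<open>q\<close>, and \<open>x\<close> gives \<open>(x, x)\<close>, tested by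
  sets that contain neither.\<close>

lemma encode_split:
  assumes "P1 = P2" "P1' \<noteq> P2'"
  shows "encode E \<C>' (\<lambda>l'. \<Sum>l\<in>\<C> \<rightarrow>\<^sub>E UNIV. saddle_coeff \<C> {P1, P2} {P1', P2'} l l' * c l) = encode E \<C> c"
    (is "encode E \<C>' ?c' = ?\<phi>")
proof (rule state_space_eqI[OF encode_in_state_space[OF part'] _ part' fin P'])
  have \<phi>: "?\<phi> \<in> state_space E (part_rel \<C>)" by (rule encode_in_state_space[OF part])
  have sub: "part_rel \<C> a b" if ab: "part_rel \<C>' a b" for a b
  proof -
    obtain Z where Z: "Z \<in> \<C>'" "a \<in> Z" "b \<in> Z" using ab by (auto simp: part_rel_def)
    show ?thesis
    proof (cases "Z = P1' \<or> Z = P2'")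
      case True
      then have "a \<in> P1" "b \<in> P1" using Z union assms(1) by auto
      then show ?thesis using P(1) unfolding part_rel_def by blast
    next
      case False
      then show ?thesis using Z off2 by (auto simp: part_rel_def)
    qed
  qed
  show "?\<phi> \<in> state_space E (part_rel \<C>')"
    by (rule state_spaceI[OF state_space_supp[OF \<phi>] state_spaceD[OF \<phi> sub]])
  fix K assume K: "K \<subseteq> E" "thin \<C>' K" "K \<inter> P1' \<subseteq> {p}" "P1' = P2' \<or> K \<inter> P2' \<subseteq> {q}"
  let ?l' = "lab_of \<C>' K"
  have un: "P1 = P1' \<union> P2'" using union assms by simp
  have pq: "p \<notin> P2'" "q \<notin> P1'" using uniq' P' assms by metis+
  then have "p \<noteq> q" using P' by blast
  note pq = pq this
  have off': "Y \<in> \<C>'" "Y \<noteq> P1'" "Y \<noteq> P2'" if "Y \<in> \<C>" "Y \<noteq> P1" for Y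
    using that off1 assms by auto
  have l'1: "?l' P1' = (if p \<in> K then V1 else Vx)" and l'2: "?l' P2' = (if q \<in> K then V1 else Vx)"
    using K P' pq assms by (auto simp: lab_of_def)
  have "encode E \<C>' ?c' K = ?c' ?l'" using K by (simp add: encode_def)
  also have "\<dots> = (\<Sum>l\<in>{l \<in> \<C> \<rightarrow>\<^sub>E UNIV. (\<forall>Y\<in>\<C> - {P1}. ?l' Y = l Y) \<and> (?l' P1', ?l' P2') \<in> vcomult (l P1)}. c l)"
    unfolding assms(1)[symmetric] insert_absorb2 saddle_coeff_split[OF assms(2)]
    by (rule sum_of_bool_mult[OF finite_lab])
  also have "\<dots> = ?\<phi> K"
  proof (cases "p \<in> K \<and> q \<in> K")
    case True
    \<comment> \<open>The pair \<open>(1, 1)\<close> occurs in no coproduct; on the other side, a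
      set with \<open>p\<close> and \<open>q\<close> meets the undivided circle twice.\<close>
    have "(V1, V1) \<notin> vcomult g" for g by (cases g) auto
    then have "{l \<in> \<C> \<rightarrow>\<^sub>E UNIV. (\<forall>Y\<in>\<C> - {P1}. ?l' Y = l Y) \<and> (?l' P1', ?l' P2') \<in> vcomult (l P1)} = {}"
      using True by (simp add: l'1 l'2)
    moreover have "\<not> thin \<C> K"
      unfolding thin_def using True P assms pq by blast
    ultimately show ?thesis by (simp only: encode_def sum.empty simp_thms if_False)
  next
    case False
    note nboth = False
    have com: "(?l' P1', ?l' P2') \<in> vcomult g \<longleftrightarrow> g = (if p \<in> K \<or> q \<in> K then V1 else Vx)" for g
      using False by (cases g) (auto simp: l'1 l'2)
    have PK: "P1 \<inter> K = {p} \<inter> K \<union> {q} \<inter> K" using K(3,4) assms P P' un by auto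
    have lab1: "lab_of \<C> K P1 = (if p \<in> K \<or> q \<in> K then V1 else Vx)"
      using PK P(1) by (auto simp: lab_of_def)
    have "{l \<in> \<C> \<rightarrow>\<^sub>E UNIV. (\<forall>Y\<in>\<C> - {P1}. ?l' Y = l Y) \<and> (?l' P1', ?l' P2') \<in> vcomult (l P1)} =
      {lab_of \<C> K}" (is "?A = ?B")
    proof
      show "?A \<subseteq> ?B"
      proof
        fix l assume l: "l \<in> ?A"
        have "l = lab_of \<C> K"
        proof (rule PiE_ext[OF _ lab_of_in])
          fix Y assume Y: "Y \<in> \<C>"
          show "l Y = lab_of \<C> K Y"
          proof (cases "Y = P1")
            case True
            have "l P1 = (if p \<in> K \<or> q \<in> K then V1 else Vx)" using l by (simp add: com)
            then show ?thesis using True lab1 by simp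
          next
            case False
            then have "l Y = ?l' Y" using l Y by auto
            then show ?thesis using off'[OF Y False] Y by (simp add: lab_of_def)
          qed
        qed (use l in auto)
        then show "l \<in> ?B" by simp
      qed
      have "?l' Y = lab_of \<C> K Y" if "Y \<in> \<C>" "Y \<noteq> P1" for Y
        using off'[OF that] that by (simp add: lab_of_def)
      then show "?B \<subseteq> ?A"
        using lab1 by (simp add: com lab_of_in)
    qed
    moreover have "thin \<C> K"
      unfolding thin_def
    proof (intro ballI)
      fix Y y z assume Y: "Y \<in> \<C>" "y \<in> K \<inter> Y" "z \<in> K \<inter> Y"
      show "y = z"
      proof (cases "Y = P1")
        case True
        then have "y \<in> {p} \<inter> K \<union> {q} \<inter> K" "z \<in> {p} \<inter> K \<union> {q} \<inter> K"
          using Y(2,3) unfolding PK[symmetric] by auto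
        then show ?thesis using nboth by auto
      next
        case False
        then show ?thesis using K(2) off'(1)[OF Y(1) False] Y(2,3) unfolding thin_def by blast
      qed
    qed
    ultimately show ?thesis using K(1) by (simp add: encode_def)
  qed
  finally show "encode E \<C>' ?c' K = ?\<phi> K" .
qed

theorem encode_saddle:
  "encode E \<C>' (\<lambda>l'. \<Sum>l\<in>\<C> \<rightarrow>\<^sub>E UNIV. saddle_coeff \<C> {P1, P2} {P1', P2'} l l' * c l) =
    saddle_map (P1 = P2) (P1' = P2') p q (encode E \<C> c)"
proof -
  consider "P1 \<noteq> P2" "P1' = P2'" | "P1 = P2" "P1' \<noteq> P2'" | "(P1 = P2) = (P1' = P2')" by blast
  then show ?thesis
  proof cases
    case 1
    then show ?thesis using encode_merge by (simp add: saddle_map_def fun_eq_iff)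
  next
    case 2
    then show ?thesis using encode_split by (simp add: saddle_map_def fun_eq_iff)
  next
    case 3
    then have "card {P1, P2} = card {P1', P2'}" by (cases "P1 = P2") auto
    then have "saddle_coeff \<C> {P1, P2} {P1', P2'} l l' = 0" for l l' by (rule saddle_coeff_other)
    then show ?thesis using 3 by (auto simp: saddle_map_def encode_def fun_eq_iff)
  qed
qed

end

section \<open>Rotations and mutations\<close>

text \<open>
  A rotation \<open>r\<close> maps a half-edge \<open>(e, b)\<close> with \<open>e \<in> M\<close> to the two other edges at its vertex in
  counterclockwise order. Only the edges are recorded, since at the base of a loop the order
  of the two half-edges does not affect the circles.
\<close>

abbreviation arc_at :: "('e \<times> bool \<Rightarrow> 'e \<times> 'e) \<Rightarrow> bool \<Rightarrow> 'e \<Rightarrow> 'e \<Rightarrow> 'e \<Rightarrow> bool" where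
  "arc_at r s e a b \<equiv> if s
     then {a, b} = {fst (r (e, False)), fst (r (e, True))} \<or> {a, b} = {snd (r (e, False)), snd (r (e, True))}
     else {a, b} = {fst (r (e, False)), snd (r (e, True))} \<or> {a, b} = {snd (r (e, False)), fst (r (e, True))}"

definition arcs :: "'e set \<Rightarrow> 'e set \<Rightarrow> ('e \<times> bool \<Rightarrow> 'e \<times> 'e) \<Rightarrow> 'e \<Rightarrow> 'e \<Rightarrow> bool" where
  "arcs M A r a b \<longleftrightarrow> (\<exists>e\<in>M. arc_at r (e \<in> A) e a b)"

definition rotation :: "('v, 'e) mgraph \<Rightarrow> 'e set \<Rightarrow> ('e \<times> bool \<Rightarrow> 'e \<times> 'e) \<Rightarrow> bool" where
  "rotation G M r \<longleftrightarrow> (\<forall>e\<in>M. \<forall>b. \<exists>x y. half_edges_at G (ends G e b) = {(e, b), x, y} \<and>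
     distinct [(e, b), x, y] \<and> r (e, b) = (fst x, fst y))"

definition crossing :: "('v, 'e) mgraph \<Rightarrow> 'v set \<Rightarrow> 'e \<Rightarrow> bool" where
  "crossing G W e \<longleftrightarrow> (ends G e False \<in> W) \<noteq> (ends G e True \<in> W)"

lemma arcs_sym: "arcs M A r a b \<Longrightarrow> arcs M A r b a"
  unfolding arcs_def by (simp only: insert_commute[of b a])

locale matched =
  fixes G :: "('v, 'e) mgraph" and M :: "'e set"
  assumes triv: "trivalent G" and pm: "perfect_matching G M"
begin

definition rest :: "'e set" where
  "rest = (links G - M) \<union> circs G"

lemma M_links: "M \<subseteq> links G" and M_noloop: "e \<in> M \<Longrightarrow> ends G e False \<noteq> ends G e True"
  and M_ex1: "v \<in> verts G \<Longrightarrow> \<exists>!e. e \<in> M \<and> v \<in> range (ends G e)"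
  using pm by (auto simp: perfect_matching_def)

lemma fin: "finite (links G)" "finite M" "finite rest" and ends_verts: "e \<in> links G \<Longrightarrow> ends G e b \<in> verts G"
  using triv M_links by (auto simp: trivalent_def multigraph_def rest_def intro: finite_subset)

lemma circs_disj: "links G \<inter> circs G = {}"
  using triv by (auto simp: trivalent_def multigraph_def)

lemma M_end_unique:
  assumes "e \<in> M" "f \<in> M" "ends G e b = ends G f c"
  shows "e = f \<and> b = c"
proof -
  have "e = f"
    using M_ex1[OF ends_verts[of e b]] assms M_links by (metis rangeI subsetD)
  moreover have "b = c"
    using assms M_noloop[OF assms(1)] calculation by (cases b; cases c) auto
  ultimately show ?thesis by simp
qed

end

locale rotated = matched G M for G :: "('v, 'e) mgraph" and M +
  fixes r :: "'e \<times> bool \<Rightarrow> 'e \<times> 'e"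
  assumes rot: "rotation G M r"
begin

lemma rot_obtain:
  assumes "e \<in> M"
  obtains c d where "half_edges_at G (ends G e b) = {(e, b), (fst (r (e, b)), c), (snd (r (e, b)), d)}"
    "distinct [(e, b), (fst (r (e, b)), c), (snd (r (e, b)), d)]"
proof -
  obtain x y where "half_edges_at G (ends G e b) = {(e, b), x, y}" "distinct [(e, b), x, y]"
    "r (e, b) = (fst x, fst y)"
    using rot assms unfolding rotation_def by metis
  then show thesis using that[of "snd x" "snd y"] by simp
qed

lemma half_edge_not_M:
  assumes "e \<in> M" "(a, c) \<in> half_edges_at G (ends G e b)" "(a, c) \<noteq> (e, b)"
  shows "a \<in> links G - M"
proof -
  have "a \<in> links G" "ends G a c = ends G e b" using assms by (auto simp: half_edges_at_def)
  then have "a \<notin> M" using M_end_unique[of a e c b] assms(1,3) by blast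
  then show ?thesis using \<open>a \<in> links G\<close> by blast
qed

lemma rot_links:
  assumes "e \<in> M"
  shows "fst (r (e, b)) \<in> links G - M" "snd (r (e, b)) \<in> links G - M"
proof -
  obtain c d where *: "half_edges_at G (ends G e b) = {(e, b), (fst (r (e, b)), c), (snd (r (e, b)), d)}"
    "distinct [(e, b), (fst (r (e, b)), c), (snd (r (e, b)), d)]"
    using rot_obtain[OF assms] .
  have "(fst (r (e, b)), c) \<noteq> (e, b)" "(snd (r (e, b)), d) \<noteq> (e, b)"
    using *(2) unfolding distinct.simps list.set by (metis insertI1 insertI2)+
  then show "fst (r (e, b)) \<in> links G - M" "snd (r (e, b)) \<in> links G - M"
    using half_edge_not_M[OF assms, of _ c b] half_edge_not_M[OF assms, of _ d b]
    unfolding *(1) by blast+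
qed

lemma rot_rest:
  assumes "e \<in> M"
  shows "fst (r (e, b)) \<in> rest" "snd (r (e, b)) \<in> rest"
  using rot_links[OF assms] by (auto simp: rest_def)

lemma rot_touch:
  assumes "e \<in> M"
  shows "\<exists>c. ends G (fst (r (e, b))) c = ends G e b" "\<exists>c. ends G (snd (r (e, b))) c = ends G e b"
proof -
  obtain c d where "half_edges_at G (ends G e b) = {(e, b), (fst (r (e, b)), c), (snd (r (e, b)), d)}"
    using rot_obtain[OF assms] .
  then have "(fst (r (e, b)), c) \<in> half_edges_at G (ends G e b)" "(snd (r (e, b)), d) \<in> half_edges_at G (ends G e b)"
    by auto
  then show "\<exists>c. ends G (fst (r (e, b))) c = ends G e b" "\<exists>c. ends G (snd (r (e, b))) c = ends G e b"
    by (auto simp: half_edges_at_def)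
qed

lemma touch_rot:
  assumes "e \<in> M" "a \<in> links G - M" "ends G a c = ends G e b"
  shows "a = fst (r (e, b)) \<or> a = snd (r (e, b))"
proof -
  obtain c' d where *: "half_edges_at G (ends G e b) = {(e, b), (fst (r (e, b)), c'), (snd (r (e, b)), d)}"
    using rot_obtain[OF assms(1)] .
  have "(a, c) \<in> half_edges_at G (ends G e b)" using assms by (auto simp: half_edges_at_def)
  then show ?thesis using assms(1,2) unfolding * by auto
qed

lemma arcs_rest: "arcs M A r a b \<Longrightarrow> a \<in> rest \<and> b \<in> rest"
  using rot_rest unfolding arcs_def by (auto simp: doubleton_eq_iff split: if_splits)

lemma arcsI:
  assumes "e \<in> M"
  shows "e \<in> A \<Longrightarrow> arcs M A r (fst (r (e, False))) (fst (r (e, True)))"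
    "e \<in> A \<Longrightarrow> arcs M A r (snd (r (e, False))) (snd (r (e, True)))"
    "e \<notin> A \<Longrightarrow> arcs M A r (fst (r (e, False))) (snd (r (e, True)))"
    "e \<notin> A \<Longrightarrow> arcs M A r (snd (r (e, False))) (fst (r (e, True)))"
  using assms unfolding arcs_def by (auto intro!: bexI[of _ e])

text \<open>Every half-edge outside \<open>M\<close> at a vertex of \<open>W\<close> is counted once on the left; on the right,
  the edges with both ends in \<open>W\<close> cancel.\<close>

lemma parity:
  fixes f :: "'e \<Rightarrow> bit"
  assumes W: "W \<subseteq> verts G"
  shows "(\<Sum>h\<in>{h \<in> M \<times> UNIV. ends G (fst h) (snd h) \<in> W}. f (fst (r h)) + f (snd (r h))) =
    (\<Sum>a\<in>{a \<in> links G - M. crossing G W a}. f a)"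
proof -
  define H where "H = {h \<in> M \<times> (UNIV :: bool set). ends G (fst h) (snd h) \<in> W}"
  define X where "X h = half_edges_at G (ends G (fst h) (snd h)) - {h}" for h
  have finH: "finite H" using fin by (auto simp: H_def)
  have XH: "finite (X h) \<and> (\<Sum>k\<in>X h. f (fst k)) = f (fst (r h)) + f (snd (r h))" if "h \<in> H" for h
  proof -
    obtain e b where h: "h = (e, b)" by (cases h)
    then have "e \<in> M" using that by (auto simp: H_def)
    then obtain c d where "half_edges_at G (ends G e b) = {(e, b), (fst (r (e, b)), c), (snd (r (e, b)), d)}"
      "distinct [(e, b), (fst (r (e, b)), c), (snd (r (e, b)), d)]"
      using rot_obtain by blast
    then have "X h = {(fst (r h), c), (snd (r h), d)}" "(fst (r h), c) \<noteq> (snd (r h), d)"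
      by (auto simp: X_def h)
    then show ?thesis by simp
  qed
  have disj: "X h \<inter> X k = {}" if "h \<in> H" "k \<in> H" "h \<noteq> k" for h k
  proof (rule ccontr)
    assume "X h \<inter> X k \<noteq> {}"
    then have "ends G (fst h) (snd h) = ends G (fst k) (snd k)"
      by (auto simp: X_def half_edges_at_def)
    moreover have "fst h \<in> M" "fst k \<in> M" using that by (auto simp: H_def)
    ultimately have "fst h = fst k \<and> snd h = snd k" by (metis M_end_unique)
    then show False using that(3) by (simp add: prod_eq_iff)
  qed
  \<comment> \<open>Every vertex of \<open>W\<close> is the end of exactly one half-edge of
    \<open>M\<close>, so the sets \<open>X h\<close> partition the half-edges outside
    \<open>M\<close> at the vertices of \<open>W\<close>.\<close>
  have UX: "(\<Union>h\<in>H. X h) = {k \<in> (links G - M) \<times> UNIV. ends G (fst k) (snd k) \<in> W}" (is "_ = ?K")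
  proof
    show "(\<Union>h\<in>H. X h) \<subseteq> ?K"
    proof
      fix k assume "k \<in> (\<Union>h\<in>H. X h)"
      then obtain h where h: "h \<in> H" "k \<in> X h" by blast
      then have "fst k \<in> links G - M"
        by (intro half_edge_not_M[of "fst h" "fst k" "snd k" "snd h"]) (auto simp: H_def X_def)
      then show "k \<in> ?K" using h by (auto simp: H_def X_def half_edges_at_def mem_Times_iff)
    qed
    show "?K \<subseteq> (\<Union>h\<in>H. X h)"
    proof
      fix k assume k: "k \<in> ?K"
      then obtain e where e: "e \<in> M" "ends G (fst k) (snd k) \<in> range (ends G e)"
        using M_ex1[of "ends G (fst k) (snd k)"] W by blast
      then obtain b where b: "ends G (fst k) (snd k) = ends G e b" by blast
      then have "(e, b) \<in> H" using e k by (auto simp: H_def)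
      moreover have "k \<in> X (e, b)" using k b e by (cases k) (auto simp: X_def half_edges_at_def)
      ultimately show "k \<in> (\<Union>h\<in>H. X h)" by blast
    qed
  qed
  have "(\<Sum>h\<in>H. f (fst (r h)) + f (snd (r h))) = (\<Sum>h\<in>H. \<Sum>k\<in>X h. f (fst k))"
    using XH by (intro sum.cong) auto
  also have "\<dots> = (\<Sum>k\<in>?K. f (fst k))"
    unfolding UX[symmetric] using finH XH disj by (subst sum.UNION_disjoint) auto
  also have "\<dots> = (\<Sum>k\<in>(links G - M) \<times> UNIV. if ends G (fst k) (snd k) \<in> W then f (fst k) else 0)"
    using fin by (intro sum.inter_filter) auto
  also have "\<dots> = (\<Sum>a\<in>links G - M. \<Sum>b\<in>UNIV. if ends G a b \<in> W then f a else 0)"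
    by (simp add: sum.cartesian_product case_prod_beta cong: if_cong)
  also have "\<dots> = (\<Sum>a\<in>links G - M. if crossing G W a then f a else 0)"
    by (intro sum.cong) (auto simp: UNIV_bool crossing_def)
  also have "\<dots> = (\<Sum>a\<in>{a \<in> links G - M. crossing G W a}. f a)"
    using fin by (intro sum.inter_filter[symmetric]) auto
  finally show ?thesis by (simp add: H_def)
qed

end

locale mutation = rotated G M r for G :: "('v, 'e) mgraph" and M r +
  fixes r' :: "'e \<times> bool \<Rightarrow> 'e \<times> 'e" and W :: "'v set"
  assumes W: "W \<subseteq> verts G"
    and r': "e \<in> M \<Longrightarrow> r' (e, b) = (if ends G e b \<in> W then prod.swap (r (e, b)) else r (e, b))"
begin

text \<open>Looking at one end is enough, since this set is used when no edge outside
  \<open>M\<close> leaves \<open>W\<close>.\<close>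

definition inner :: "'e set" where
  "inner = {a \<in> links G - M. ends G a False \<in> W}"

lemma rot': "rotation G M r'"
  unfolding rotation_def
proof (intro ballI allI)
  fix e b assume e: "e \<in> M"
  then obtain x y where xy: "half_edges_at G (ends G e b) = {(e, b), x, y}" "distinct [(e, b), x, y]"
    "r (e, b) = (fst x, fst y)"
    using rot unfolding rotation_def by metis
  have yx: "half_edges_at G (ends G e b) = {(e, b), y, x}" "distinct [(e, b), y, x]"
    unfolding xy(1) using xy(2) by (simp_all only: insert_commute[of x y] distinct.simps list.set) blast
  show "\<exists>x y. half_edges_at G (ends G e b) = {(e, b), x, y} \<and> distinct [(e, b), x, y] \<and>
      r' (e, b) = (fst x, fst y)"
  proof (cases "ends G e b \<in> W")
    case True
    then have "r' (e, b) = (fst y, fst x)" using r'[OF e, of b] xy(3) by simp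
    then show ?thesis using yx by blast
  next
    case False
    then have "r' (e, b) = (fst x, fst y)" using r'[OF e, of b] xy(3) by simp
    then show ?thesis using xy by blast
  qed
qed

lemma rev: "mutation G M r' r W"
  by unfold_locales (use W rot' r' in auto)

text \<open>Reversing the orders at both ends of an edge exchanges the two arcs of its 0-smoothing,
  and likewise the two arcs of its 1-smoothing.\<close>

lemma arcs_eq:
  assumes "\<And>e. e \<in> M \<Longrightarrow> \<not> crossing G W e"
  shows "arcs M A r' = arcs M A r"
proof (intro ext)
  fix a b
  have "(arc_at r' (e \<in> A) e a b) \<longleftrightarrow>
     (arc_at r (e \<in> A) e a b)"
    if "e \<in> M" for e
    using assms[OF that] r'[OF that] unfolding crossing_def
    by (cases "ends G e False \<in> W"; cases "e \<in> A") auto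
  then show "arcs M A r' a b = arcs M A r a b"
    unfolding arcs_def by (intro bex_cong) auto
qed

lemma shear_state_space:
  assumes N: "\<And>a. a \<in> links G - M \<Longrightarrow> \<not> crossing G W a"
    and card: "card {a \<in> M. crossing G W a} \<le> 2"
    and e: "e \<in> M" "crossing G W e" "ends G e b \<in> W"
    and \<phi>: "\<phi> \<in> state_space rest (arcs M A r)"
  shows "shear inner (fst (r (e, b))) (snd (r (e, b))) \<phi> \<in> state_space rest (arcs M A r')"
proof -
  define p where "p = fst (r (e, b))"
  define q where "q = snd (r (e, b))"
  define I where "I K = contract p \<phi> K + contract q \<phi> K" for K
  have finI: "finite inner" "inner \<subseteq> rest" using fin by (auto simp: inner_def rest_def)
  have mem: "fst (r (g, c)) \<in> inner \<longleftrightarrow> ends G g c \<in> W" "snd (r (g, c)) \<in> inner \<longleftrightarrow> ends G g c \<in> W"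
    if "g \<in> M" for g c
  proof -
    have "a \<in> inner \<longleftrightarrow> ends G g c \<in> W" if a: "a \<in> links G - M" "\<exists>d. ends G a d = ends G g c" for a
    proof -
      from a obtain d where "ends G a d = ends G g c" by blast
      then show ?thesis using N[OF a(1)] a(1) unfolding crossing_def inner_def by (cases d) auto
    qed
    then show "fst (r (g, c)) \<in> inner \<longleftrightarrow> ends G g c \<in> W" "snd (r (g, c)) \<in> inner \<longleftrightarrow> ends G g c \<in> W"
      using rot_links[OF that, of c] rot_touch[OF that, of c] by blast+
  qed
  have pq: "p \<in> inner" "q \<in> inner" using mem[OF e(1)] e(3) by (auto simp: p_def q_def)
  have arc: "contract x \<phi> = contract y \<phi>" if "arcs M A r x y" for x y
    using \<phi> that by (rule state_spaceD)
  let ?J = "\<lambda>K h. contract (fst (r h)) \<phi> K + contract (snd (r h)) \<phi> K"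
  \<comment> \<open>For every matching edge that leaves \<open>W\<close>, the sum of the two edges
    at its inner end acts on \<phi> in the same way. By \<open>parity\<close> the sums over all
    matching ends in \<open>W\<close> add up to 0, edges with both ends in \<open>W\<close>
    contribute nothing, and at most two edges leave.\<close>
  have J: "?J K (g, c) = I K" if g: "g \<in> M" "crossing G W g" "ends G g c \<in> W" for g c K
  proof (cases "g = e")
    case True
    then have "c = b" using g e unfolding crossing_def by (cases c; cases b) auto
    then show ?thesis using True by (simp add: I_def p_def q_def)
  next
    case False
    define H where "H = {h \<in> M \<times> (UNIV::bool set). ends G (fst h) (snd h) \<in> W}"
    have "{a \<in> M. crossing G W a} = {e, g}"
      using card False e g fin by (intro card_seteq[symmetric]) auto
    then have only: "a = e \<or> a = g" if "a \<in> M" "crossing G W a" for a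
      using that by auto
    have "(\<Sum>h\<in>H. ?J K h) = 0"
      using parity[OF W, of "\<lambda>a. contract a \<phi> K"] N unfolding H_def by (simp cong: conj_cong)
    also have "(\<Sum>h\<in>H. ?J K h) = (\<Sum>h\<in>M \<times> UNIV. if ends G (fst h) (snd h) \<in> W then ?J K h else 0)"
      unfolding H_def using fin by (intro sum.inter_filter) auto
    also have "\<dots> = (\<Sum>a\<in>M. \<Sum>d\<in>UNIV. if ends G a d \<in> W then ?J K (a, d) else 0)"
      by (simp add: sum.cartesian_product case_prod_beta cong: if_cong)
    also have "\<dots> = (\<Sum>a\<in>M. if a = e then I K else if a = g then ?J K (g, c) else 0)"
    proof (intro sum.cong refl)
      fix a assume a: "a \<in> M"
      show "(\<Sum>d\<in>UNIV. if ends G a d \<in> W then ?J K (a, d) else 0) =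
          (if a = e then I K else if a = g then ?J K (g, c) else 0)"
      proof (cases "crossing G W a")
        case True
        then have "a = e \<or> a = g" using only a by blast
        moreover have "(\<Sum>d\<in>UNIV. if ends G e d \<in> W then ?J K (e, d) else 0) = I K"
          using e unfolding crossing_def by (cases b) (auto simp: UNIV_bool I_def p_def q_def)
        moreover have "(\<Sum>d\<in>UNIV. if ends G g d \<in> W then ?J K (g, d) else 0) = ?J K (g, c)"
          using g unfolding crossing_def by (cases c) (auto simp: UNIV_bool)
        ultimately show ?thesis using False by auto
      next
        case nc: False
        \<comment> \<open>The two smoothing arcs at \<open>a\<close> identify its four neighbours in
          pairs.\<close>
        have "?J K (a, False) + ?J K (a, True) = 0"
          using arcsI[OF a, of A, THEN arc] by (cases "a \<in> A") (simp_all add: algebra_simps)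
        then show ?thesis using nc e g by (auto simp: UNIV_bool crossing_def add.commute)
      qed
    qed
    also have "\<dots> = (\<Sum>a\<in>{e, g}. if a = e then I K else if a = g then ?J K (g, c) else 0)"
      using e g fin by (intro sum.mono_neutral_right) auto
    also have "\<dots> = I K + ?J K (g, c)"
      using False by simp
    finally show ?thesis by (metis bit_double_left add.right_neutral)
  qed
  have shI: "shear inner p q I = I"
  proof -
    have "contract p I L + contract q I L = 0" for L
      by (simp add: I_def[abs_def] contract_add contract_commute[of q p])
    then show ?thesis by (simp add: shear_def fun_eq_iff)
  qed
  have cs: "contract a (shear inner p q \<phi>) K = shear inner p q (contract a \<phi>) K + (if a \<in> inner then I K else 0)" for a K
    using contract_shear[OF finI(1)] by (simp add: I_def)
  let ?s = "shear inner p q"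
  \<comment> \<open>The contractions with the two edges at the inner end differ by \<open>I\<close>.
    The shear adds \<open>I\<close> once more, because the second edge is in \<open>inner\<close>;
    so after the shear this edge satisfies the relation that the first one had with the outer edge
    \<open>z\<close>.\<close>
  have swap: "contract (snd (r (g, c))) (?s \<phi>) = contract z (?s \<phi>)"
    if "g \<in> M" "crossing G W g" "ends G g c \<in> W" "contract (fst (r (g, c))) \<phi> = contract z \<phi>" "z \<notin> inner" for g c z
  proof
    fix K
    have *: "contract (snd (r (g, c))) \<phi> L = contract (fst (r (g, c))) \<phi> L + I L" for L
      using J[OF that(1-3), of L, symmetric] by (simp add: add.assoc[symmetric])
    have "contract (snd (r (g, c))) \<phi> = (\<lambda>L. contract (fst (r (g, c))) \<phi> L + I L)"
      by (rule ext) (rule *)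
    then have "?s (contract (snd (r (g, c))) \<phi>) K = ?s (contract (fst (r (g, c))) \<phi>) K + I K"
      by (simp only: shear_add shI)
    then show "contract (snd (r (g, c))) (?s \<phi>) K = contract z (?s \<phi>) K"
      using that mem[OF that(1), of c] by (simp add: cs add.assoc)
  qed
  have swap2: "contract (fst (r (g, c))) (?s \<phi>) = contract z (?s \<phi>)"
    if "g \<in> M" "crossing G W g" "ends G g c \<in> W" "contract (snd (r (g, c))) \<phi> = contract z \<phi>" "z \<notin> inner" for g c z
  proof
    fix K
    have *: "contract (fst (r (g, c))) \<phi> L = contract (snd (r (g, c))) \<phi> L + I L" for L
      using J[OF that(1-3), of L, symmetric] by (simp add: add_ac)
    have "contract (fst (r (g, c))) \<phi> = (\<lambda>L. contract (snd (r (g, c))) \<phi> L + I L)"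
      by (rule ext) (rule *)
    then have "?s (contract (fst (r (g, c))) \<phi>) K = ?s (contract (snd (r (g, c))) \<phi>) K + I K"
      by (simp only: shear_add shI)
    then show "contract (fst (r (g, c))) (?s \<phi>) K = contract z (?s \<phi>) K"
      using that mem[OF that(1), of c] by (simp add: cs add.assoc)
  qed
  have same: "contract x (?s \<phi>) = contract y (?s \<phi>)" if "contract x \<phi> = contract y \<phi>" "x \<in> inner \<longleftrightarrow> y \<in> inner" for x y
    using that by (intro ext) (simp add: cs)
  have "contract x (?s \<phi>) = contract y (?s \<phi>)" if xy: "arcs M A r' x y" for x y
  proof -
    from xy obtain g where g: "g \<in> M" "arc_at r' (g \<in> A) g x y"
      unfolding arcs_def by blast
    note ar = arcsI[OF g(1), of A, THEN arc]
    have key: "(g \<in> A \<longrightarrow> contract (fst (r' (g, False))) (?s \<phi>) = contract (fst (r' (g, True))) (?s \<phi>) \<and>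
        contract (snd (r' (g, False))) (?s \<phi>) = contract (snd (r' (g, True))) (?s \<phi>)) \<and>
      (g \<notin> A \<longrightarrow> contract (fst (r' (g, False))) (?s \<phi>) = contract (snd (r' (g, True))) (?s \<phi>) \<and>
        contract (snd (r' (g, False))) (?s \<phi>) = contract (fst (r' (g, True))) (?s \<phi>))"
    proof (cases "crossing G W g")
      case False
      then show ?thesis
        using r'[OF g(1)] mem[OF g(1)] ar unfolding crossing_def
        by (cases "ends G g False \<in> W") (auto intro!: same)
    next
      case True
      show ?thesis
      proof (cases "ends G g False \<in> W")
        case F: True
        then have T: "ends G g True \<notin> W" using True by (auto simp: crossing_def)
        show ?thesis
          using r'[OF g(1)] mem[OF g(1)] ar F T
          by (auto intro!: swap[OF g(1) True F] swap2[OF g(1) True F])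
      next
        case F: False
        then have T: "ends G g True \<in> W" using True by (auto simp: crossing_def)
        show ?thesis
          using r'[OF g(1)] mem[OF g(1)] ar[THEN sym] F T
          by (auto intro!: swap[OF g(1) True T, symmetric] swap2[OF g(1) True T, symmetric])
      qed
    qed
    show ?thesis
      using g(2) key by (cases "g \<in> A") (auto simp: doubleton_eq_iff)
  qed
  then have "?s \<phi> \<in> state_space rest (arcs M A r')"
    by (intro state_spaceI shear_supp[OF _ finI(2)]) (use state_space_supp[OF \<phi>] in auto)
  then show ?thesis by (simp add: p_def q_def)
qed

lemma inner_rot:
  assumes N: "\<And>a. a \<in> links G - M \<Longrightarrow> \<not> crossing G W a" and "g \<in> M"
  shows "fst (r (g, c)) \<in> inner \<longleftrightarrow> snd (r (g, c)) \<in> inner"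
proof -
  have "a \<in> inner \<longleftrightarrow> ends G g c \<in> W" if a: "a \<in> links G - M" "\<exists>d. ends G a d = ends G g c" for a
  proof -
    from a obtain d where "ends G a d = ends G g c" by blast
    then show ?thesis using N[OF a(1)] a(1) unfolding crossing_def inner_def by (cases d) auto
  qed
  then show ?thesis using rot_links[OF assms(2), of c] rot_touch[OF assms(2), of c] by blast
qed

text \<open>For the constant 1, \<open>parity\<close> says that the number of edges outside
  \<open>M\<close> that leave \<open>W\<close> is even. Beside \<open>e\<close> there is room for at
  most one leaving edge, so there is none outside \<open>M\<close>.\<close>

lemma no_crossing_rest:
  assumes "card {a \<in> links G. crossing G W a} \<le> 2" and e: "e \<in> M" "crossing G W e"
    and a: "a \<in> links G - M"
  shows "\<not> crossing G W a"
proof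
  assume "crossing G W a"
  have "e \<noteq> a" using e a by blast
  have ea: "{a \<in> links G. crossing G W a} = {e, a}"
    using assms fin M_links \<open>crossing G W a\<close> \<open>e \<noteq> a\<close> by (intro card_seteq[symmetric]) auto
  have "{a \<in> links G - M. crossing G W a} = {a \<in> links G. crossing G W a} - M" by blast
  then have "{a \<in> links G - M. crossing G W a} = {a}" using a e unfolding ea by auto
  then show False using parity[OF W, of "\<lambda>_. 1"] by simp
qed

text \<open>One triple \<open>I\<close>, \<open>p\<close>, \<open>q\<close> serves all smoothings
  \<open>A\<close>; this uniformity is what lets the shear commute with the differential. The same
  shear leads back, since at the chosen end \<open>r'\<close> merely exchanges \<open>p\<close> and
  \<open>q\<close>.\<close>

theorem mutation_shear:
  assumes "card {a \<in> links G. crossing G W a} \<le> 2"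
  obtains I p q where "finite I" "I \<subseteq> rest" "p \<in> I \<longleftrightarrow> q \<in> I"
    "\<And>g c. g \<in> M \<Longrightarrow> fst (r (g, c)) \<in> I \<longleftrightarrow> snd (r (g, c)) \<in> I"
    "\<And>A \<phi>. \<phi> \<in> state_space rest (arcs M A r) \<Longrightarrow> shear I p q \<phi> \<in> state_space rest (arcs M A r')"
    "\<And>A \<phi>. \<phi> \<in> state_space rest (arcs M A r') \<Longrightarrow> shear I p q \<phi> \<in> state_space rest (arcs M A r)"
proof (cases "\<exists>e\<in>M. crossing G W e")
  case False
  then have "arcs M A r' = arcs M A r" for A by (intro arcs_eq) auto
  moreover have "shear {} p p \<phi> = \<phi>" for p and \<phi> :: "'e set \<Rightarrow> bit" by (simp add: shear_def fun_eq_iff)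
  ultimately show thesis using that[of "{}" undefined undefined] by simp
next
  case True
  then obtain e where e: "e \<in> M" "crossing G W e" by blast
  then obtain b where b: "ends G e b \<in> W" unfolding crossing_def by blast
  have N: "\<not> crossing G W a" if "a \<in> links G - M" for a
    using no_crossing_rest[OF assms e that] .
  have card: "card {a \<in> M. crossing G W a} \<le> 2"
    using assms fin M_links by (intro order_trans[OF card_mono assms]) auto
  interpret R: mutation G M r' r W by (rule rev)
  have sw: "fst (r' (e, b)) = snd (r (e, b))" "snd (r' (e, b)) = fst (r (e, b))"
    using r'[OF e(1), of b] b by auto
  have comm: "shear J p q = shear J q p" for J p q
    by (auto simp: shear_def fun_eq_iff add.commute)
  show thesis
  proof (rule that[of inner "fst (r (e, b))" "snd (r (e, b))"])
    show "finite inner" "inner \<subseteq> rest" using fin by (auto simp: inner_def rest_def)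
    show "fst (r (g, c)) \<in> inner \<longleftrightarrow> snd (r (g, c)) \<in> inner" if "g \<in> M" for g c
      using inner_rot[OF N that] .
    show "fst (r (e, b)) \<in> inner \<longleftrightarrow> snd (r (e, b)) \<in> inner" using inner_rot[OF N e(1)] .
    show "shear inner (fst (r (e, b))) (snd (r (e, b))) \<phi> \<in> state_space rest (arcs M A r')"
      if "\<phi> \<in> state_space rest (arcs M A r)" for A \<phi>
      using shear_state_space[OF N card e b that] .
    show "shear inner (fst (r (e, b))) (snd (r (e, b))) \<phi> \<in> state_space rest (arcs M A r)"
      if "\<phi> \<in> state_space rest (arcs M A r')" for A \<phi>
      using R.shear_state_space[OF N card e b that] by (simp add: sw comm[of _ "fst (r (e, b))"])
  qed
qed

end

section \<open>The circles of a state\<close>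

definition classes :: "'e set \<Rightarrow> ('e \<Rightarrow> 'e \<Rightarrow> bool) \<Rightarrow> 'e set set" where
  "classes E R = (\<lambda>a. {b. R\<^sup>*\<^sup>* a b}) ` E"

lemma classes_partition:
  assumes sym: "\<And>a b. R a b \<Longrightarrow> R b a" and E: "\<And>a b. R a b \<Longrightarrow> b \<in> E"
  shows "partition_on E (classes E R)"
    and "Z \<in> classes E R \<Longrightarrow> a \<in> Z \<Longrightarrow> Z = {b. R\<^sup>*\<^sup>* a b}"
proof -
  have rsym: "R\<^sup>*\<^sup>* b a" if "R\<^sup>*\<^sup>* a b" for a b
    using that
  proof (induction rule: rtranclp_induct)
    case (step y z)
    then show ?case using sym by (metis converse_rtranclp_into_rtranclp)
  qed simp
  show *: "Z = {b. R\<^sup>*\<^sup>* a b}" if "Z \<in> classes E R" "a \<in> Z" for Z a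
    using that rsym unfolding classes_def by (auto intro: rtranclp_trans)
  have sub: "b \<in> E" if "R\<^sup>*\<^sup>* a b" "a \<in> E" for a b
    using that by (induction rule: rtranclp_induct) (auto intro: E)
  show "partition_on E (classes E R)"
  proof (rule partition_onI)
    show "\<Union>(classes E R) = E" using sub by (auto simp: classes_def)
    show "disjnt p q" if "p \<in> classes E R" "q \<in> classes E R" "p \<noteq> q" for p q
      using *[OF that(1)] *[OF that(2)] that(3) unfolding disjnt_def by blast
    show "{} \<notin> classes E R"
      by (auto simp: classes_def)
  qed
qed

lemma state_space_classes:
  assumes sym: "\<And>a b. R a b \<Longrightarrow> R b a" and E: "\<And>a b. R a b \<Longrightarrow> b \<in> E"
  shows "state_space E (part_rel (classes E R)) = state_space E R"
proof -
  have 1: "part_rel (classes E R) a b" if "R a b" for a b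
  proof -
    have "a \<in> E" using that sym E by blast
    moreover have "R\<^sup>*\<^sup>* a b" using that by blast
    ultimately show ?thesis unfolding part_rel_def classes_def by blast
  qed
  have cl: "Z = {b. R\<^sup>*\<^sup>* a b}" if "Z \<in> classes E R" "a \<in> Z" for Z a
    by (rule classes_partition(2)[where E = E]) (use that sym E in blast)+
  have 2: "R\<^sup>*\<^sup>* a b" if ab: "part_rel (classes E R) a b" for a b
  proof -
    obtain Z where Z: "Z \<in> classes E R" "a \<in> Z" "b \<in> Z" using ab unfolding part_rel_def by blast
    then show ?thesis using cl[OF Z(1,2)] by blast
  qed
  have "\<phi> \<in> state_space E (part_rel (classes E R)) \<longleftrightarrow> \<phi> \<in> state_space E R" for \<phi>
  proof
    assume \<phi>: "\<phi> \<in> state_space E (part_rel (classes E R))"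
    show "\<phi> \<in> state_space E R"
      by (rule state_spaceI[OF state_space_supp[OF \<phi>] state_spaceD[OF \<phi> 1]])
  next
    assume "\<phi> \<in> state_space E R"
    then have \<phi>: "\<phi> \<in> state_space E R\<^sup>*\<^sup>*" by (simp add: state_space_rtranclp)
    show "\<phi> \<in> state_space E (part_rel (classes E R))"
      by (rule state_spaceI[OF state_space_supp[OF \<phi>] state_spaceD[OF \<phi> 2]])
  qed
  then show ?thesis by blast
qed

text \<open>This recovers the number of circles from the state space.\<close>

lemma card_classes_state_space:
  assumes "partition_on E \<C>" "finite E"
  shows "card {\<phi> \<in> state_space E (part_rel \<C>). \<forall>K. \<phi> K \<noteq> 0 \<longrightarrow> card K = 1} = 2 ^ card \<C>"
proof -
  let ?D = "{\<phi> \<in> state_space E (part_rel \<C>). \<forall>K. \<phi> K \<noteq> 0 \<longrightarrow> card K = 1}"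
  \<comment> \<open>A member of the state space supported on one-element sets is a function on edges
    that is constant on circles, so it amounts to a set \<open>X\<close> of circles.\<close>
  define \<Phi> :: "'a set set \<Rightarrow> 'a set \<Rightarrow> bit" where "\<Phi> X K = of_bool (\<exists>a\<in>\<Union>X. K = {a})" for X K
  have contract_\<Phi>: "contract a (\<Phi> X) K = of_bool (K = {} \<and> a \<in> \<Union>X)" for a X K
  proof (cases "K = {}")
    case False
    then show ?thesis by (cases "a \<in> K") (auto simp: contract_def \<Phi>_def)
  qed (simp add: contract_def \<Phi>_def)
  have uniq: "Y = Z" if "Y \<in> \<C>" "Z \<in> \<C>" "x \<in> Y" "x \<in> Z" for x Y Z
    using that partition_onD2[OF assms(1)] unfolding disjoint_def by blast
  have "bij_betw \<Phi> (Pow \<C>) ?D"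
  proof (rule bij_betwI[where g = "\<lambda>\<phi>. {Z \<in> \<C>. \<exists>a\<in>Z. \<phi> {a} \<noteq> 0}"])
    show "\<Phi> \<in> Pow \<C> \<rightarrow> ?D"
    proof
      fix X assume X: "X \<in> Pow \<C>"
      have "\<Phi> X \<in> state_space E (part_rel \<C>)"
      proof (rule state_spaceI)
        fix K assume "\<Phi> X K \<noteq> 0"
        then show "K \<subseteq> E" using X partition_onD1[OF assms(1)] by (auto simp: \<Phi>_def)
      next
        fix a b assume "part_rel \<C> a b"
        then obtain Z where Z: "Z \<in> \<C>" "a \<in> Z" "b \<in> Z" by (auto simp: part_rel_def)
        have *: "y \<in> \<Union>X" if "x \<in> \<Union>X" "x \<in> Z" "y \<in> Z" for x y
        proof -
          from that(1) obtain Y where "Y \<in> X" "x \<in> Y" by blast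
          moreover from this have "Y = Z" using X Z(1) that(2) uniq[of Y Z x] by blast
          ultimately show ?thesis using that(3) by blast
        qed
        have "a \<in> \<Union>X \<longleftrightarrow> b \<in> \<Union>X" using *[of a b] *[of b a] Z(2,3) by blast
        then show "contract a (\<Phi> X) = contract b (\<Phi> X)" by (intro ext) (simp add: contract_\<Phi>)
      qed
      moreover have "card K = 1" if "\<Phi> X K \<noteq> 0" for K
        using that by (auto simp: \<Phi>_def)
      ultimately show "\<Phi> X \<in> ?D" by blast
    qed
    show "(\<lambda>\<phi>. {Z \<in> \<C>. \<exists>a\<in>Z. \<phi> {a} \<noteq> 0}) \<in> ?D \<rightarrow> Pow \<C>" by auto
    show "{Z \<in> \<C>. \<exists>a\<in>Z. \<Phi> X {a} \<noteq> 0} = X" if X: "X \<in> Pow \<C>" for X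
    proof
      show "{Z \<in> \<C>. \<exists>a\<in>Z. \<Phi> X {a} \<noteq> 0} \<subseteq> X"
      proof
        fix Z assume "Z \<in> {Z \<in> \<C>. \<exists>a\<in>Z. \<Phi> X {a} \<noteq> 0}"
        then obtain a Y where "Z \<in> \<C>" "a \<in> Z" "Y \<in> X" "a \<in> Y" by (auto simp: \<Phi>_def)
        then show "Z \<in> X" using uniq[of Z Y a] X by auto
      qed
      show "X \<subseteq> {Z \<in> \<C>. \<exists>a\<in>Z. \<Phi> X {a} \<noteq> 0}"
      proof
        fix Z assume Z: "Z \<in> X"
        then have "Z \<in> \<C>" using X by auto
        moreover obtain a where "a \<in> Z" using \<open>Z \<in> \<C>\<close> some_in_part[OF assms(1)] by blast
        ultimately show "Z \<in> {Z \<in> \<C>. \<exists>a\<in>Z. \<Phi> X {a} \<noteq> 0}" using Z by (auto simp: \<Phi>_def)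
      qed
    qed
    show "\<Phi> {Z \<in> \<C>. \<exists>a\<in>Z. \<phi> {a} \<noteq> 0} = \<phi>" if \<phi>: "\<phi> \<in> ?D" for \<phi>
    proof
      fix K
      have \<phi>1: "\<phi> \<in> state_space E (part_rel \<C>)" and \<phi>2: "\<And>K. \<phi> K \<noteq> 0 \<Longrightarrow> card K = 1"
        using \<phi> by auto
      have eq: "\<phi> {a} = \<phi> {b}" if "Z \<in> \<C>" "a \<in> Z" "b \<in> Z" for Z a b
      proof -
        have "part_rel \<C> a b" using that by (auto simp: part_rel_def)
        from state_spaceD[OF \<phi>1 this] have "contract a \<phi> {} = contract b \<phi> {}" by simp
        then show ?thesis by (simp add: contract_def)
      qed
      show "\<Phi> {Z \<in> \<C>. \<exists>a\<in>Z. \<phi> {a} \<noteq> 0} K = \<phi> K"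
      proof (cases "\<exists>a. K = {a}")
        case True
        then obtain a where a: "K = {a}" by blast
        have "(\<exists>Z\<in>\<C>. (\<exists>b\<in>Z. \<phi> {b} \<noteq> 0) \<and> a \<in> Z) \<longleftrightarrow> \<phi> {a} \<noteq> 0"
        proof
          assume "\<exists>Z\<in>\<C>. (\<exists>b\<in>Z. \<phi> {b} \<noteq> 0) \<and> a \<in> Z"
          then obtain Z b where Zb: "Z \<in> \<C>" "b \<in> Z" "\<phi> {b} \<noteq> 0" "a \<in> Z" by blast
          show "\<phi> {a} \<noteq> 0" using eq[OF Zb(1,4,2)] Zb(3) by simp
        next
          assume *: "\<phi> {a} \<noteq> 0"
          then have "a \<in> E" using state_space_supp[OF \<phi>1] by blast
          then show "\<exists>Z\<in>\<C>. (\<exists>b\<in>Z. \<phi> {b} \<noteq> 0) \<and> a \<in> Z"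
            using * partition_onD1[OF assms(1)] by blast
        qed
        then show ?thesis using bit_not_zero_iff[of "\<phi> {a}"] by (auto simp: \<Phi>_def a)
      next
        case False
        then have "\<phi> K = 0" using \<phi>2[of K] by (metis card_1_singletonE)
        then show ?thesis using False by (auto simp: \<Phi>_def)
      qed
    qed
  qed
  then have "card ?D = card (Pow \<C>)" by (simp add: bij_betw_same_card)
  also have "\<dots> = 2 ^ card \<C>"
    using assms by (intro card_Pow finite_elements) auto
  finally show ?thesis .
qed

text \<open>Each first-order term replaces one element of \<open>K\<close> by \<open>p\<close> or
  \<open>q\<close>. So the shear preserves cardinality, which carries the grading.\<close>

lemma shear_card:
  assumes "\<forall>K. \<phi> K \<noteq> 0 \<longrightarrow> finite K \<and> card K = n" "shear I p q \<phi> K \<noteq> 0"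
  shows "card K = n"
proof (cases "\<phi> K = 0")
  case True
  then have "(\<Sum>a\<in>K \<inter> I. contract p \<phi> (K - {a}) + contract q \<phi> (K - {a})) \<noteq> 0"
    using assms(2) by (simp add: shear_def)
  then obtain a where a: "a \<in> K \<inter> I" "contract p \<phi> (K - {a}) + contract q \<phi> (K - {a}) \<noteq> 0"
    by (meson sum.neutral)
  then have "contract p \<phi> (K - {a}) \<noteq> 0 \<or> contract q \<phi> (K - {a}) \<noteq> 0" by auto
  then obtain x where "contract x \<phi> (K - {a}) \<noteq> 0" by blast
  then have x: "x \<notin> K - {a}" "\<phi> (insert x (K - {a})) \<noteq> 0" by (auto simp: contract_def split: if_splits)
  then have fin: "finite (insert x (K - {a}))" and n: "card (insert x (K - {a})) = n"
    using assms(1) by (simp_all only: simp_thms)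
  from fin have finK: "finite K" by simp
  then have "card (insert x (K - {a})) = Suc (card (K - {a}))" using x(1) by simp
  also have "\<dots> = card K" using finK a(1) by (intro card_Suc_Diff1) auto
  finally show ?thesis using n by simp
qed (use assms in blast)

context rotated
begin

abbreviation space_of :: "'e set \<Rightarrow> ('e set \<Rightarrow> bit) set" where
  "space_of A \<equiv> state_space rest (arcs M A r)"

definition cyc :: "'e set \<Rightarrow> 'e set set" where
  "cyc A = classes rest (arcs M A r)"

abbreviation cls1 :: "'e set \<Rightarrow> 'e \<Rightarrow> 'e set" where
  "cls1 A e \<equiv> {b. (arcs M A r)\<^sup>*\<^sup>* (fst (r (e, False))) b}"

abbreviation cls2 :: "'e set \<Rightarrow> 'e \<Rightarrow> 'e set" where
  "cls2 A e \<equiv> {b. (arcs M A r)\<^sup>*\<^sup>* (snd (r (e, False))) b}"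

definition joined :: "'e set \<Rightarrow> 'e \<Rightarrow> bool" where
  "joined A e \<longleftrightarrow> (arcs M A r)\<^sup>*\<^sup>* (fst (r (e, False))) (snd (r (e, False)))"

lemma cyc_partition: "partition_on rest (cyc A)"
  unfolding cyc_def by (rule classes_partition(1)) (assumption | erule arcs_sym | erule arcs_rest[THEN conjunct2])+

lemma cyc_class: "Z \<in> cyc A \<Longrightarrow> a \<in> Z \<Longrightarrow> Z = {b. (arcs M A r)\<^sup>*\<^sup>* a b}"
  unfolding cyc_def by (rule classes_partition(2)) (assumption | erule arcs_sym | erule arcs_rest[THEN conjunct2])+

lemma cyc_state_space: "state_space rest (part_rel (cyc A)) = space_of A"
  unfolding cyc_def by (rule state_space_classes) (assumption | erule arcs_sym | erule arcs_rest[THEN conjunct2])+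

lemma cls_in_cyc: "a \<in> rest \<Longrightarrow> {b. (arcs M A r)\<^sup>*\<^sup>* a b} \<in> cyc A"
  by (auto simp: cyc_def classes_def)

text \<open>This expresses lying on one circle by the state space alone, a form that the shear
  carries over to the other graph. For the converse, the indicator of the one-element subsets of a
  circle serves as test functional.\<close>

lemma joined_iff:
  assumes "e \<in> M"
  shows "joined A e \<longleftrightarrow>
    (\<forall>\<phi>\<in>space_of A. \<forall>K. contract (fst (r (e, False))) \<phi> K + contract (snd (r (e, False))) \<phi> K = 0)"
    (is "_ \<longleftrightarrow> ?R")
proof
  assume "joined A e"
  show ?R
  proof (intro ballI allI)
    fix \<phi> K assume "\<phi> \<in> space_of A"
    then have "\<phi> \<in> state_space rest (arcs M A r)\<^sup>*\<^sup>*" by (simp add: state_space_rtranclp)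
    from state_spaceD[OF this \<open>joined A e\<close>[unfolded joined_def]]
    show "contract (fst (r (e, False))) \<phi> K + contract (snd (r (e, False))) \<phi> K = 0" by simp
  qed
next
  assume R: ?R
  define Z where "Z = {b. (arcs M A r)\<^sup>*\<^sup>* (fst (r (e, False))) b}"
  define \<phi> :: "'e set \<Rightarrow> bit" where "\<phi> K = of_bool (\<exists>a\<in>Z. K = {a})" for K
  have contract_\<phi>: "contract a \<phi> K = of_bool (K = {} \<and> a \<in> Z)" for a K
  proof (cases "K = {}")
    case False
    then show ?thesis by (cases "a \<in> K") (auto simp: contract_def \<phi>_def)
  qed (simp add: contract_def \<phi>_def)
  have "\<phi> \<in> space_of A"
  proof (rule state_spaceI)
    fix K assume "\<phi> K \<noteq> 0"
    then obtain a where "a \<in> Z" "K = {a}" by (auto simp: \<phi>_def)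
    moreover have "Z \<subseteq> rest"
      using cls_in_cyc[OF rot_rest(1)[OF assms]] partition_onD1[OF cyc_partition] unfolding Z_def by blast
    ultimately show "K \<subseteq> rest" by blast
  next
    fix a b assume "arcs M A r a b"
    then have "a \<in> Z \<longleftrightarrow> b \<in> Z" unfolding Z_def
      by (metis arcs_sym mem_Collect_eq rtranclp.rtrancl_into_rtrancl)
    then show "contract a \<phi> = contract b \<phi>" by (intro ext) (simp add: contract_\<phi>)
  qed
  from R[rule_format, OF this, of "{}"] show "joined A e"
    by (cases "(arcs M A r)\<^sup>*\<^sup>* (fst (r (e, False))) (snd (r (e, False)))") (simp_all add: contract_\<phi> joined_def Z_def)
qed

lemma arcs_mono_off:
  assumes "insert e A = insert e B" "arcs M A r x y" "e \<in> M"
  shows "arcs M B r x y \<or> (\<exists>c\<in>{fst (r (e, False)), snd (r (e, False))}. (arcs M A r)\<^sup>*\<^sup>* x c)"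
proof -
  from assms(2) obtain g where g: "g \<in> M" "arc_at r (g \<in> A) g x y"
    unfolding arcs_def by blast
  show ?thesis
  proof (cases "g = e")
    case True
    then have "x \<in> {fst (r (e, False)), snd (r (e, False))} \<or> y \<in> {fst (r (e, False)), snd (r (e, False))}"
      using g(2) by (auto simp: doubleton_eq_iff split: if_splits)
    moreover have "(arcs M A r)\<^sup>*\<^sup>* x x" "(arcs M A r)\<^sup>*\<^sup>* x y" using assms(2) by auto
    ultimately show ?thesis by blast
  next
    case False
    then have gAB: "g \<in> B \<longleftrightarrow> g \<in> A" using assms(1) by blast
    have "arcs M B r x y" unfolding arcs_def by (rule bexI[of _ g]) (use g in \<open>simp_all only: gAB\<close>)
    then show ?thesis ..
  qed
qed

text \<open>Either smoothing joins each edge at the end \<open>True\<close> of \<open>e\<close> to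
  an edge at the end \<open>False\<close>. A circle that avoids the latter edges therefore avoids
  the former too; it does not pass \<open>e\<close> and is not affected by the change of
  smoothing.\<close>

lemma cyc_off:
  assumes AB: "insert e A = insert e B" and e: "e \<in> M"
    and Y: "Y \<in> cyc A" "fst (r (e, False)) \<notin> Y" "snd (r (e, False)) \<notin> Y"
  shows "Y \<in> cyc B"
proof -
  let ?P = "{fst (r (e, False)), snd (r (e, False))}"
  obtain a where a: "a \<in> rest" "Y = {b. (arcs M A r)\<^sup>*\<^sup>* a b}"
    using Y(1) by (auto simp: cyc_def classes_def)
  have AtoB: "(arcs M B r)\<^sup>*\<^sup>* a b" if "(arcs M A r)\<^sup>*\<^sup>* a b" for b
    using that
  proof (induction rule: rtranclp_induct)
    case (step x y)
    have "\<not> (\<exists>c\<in>?P. (arcs M A r)\<^sup>*\<^sup>* x c)"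
      using step(1) Y(2,3) a(2) by (auto dest: rtranclp_trans)
    then have "arcs M B r x y" using arcs_mono_off[OF AB step(2) e] by blast
    then show ?case using step by auto
  qed simp
  have BtoA: "(arcs M A r)\<^sup>*\<^sup>* a b" if "(arcs M B r)\<^sup>*\<^sup>* a b" for b
    using that
  proof (induction rule: rtranclp_induct)
    case (step x y)
    show ?case
    proof (cases "arcs M A r x y")
      case True
      then show ?thesis using step by auto
    next
      case False
      from step(2) obtain g where g: "g \<in> M" "arc_at r (g \<in> B) g x y"
        unfolding arcs_def by blast
      have "g = e"
      proof (rule ccontr)
        assume "g \<noteq> e"
        then have gAB: "g \<in> A \<longleftrightarrow> g \<in> B" using AB by blast
        have "arcs M A r x y" unfolding arcs_def by (rule bexI[of _ g]) (use g in \<open>simp_all only: gAB\<close>)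
        then show False using False by blast
      qed
      then have "x \<in> {fst (r (e, False)), snd (r (e, False)), fst (r (e, True)), snd (r (e, True))}"
        using g(2) by (auto simp: doubleton_eq_iff split: if_splits)
      moreover have "\<exists>c\<in>?P. arcs M A r (fst (r (e, True))) c" "\<exists>c\<in>?P. arcs M A r (snd (r (e, True))) c"
        using arcsI[OF e, of A, THEN arcs_sym] by (cases "e \<in> A"; blast)+
      ultimately have "\<exists>c\<in>?P. (arcs M A r)\<^sup>*\<^sup>* x c" by auto
      then have "\<exists>c\<in>?P. c \<in> Y" using step(3) a(2) by (auto dest: rtranclp_trans)
      then show ?thesis using Y by auto
    qed
  qed simp
  have "Y = {b. (arcs M B r)\<^sup>*\<^sup>* a b}" using a(2) AtoB BtoA by blast
  then show ?thesis using a(1) by (auto simp: cyc_def classes_def)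
qed

text \<open>The first premise says that \<open>A\<close> and \<open>B\<close> agree except possibly
  at \<open>e\<close>. It is symmetric, so that one inclusion already gives equality of the circles
  away from \<open>e\<close>.\<close>

lemma saddle_cyc:
  assumes "insert e A = insert e B" "e \<in> M"
  shows "saddle rest (cyc A) (cyc B)
    (cls1 A e) (cls2 A e) (cls1 B e) (cls2 B e)
    (fst (r (e, False))) (snd (r (e, False)))"
proof
  show "finite rest" "partition_on rest (cyc A)" "partition_on rest (cyc B)"
    using fin cyc_partition by auto
  show "cyc A - {cls1 A e, cls2 A e} =
    cyc B - {cls1 B e, cls2 B e}"
  proof -
    have *: "cyc A - {cls1 A e, cls2 A e} \<subseteq>
      cyc B - {cls1 B e, cls2 B e}"
      if AB: "insert e A = insert e B" for A B
    proof
      fix Y assume "Y \<in> cyc A - {cls1 A e, cls2 A e}"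
      then have Y: "Y \<in> cyc A" "fst (r (e, False)) \<notin> Y" "snd (r (e, False)) \<notin> Y"
        using cyc_class[of Y A] by auto
      have "Y \<in> cyc B" using cyc_off[OF AB assms(2) Y] .
      then show "Y \<in> cyc B - {cls1 B e, cls2 B e}"
        using Y(2,3) by auto
    qed
    show ?thesis using *[OF assms(1)] *[OF assms(1)[symmetric]] by (rule equalityI)
  qed
qed (use rot_rest[OF assms(2)] cls_in_cyc in auto)

lemma joined_classes:
  assumes "e \<in> M"
  shows "joined A e \<longleftrightarrow> cls1 A e = cls2 A e"
  using cyc_class[OF cls_in_cyc[OF rot_rest(1)[OF assms, of False]], of "snd (r (e, False))" A]
  by (auto simp: joined_def)

lemma rot_class:
  assumes "e \<in> M"
  shows "fst (r (e, True)) \<in> cls1 A e \<union> cls2 A e"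
    "snd (r (e, True)) \<in> cls1 A e \<union> cls2 A e"
  using arcsI[OF assms, of A] by (cases "e \<in> A"; blast intro: r_into_rtranclp)+

end

section \<open>The isomorphism of complexes\<close>

locale oriented = rotated G M r for G :: "('v, 'e) mgraph" and M r +
  fixes P :: "('v, 'e) drawing"
  assumes circ: "state_circles G P M A = cyc A"
begin

text \<open>All circles through \<open>e\<close> are seen at its end \<open>False\<close>, since
  each edge at the other end is joined to one of the two edges there.\<close>

lemma circles_through:
  assumes e: "e \<in> M"
  shows "circles_through G P M A e = {cls1 A e, cls2 A e}"
proof
  show "circles_through G P M A e \<subseteq> {cls1 A e, cls2 A e}"
  proof
    fix Z assume "Z \<in> circles_through G P M A e"
    then obtain a where Z: "Z \<in> cyc A" and a: "a \<in> Z" "a \<in> links G" "range (ends G a) \<inter> range (ends G e) \<noteq> {}"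
      by (auto simp: circles_through_def circ)
    have "a \<in> rest" using Z a(1) partition_onD1[OF cyc_partition] by blast
    then have "a \<in> links G - M" using a(2) circs_disj by (auto simp: rest_def)
    moreover from a(3) obtain c b where "ends G a c = ends G e b" by auto
    ultimately have "a = fst (r (e, b)) \<or> a = snd (r (e, b))" using touch_rot[OF e] by blast
    then have "a \<in> cls1 A e \<union> cls2 A e" using rot_class[OF e, of A] by (cases b) auto
    then show "Z \<in> {cls1 A e, cls2 A e}"
    proof
      assume "a \<in> cls1 A e"
      then have "Z = cls1 A e"
        using cyc_class[OF Z a(1)] cyc_class[OF cls_in_cyc[OF rot_rest(1)[OF e, of False]], of a A] by simp
      then show ?thesis by simp
    next
      assume "a \<in> cls2 A e"
      then have "Z = cls2 A e"
        using cyc_class[OF Z a(1)] cyc_class[OF cls_in_cyc[OF rot_rest(2)[OF e, of False]], of a A] by simp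
      then show ?thesis by simp
    qed
  qed
  have *: "{b. (arcs M A r)\<^sup>*\<^sup>* x b} \<in> circles_through G P M A e"
    if "x \<in> links G - M" "\<exists>c. ends G x c = ends G e False" for x
  proof -
    have "x \<in> rest" using that by (simp add: rest_def)
    then have "{b. (arcs M A r)\<^sup>*\<^sup>* x b} \<in> state_circles G P M A" by (simp add: circ cls_in_cyc)
    moreover have "x \<in> {b. (arcs M A r)\<^sup>*\<^sup>* x b} \<inter> links G" using that by simp
    moreover have "range (ends G x) \<inter> range (ends G e) \<noteq> {}" using that(2) by (metis IntI empty_iff rangeI)
    ultimately show ?thesis unfolding circles_through_def by blast
  qed
  show "{cls1 A e, cls2 A e} \<subseteq> circles_through G P M A e"
    using *[OF rot_links(1) rot_touch(1)] *[OF rot_links(2) rot_touch(2)] e by simp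
qed

lemma edge_coeff_eq:
  assumes "e \<in> A" "e \<in> M"
  shows "edge_coeff G P M (A - {e}) e l l' =
    saddle_coeff (cyc (A - {e})) {cls1 (A - {e}) e, cls2 (A - {e}) e} {cls1 A e, cls2 A e} l l'"
  using assms by (simp only: edge_coeff_def saddle_coeff_def Let_def circles_through insert_Diff circ)

text \<open>After encoding, the components of the differential refer to circles only through
  \<open>joined\<close>, so they can be compared between two drawings with different
  circles.\<close>

lemma encode_differential:
  assumes "A \<subseteq> M"
  shows "encode rest (cyc A) (\<lambda>l. differential G P M c (A, l)) =
    (\<lambda>K. \<Sum>e\<in>A. saddle_map (joined (A - {e}) e) (joined A e) (fst (r (e, False))) (snd (r (e, False)))
      (encode rest (cyc (A - {e})) (\<lambda>l. c (A - {e}, l))) K)"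
proof
  fix K
  let ?c = "\<lambda>e l'. \<Sum>l\<in>cyc (A - {e}) \<rightarrow>\<^sub>E UNIV. saddle_coeff (cyc (A - {e}))
    {cls1 (A - {e}) e, cls2 (A - {e}) e} {cls1 A e, cls2 A e} l l' * c (A - {e}, l)"
  have "(\<Sum>e\<in>A. saddle_map (joined (A - {e}) e) (joined A e) (fst (r (e, False))) (snd (r (e, False)))
      (encode rest (cyc (A - {e})) (\<lambda>l. c (A - {e}, l))) K) = (\<Sum>e\<in>A. encode rest (cyc A) (?c e) K)"
  proof (rule sum.cong[OF refl])
    fix e assume e: "e \<in> A"
    then have eM: "e \<in> M" using assms by auto
    have "insert e (A - {e}) = insert e A" by auto
    from saddle.encode_saddle[OF saddle_cyc[OF this eM]]
    show "saddle_map (joined (A - {e}) e) (joined A e) (fst (r (e, False))) (snd (r (e, False)))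
      (encode rest (cyc (A - {e})) (\<lambda>l. c (A - {e}, l))) K = encode rest (cyc A) (?c e) K"
      by (simp only: joined_classes[OF eM])
  qed
  also have "\<dots> = (if K \<subseteq> rest \<and> thin (cyc A) K then \<Sum>e\<in>A. ?c e (lab_of (cyc A) K) else 0)"
  proof (cases "K \<subseteq> rest \<and> thin (cyc A) K")
    case False
    then have "encode rest (cyc A) c' K = 0" for c' by (simp only: encode_def if_False)
    then show ?thesis using False by (simp only: if_False sum.neutral_const)
  qed (simp add: encode_def)
  also have "(\<Sum>e\<in>A. ?c e (lab_of (cyc A) K)) = differential G P M c (A, lab_of (cyc A) K)"
    unfolding differential_def labellings_def circ
    using assms by (auto simp: lab_of_in edge_coeff_eq intro!: sum.cong)
  finally show "encode rest (cyc A) (\<lambda>l. differential G P M c (A, l)) K =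
    (\<Sum>e\<in>A. saddle_map (joined (A - {e}) e) (joined A e) (fst (r (e, False))) (snd (r (e, False)))
      (encode rest (cyc (A - {e})) (\<lambda>l. c (A - {e}, l))) K)"
    unfolding encode_def[of rest "cyc A"] by (rule sym)
qed

lemma differential_outside:
  assumes "\<not> (A \<subseteq> M \<and> l \<in> cyc A \<rightarrow>\<^sub>E UNIV)"
  shows "differential G P M c (A, l) = 0"
  using assms by (auto simp: differential_def labellings_def circ)

lemma cochainsD:
  assumes "c \<in> cochains G P M i j" "c (A, l) \<noteq> 0"
  shows "A \<subseteq> M" "card A = i" "l \<in> cyc A \<rightarrow>\<^sub>E UNIV"
    "(\<Sum>Z\<in>cyc A. gen_deg (l Z)) + int (card A) = j"
proof -
  have "(A, l) \<in> cochain_basis G P M i j" using assms unfolding cochains_def by blast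
  then show "A \<subseteq> M" "card A = i" "l \<in> cyc A \<rightarrow>\<^sub>E UNIV" "(\<Sum>Z\<in>cyc A. gen_deg (l Z)) + int (card A) = j"
    unfolding cochain_basis_def labellings_def circ by blast+
qed

lemma cochains_outside:
  assumes "c \<in> cochains G P M i j" "\<not> (A \<subseteq> M \<and> l \<in> cyc A \<rightarrow>\<^sub>E UNIV)"
  shows "c (A, l) = 0"
  using assms(2) cochainsD[OF assms(1), of A l] by blast

lemma encode_cochain:
  assumes "c \<in> cochains G P M i j" "encode rest (cyc A) (\<lambda>l. c (A, l)) K \<noteq> 0"
  shows "finite K" "card A = i" "2 * int (card K) - int (card (cyc A)) + int i = j"
proof -
  have K: "K \<subseteq> rest" "thin (cyc A) K" "c (A, lab_of (cyc A) K) \<noteq> 0"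
    using assms(2) by (auto simp: encode_def split: if_splits)
  show "finite K" using K(1) fin(3) finite_subset by blast
  show "card A = i" "2 * int (card K) - int (card (cyc A)) + int i = j"
    using cochainsD[OF assms(1) K(3)] gen_deg_lab_of[OF cyc_partition fin(3) K(1,2)] by auto
qed

end

text \<open>Encoding, then \<sigma>, then decoding by evaluation on transversals. The value 0 away
  from the labellings is required of a cochain.\<close>

definition transfer :: "'e set \<Rightarrow> 'e set \<Rightarrow> ('e set \<Rightarrow> 'e set set) \<Rightarrow> ('e set \<Rightarrow> 'e set set) \<Rightarrow>
    (('e set \<Rightarrow> bit) \<Rightarrow> 'e set \<Rightarrow> bit) \<Rightarrow> 'e cochain \<Rightarrow> 'e cochain" where
  "transfer E M \<C> \<C>' \<sigma> c = (\<lambda>(A, l). if A \<subseteq> M \<and> l \<in> \<C>' A \<rightarrow>\<^sub>E UNIV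
     then \<sigma> (encode E (\<C> A) (\<lambda>l. c (A, l))) (transversal (\<C>' A) l) else 0)"

text \<open>The assumptions are symmetric in the two drawings, as \<open>rev\<close> shows, so each
  implication proved here also yields its converse. \<open>side\<close> makes the sum of the two
  edges at a matching end invariant under the shear, and \<open>pq\<close> does the same for
  \<open>p + q\<close>.\<close>

locale oriented_pair = P: oriented G M r P + Q: oriented G M r' Q
  for G :: "('v, 'e) mgraph" and M r P r' Q +
  fixes I p q
  assumes I: "finite I" "I \<subseteq> P.rest" and pq: "p \<in> I \<longleftrightarrow> q \<in> I"
    and r': "e \<in> M \<Longrightarrow> r' (e, b) = r (e, b) \<or> r' (e, b) = prod.swap (r (e, b))"
    and side: "e \<in> M \<Longrightarrow> fst (r (e, b)) \<in> I \<longleftrightarrow> snd (r (e, b)) \<in> I"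
    and PQ: "\<phi> \<in> P.space_of A \<Longrightarrow> shear I p q \<phi> \<in> Q.space_of A"
    and QP: "\<phi> \<in> Q.space_of A \<Longrightarrow> shear I p q \<phi> \<in> P.space_of A"
begin

abbreviation \<sigma> where "\<sigma> \<equiv> shear I p q"

abbreviation T where "T \<equiv> transfer P.rest M P.cyc Q.cyc \<sigma>"

lemma rev: "oriented_pair G M r' Q r P I p q"
proof unfold_locales
  show "r (e, b) = r' (e, b) \<or> r (e, b) = prod.swap (r' (e, b))" if "e \<in> M" for e b
    using r'[OF that, of b] by (metis swap_swap)
  show "fst (r' (e, b)) \<in> I \<longleftrightarrow> snd (r' (e, b)) \<in> I" if "e \<in> M" for e b
    using r'[OF that, of b] side[OF that, of b] by (metis fst_swap snd_swap)
qed (use I pq PQ QP in auto)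

lemma sum_swap:
  assumes "e \<in> M"
  shows "contract (fst (r' (e, b))) \<phi> K + contract (snd (r' (e, b))) \<phi> K = contract (fst (r (e, b))) \<phi> K + contract (snd (r (e, b))) \<phi> K"
  using r'[OF assms, of b] by (metis fst_swap snd_swap add.commute)

text \<open>The contraction with the sum of the two edges at an end commutes with the shear. If it
  kills the sheared functional, it also kills the shear of that, which is the original one.\<close>

lemma joined_imp:
  assumes e: "e \<in> M" and "P.joined A e"
  shows "Q.joined A e"
  unfolding Q.joined_iff[OF e] sum_swap[OF e]
proof (intro ballI allI)
  fix \<phi> K assume \<phi>: "\<phi> \<in> Q.space_of A"
  let ?x = "fst (r (e, False))" and ?y = "snd (r (e, False))"
  have "contract ?x (\<sigma> \<phi>) L + contract ?y (\<sigma> \<phi>) L = 0" for L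
    using assms(2) QP[OF \<phi>] unfolding P.joined_iff[OF e] by blast
  then have "\<sigma> (\<lambda>L. contract ?x (\<sigma> \<phi>) L + contract ?y (\<sigma> \<phi>) L) K = 0" by simp
  then show "contract ?x \<phi> K + contract ?y \<phi> K = 0"
    using contract2_shear[OF I(1) pq side[OF e, of False], of "\<sigma> \<phi>" K] by (simp add: shear_shear[OF I(1) pq])
qed

lemma joined_eq:
  assumes e: "e \<in> M"
  shows "Q.joined A e = P.joined A e"
proof -
  interpret R: oriented_pair G M r' Q r P I p q by (rule rev)
  show ?thesis using joined_imp[OF e] R.joined_imp[OF e] by blast
qed

lemma encode_T:
  assumes "A \<subseteq> M"
  shows "encode P.rest (Q.cyc A) (\<lambda>l. T c (A, l)) = \<sigma> (encode P.rest (P.cyc A) (\<lambda>l. c (A, l)))"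
proof (rule encode_dec)
  have "encode P.rest (P.cyc A) (\<lambda>l. c (A, l)) \<in> P.space_of A"
    using encode_in_state_space[OF P.cyc_partition] by (simp add: P.cyc_state_space)
  then show "\<sigma> (encode P.rest (P.cyc A) (\<lambda>l. c (A, l))) \<in> state_space P.rest (part_rel (Q.cyc A))"
    using PQ by (simp add: Q.cyc_state_space)
qed (use assms P.fin Q.cyc_partition in \<open>auto simp: transfer_def\<close>)

lemma encode_inject:
  assumes "\<And>A l. \<not> (A \<subseteq> M \<and> l \<in> Q.cyc A \<rightarrow>\<^sub>E UNIV) \<Longrightarrow> c (A, l) = 0"
    "\<And>A l. \<not> (A \<subseteq> M \<and> l \<in> Q.cyc A \<rightarrow>\<^sub>E UNIV) \<Longrightarrow> d (A, l) = 0"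
    "\<And>A. A \<subseteq> M \<Longrightarrow> encode P.rest (Q.cyc A) (\<lambda>l. c (A, l)) = encode P.rest (Q.cyc A) (\<lambda>l. d (A, l))"
  shows "c = d"
proof
  fix x :: "'e set \<times> ('e set \<Rightarrow> gen)"
  obtain A l where x: "x = (A, l)" by (cases x)
  show "c x = d x"
  proof (cases "A \<subseteq> M \<and> l \<in> Q.cyc A \<rightarrow>\<^sub>E UNIV")
    case True
    then have "encode P.rest (Q.cyc A) (\<lambda>l. c (A, l)) (transversal (Q.cyc A) l) =
        encode P.rest (Q.cyc A) (\<lambda>l. d (A, l)) (transversal (Q.cyc A) l)"
      using assms(3) by simp
    then show ?thesis using True by (simp add: x encode_transversal[OF Q.cyc_partition])
  qed (use assms(1,2) x in auto)
qed

lemma T_outside: "\<not> (A \<subseteq> M \<and> l \<in> Q.cyc A \<rightarrow>\<^sub>E UNIV) \<Longrightarrow> T c (A, l) = 0"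
  by (auto simp: transfer_def)

text \<open>\<open>saddle_map\<close> contains the two edges only through their sum, which is fixed
  by the shear and is the same for \<open>r\<close> and \<open>r'\<close>.\<close>

lemma shear_saddle_map:
  assumes e: "e \<in> M"
  shows "\<sigma> (saddle_map s s' (fst (r (e, False))) (snd (r (e, False))) \<phi>) =
    saddle_map s s' (fst (r' (e, False))) (snd (r' (e, False))) (\<sigma> \<phi>)"
proof -
  have "\<sigma> (\<lambda>K. contract (fst (r (e, False))) \<phi> K + contract (snd (r (e, False))) \<phi> K) =
    (\<lambda>K. contract (fst (r' (e, False))) (\<sigma> \<phi>) K + contract (snd (r' (e, False))) (\<sigma> \<phi>) K)"
    using contract2_shear[OF I(1) pq side[OF e, of False], of \<phi>] sum_swap[OF e] by (simp add: fun_eq_iff)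
  then show ?thesis
    unfolding saddle_map_def[abs_def] by (cases s; cases s') simp_all
qed

lemma T_differential: "T (differential G P M c) = differential G Q M (T c)"
proof (rule encode_inject)
  fix A assume A: "A \<subseteq> M"
  have AM: "e \<in> M" "A - {e} \<subseteq> M" if "e \<in> A" for e using A that by auto
  have "encode P.rest (Q.cyc A) (\<lambda>l. T (differential G P M c) (A, l)) =
      \<sigma> (\<lambda>K. \<Sum>e\<in>A. saddle_map (P.joined (A - {e}) e) (P.joined A e) (fst (r (e, False))) (snd (r (e, False)))
      (encode P.rest (P.cyc (A - {e})) (\<lambda>l. c (A - {e}, l))) K)"
    by (simp only: encode_T[OF A] P.encode_differential[OF A])
  also have "\<dots> = (\<lambda>K. \<Sum>e\<in>A. saddle_map (Q.joined (A - {e}) e) (Q.joined A e) (fst (r' (e, False))) (snd (r' (e, False)))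
      (encode P.rest (Q.cyc (A - {e})) (\<lambda>l. T c (A - {e}, l))) K)"
    unfolding shear_sum using AM by (intro ext sum.cong) (simp_all add: shear_saddle_map joined_eq encode_T)
  also have "\<dots> = encode P.rest (Q.cyc A) (\<lambda>l. differential G Q M (T c) (A, l))"
    by (simp only: Q.encode_differential[OF A])
  finally show "encode P.rest (Q.cyc A) (\<lambda>l. T (differential G P M c) (A, l)) =
    encode P.rest (Q.cyc A) (\<lambda>l. differential G Q M (T c) (A, l))" .
qed (simp_all only: T_outside Q.differential_outside simp_thms)

lemma shear_singletons:
  assumes "\<phi> \<in> {\<phi> \<in> P.space_of A. \<forall>K. \<phi> K \<noteq> 0 \<longrightarrow> card K = 1}"
  shows "\<sigma> \<phi> \<in> {\<phi> \<in> Q.space_of A. \<forall>K. \<phi> K \<noteq> 0 \<longrightarrow> card K = 1}"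
proof -
  have "\<forall>K. \<phi> K \<noteq> 0 \<longrightarrow> finite K \<and> card K = 1"
    using assms by (metis (mono_tags, lifting) mem_Collect_eq card.infinite zero_neq_one)
  then show ?thesis using assms PQ shear_card[of \<phi> 1] by auto
qed

text \<open>The shear does not map circles to circles, so their number is read off from the members
  of the state spaces supported on one-element sets, between which the shear is a bijection.\<close>

lemma card_cyc: "card (P.cyc A) = card (Q.cyc A)"
proof -
  interpret R: oriented_pair G M r' Q r P I p q by (rule rev)
  have "bij_betw \<sigma> {\<phi> \<in> P.space_of A. \<forall>K. \<phi> K \<noteq> 0 \<longrightarrow> card K = 1} {\<phi> \<in> Q.space_of A. \<forall>K. \<phi> K \<noteq> 0 \<longrightarrow> card K = 1}"
    by (rule bij_betw_byWitness[where f' = \<sigma>])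
      (use shear_shear[OF I(1) pq] shear_singletons R.shear_singletons in blast)+
  then have "card {\<phi> \<in> P.space_of A. \<forall>K. \<phi> K \<noteq> 0 \<longrightarrow> card K = 1} = card {\<phi> \<in> Q.space_of A. \<forall>K. \<phi> K \<noteq> 0 \<longrightarrow> card K = 1}"
    by (rule bij_betw_same_card)
  then have "(2::nat) ^ card (P.cyc A) = 2 ^ card (Q.cyc A)"
    using card_classes_state_space[OF P.cyc_partition[of A] P.fin(3)]
      card_classes_state_space[OF Q.cyc_partition[of A] P.fin(3)]
    by (simp only: P.cyc_state_space Q.cyc_state_space)
  then show ?thesis by simp
qed

lemma T_cochains:
  assumes c: "c \<in> cochains G P M i j"
  shows "T c \<in> cochains G Q M i j"
proof -
  have "(A, l) \<in> cochain_basis G Q M i j" if nz: "T c (A, l) \<noteq> 0" for A l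
  proof -
    have A: "A \<subseteq> M" "l \<in> Q.cyc A \<rightarrow>\<^sub>E UNIV" using nz T_outside by blast+
    let ?K = "transversal (Q.cyc A) l" and ?\<phi> = "encode P.rest (P.cyc A) (\<lambda>l. c (A, l))"
    have nz': "\<sigma> ?\<phi> ?K \<noteq> 0" using nz A by (simp add: transfer_def)
    then have "\<exists>L. ?\<phi> L \<noteq> 0"
      by (metis (no_types) ext shear_zero)
    then obtain L where L: "?\<phi> L \<noteq> 0" by blast
    \<comment> \<open>For fixed \<open>A\<close>, \<open>i\<close> and \<open>j\<close> all sets in
      the support have the same size.\<close>
    have "card L' = card L \<and> finite L'" if "?\<phi> L' \<noteq> 0" for L'
      using P.encode_cochain[OF c L] P.encode_cochain[OF c that] by simp
    then have "card ?K = card L" using shear_card[OF _ nz'] by blast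
    moreover have "lab_of (Q.cyc A) ?K = l" using lab_of_transversal[OF Q.cyc_partition A(2)] .
    moreover have "(\<Sum>Z\<in>Q.cyc A. gen_deg (lab_of (Q.cyc A) ?K Z)) = 2 * int (card ?K) - int (card (Q.cyc A))"
      using gen_deg_lab_of[OF Q.cyc_partition P.fin(3) transversal_sub[OF Q.cyc_partition] thin_transversal[OF Q.cyc_partition]] .
    ultimately show ?thesis
      using A P.encode_cochain[OF c L] by (simp add: cochain_basis_def labellings_def Q.circ card_cyc)
  qed
  then show ?thesis by (auto simp: cochains_def)
qed

lemma T_T:
  assumes "c \<in> cochains G P M i j"
  shows "transfer P.rest M Q.cyc P.cyc \<sigma> (T c) = c"
proof -
  interpret R: oriented_pair G M r' Q r P I p q by (rule rev)
  show ?thesis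
  proof (rule R.encode_inject)
    show "encode P.rest (P.cyc A) (\<lambda>l. R.T (T c) (A, l)) = encode P.rest (P.cyc A) (\<lambda>l. c (A, l))" if "A \<subseteq> M" for A
      by (simp only: R.encode_T[OF that] encode_T[OF that] shear_shear[OF I(1) pq])
  qed (simp_all only: R.T_outside P.cochains_outside[OF assms] simp_thms)
qed

lemma encode_add: "encode E \<C> (\<lambda>l. c l + d l) = (\<lambda>K. encode E \<C> c K + encode E \<C> d K)"
  by (auto simp: encode_def fun_eq_iff)

lemma encode_scale: "encode E \<C> (\<lambda>l. a * c l) = (\<lambda>K. a * encode E \<C> c K)"
  by (auto simp: encode_def fun_eq_iff)

theorem T_linear_iso: "linear_iso (cochains G P M i j) (cochains G Q M i j) T"
proof -
  interpret R: oriented_pair G M r' Q r P I p q by (rule rev)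
  have "bij_betw T (cochains G P M i j) (cochains G Q M i j)"
    by (rule bij_betw_byWitness[where f' = R.T]) (use T_T R.T_T T_cochains R.T_cochains in blast)+
  then show ?thesis
    unfolding linear_iso_def
    by (auto simp: transfer_def fun_eq_iff encode_add encode_scale shear_add shear_scale)
qed

end

section \<open>Composition of isomorphisms of complexes\<close>

definition iso_complexes :: "('v, 'e) mgraph \<Rightarrow> 'e set \<Rightarrow> ('v, 'e) drawing \<Rightarrow> ('v, 'e) drawing \<Rightarrow> bool" where
  "iso_complexes G M P Q \<longleftrightarrow> (\<exists>S :: nat \<Rightarrow> int \<Rightarrow> 'e cochain \<Rightarrow> 'e cochain. \<forall>i j.
           linear_iso (cochains G P M i j) (cochains G Q M i j) (S i j) \<and>
           (\<forall>c\<in>cochains G P M i j.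
              S (Suc i) j (differential G P M c) = differential G Q M (S i j c)))"

lemma iso_complexes_refl: "iso_complexes G M P P"
  unfolding iso_complexes_def linear_iso_def
  by (rule exI[of _ "\<lambda>i j c. c"]) (auto simp: bij_betw_def)

lemma iso_complexes_trans:
  assumes "iso_complexes G M P Q" "iso_complexes G M Q R"
  shows "iso_complexes G M P R"
proof -
  obtain S where S: "linear_iso (cochains G P M i j) (cochains G Q M i j) (S i j)"
      "\<And>c. c \<in> cochains G P M i j \<Longrightarrow> S (Suc i) j (differential G P M c) = differential G Q M (S i j c)" for i j
    using assms(1) unfolding iso_complexes_def by blast
  obtain S' where S': "linear_iso (cochains G Q M i j) (cochains G R M i j) (S' i j)"
      "\<And>c. c \<in> cochains G Q M i j \<Longrightarrow> S' (Suc i) j (differential G Q M c) = differential G R M (S' i j c)" for i j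
    using assms(2) unfolding iso_complexes_def by blast
  have mem: "S i j c \<in> cochains G Q M i j" if "c \<in> cochains G P M i j" for c i j
    using S(1)[of i j] that unfolding linear_iso_def bij_betw_def by blast
  have "linear_iso (cochains G P M i j) (cochains G R M i j) (S' i j \<circ> S i j)" for i j
    unfolding linear_iso_def
  proof (intro conjI ballI allI)
    show "bij_betw (S' i j \<circ> S i j) (cochains G P M i j) (cochains G R M i j)"
      using S(1)[of i j] S'(1)[of i j] unfolding linear_iso_def by (blast intro: bij_betw_trans)
  next
    fix c d assume "c \<in> cochains G P M i j" "d \<in> cochains G P M i j"
    then show "(S' i j \<circ> S i j) (\<lambda>b. c b + d b) = (\<lambda>b. (S' i j \<circ> S i j) c b + (S' i j \<circ> S i j) d b)"
      using S(1)[of i j] S'(1)[of i j] mem unfolding linear_iso_def by simp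
  next
    fix a c assume "c \<in> cochains G P M i j"
    then show "(S' i j \<circ> S i j) (\<lambda>b. a * c b) = (\<lambda>b. a * (S' i j \<circ> S i j) c b)"
      using S(1)[of i j] S'(1)[of i j] mem unfolding linear_iso_def by simp
  qed
  moreover have "(S' (Suc i) j \<circ> S (Suc i) j) (differential G P M c) = differential G R M ((S' i j \<circ> S i j) c)"
    if "c \<in> cochains G P M i j" for i j c
    using S(2)[OF that] S'(2)[OF mem[OF that]] by simp
  ultimately show ?thesis
    unfolding iso_complexes_def by (intro exI[of _ "\<lambda>i j. S' i j \<circ> S i j"]) blast
qed

theorem mutation_iso_complexes:
  assumes "trivalent G" "perfect_matching G M" "rotation G M r" "W \<subseteq> verts G"
    and r': "\<And>e b. e \<in> M \<Longrightarrow> r' (e, b) = (if ends G e b \<in> W then prod.swap (r (e, b)) else r (e, b))"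
    and card: "card {a \<in> links G. crossing G W a} \<le> 2"
    and P: "\<And>A. state_circles G P M A = classes ((links G - M) \<union> circs G) (arcs M A r)"
    and Q: "\<And>A. state_circles G Q M A = classes ((links G - M) \<union> circs G) (arcs M A r')"
  shows "iso_complexes G M P Q"
proof -
  interpret mutation G M r r' W
    using assms by unfold_locales auto
  interpret R: mutation G M r' r W by (rule rev)
  obtain I p q where I: "finite I" "I \<subseteq> rest" "p \<in> I \<longleftrightarrow> q \<in> I"
    "\<And>g c. g \<in> M \<Longrightarrow> fst (r (g, c)) \<in> I \<longleftrightarrow> snd (r (g, c)) \<in> I"
    "\<And>A \<phi>. \<phi> \<in> state_space rest (arcs M A r) \<Longrightarrow> shear I p q \<phi> \<in> state_space rest (arcs M A r')"
    "\<And>A \<phi>. \<phi> \<in> state_space rest (arcs M A r') \<Longrightarrow> shear I p q \<phi> \<in> state_space rest (arcs M A r)"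
    using mutation_shear[OF card] by metis
  interpret oriented_pair G M r P r' Q I p q
    by unfold_locales (use I P Q r' in \<open>auto simp: cyc_def R.cyc_def rest_def\<close>)
  show ?thesis
    unfolding iso_complexes_def using T_linear_iso T_differential
    by (intro exI[of _ "\<lambda>i j. T"]) blast
qed

section \<open>Turning of three arcs in the plane\<close>

text \<open>
  Let three arcs leave a common point and be disjoint otherwise. On the square without its corner
  \<open>(0, 0)\<close>, the difference \<open>a s - b t\<close> of two of them has a continuous logarithm \<open>L\<close>, and
  \<open>Im (L (0, 1)) - Im (L (1, 0))\<close> is the total turning of its direction. The sum of these
  turnings over the three cyclically consecutive pairs is \<open>-\<pi>\<close> or \<open>\<pi>\<close>, according to whether the arcs leave
  counterclockwise or clockwise.
\<close>

definition legs :: "(real \<Rightarrow> 'a::topological_space) \<Rightarrow> (real \<Rightarrow> 'a) \<Rightarrow> bool" where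
  "legs a b \<longleftrightarrow> continuous_on {0..1} a \<and> continuous_on {0..1} b \<and> a 0 = b 0 \<and>
     (\<forall>s\<in>{0..1}. \<forall>t\<in>{0..1}. a s = b t \<longrightarrow> s = 0 \<and> t = 0)"

definition quad :: "(real \<times> real) set" where
  "quad = {0..1} \<times> {0..1} - {(0, 0)}"

definition diff_log :: "(real \<Rightarrow> complex) \<Rightarrow> (real \<Rightarrow> complex) \<Rightarrow> (real \<times> real \<Rightarrow> complex) \<Rightarrow> bool" where
  "diff_log a b L \<longleftrightarrow> continuous_on quad L \<and> (\<forall>s t. (s, t) \<in> quad \<longrightarrow> exp (L (s, t)) = a s - b t)"

definition turn :: "(real \<times> real \<Rightarrow> complex) \<Rightarrow> real" where
  "turn L = Im (L (0, 1)) - Im (L (1, 0))"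

definition tri :: "(real \<Rightarrow> complex) \<Rightarrow> (real \<Rightarrow> complex) \<Rightarrow> (real \<Rightarrow> complex) \<Rightarrow> real \<Rightarrow> bool" where
  "tri a b c n \<longleftrightarrow> (\<exists>L1 L2 L3. diff_log a b L1 \<and> diff_log b c L2 \<and> diff_log c a L3 \<and>
     turn L1 + turn L2 + turn L3 = n * pi)"

lemma quad_simps [simp]:
  "(0, t) \<in> quad \<longleftrightarrow> 0 < t \<and> t \<le> 1" "(t, 0) \<in> quad \<longleftrightarrow> 0 < t \<and> t \<le> 1"
  "(1, t) \<in> quad \<longleftrightarrow> 0 \<le> t \<and> t \<le> 1" "(t, 1) \<in> quad \<longleftrightarrow> 0 \<le> t \<and> t \<le> 1"
  by (auto simp: quad_def)

lemma contractible_quad: "contractible quad"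
proof (rule starlike_imp_contractible)
  show "starlike quad"
    unfolding starlike_def
  proof (intro bexI[of _ "(1, 1)"] ballI subsetI)
    fix x z assume x: "x \<in> quad" and z: "z \<in> closed_segment (1, 1) x"
    obtain s t where st: "x = (s, t)" by (cases x)
    from z obtain u where u: "0 \<le> u" "u \<le> 1" "z = (1 - u) *\<^sub>R (1, 1) + u *\<^sub>R x"
      by (auto simp: in_segment)
    have zz: "z = (1 - u + u * s, 1 - u + u * t)" using u(3) st by simp
    have s: "0 \<le> s" "s \<le> 1" "0 \<le> t" "t \<le> 1" "\<not> (s = 0 \<and> t = 0)" using x st by (auto simp: quad_def)
    have "0 \<le> u * s" "0 \<le> u * t" "u * s \<le> u" "u * t \<le> u"
      using u s by (auto simp: mult_left_le)
    moreover have "\<not> (1 - u + u * s = 0 \<and> 1 - u + u * t = 0)"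
    proof
      assume *: "1 - u + u * s = 0 \<and> 1 - u + u * t = 0"
      then have "u = 1" using u \<open>0 \<le> u * s\<close> by linarith
      then show False using * s by simp
    qed
    ultimately show "z \<in> quad" unfolding zz quad_def using u by auto
  qed (auto simp: quad_def)
qed

text \<open>Two logarithms of one number differ by an integer multiple of 2 pi i, so a continuous
  choice of them cannot move.\<close>

lemma exp_eq_const:
  fixes g :: "'a::topological_space \<Rightarrow> complex"
  assumes "connected S" "continuous_on S g" "\<And>x. x \<in> S \<Longrightarrow> exp (g x) = k" "x \<in> S" "y \<in> S"
  shows "g x = g y"
proof -
  have "g constant_on S"
  proof (rule continuous_discrete_range_constant[OF assms(1,2)])
    fix x assume x: "x \<in> S"
    have "2 * pi \<le> norm (g y - g x)" if y: "y \<in> S" "g y \<noteq> g x" for y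
    proof -
      have "exp (g y) = exp (g x)" using assms(3) x y by simp
      then obtain n :: int where n: "g y = g x + of_int (2 * n) * pi * \<i>"
        by (auto simp: exp_eq)
      then have "n \<noteq> 0" using y by auto
      then have "1 \<le> \<bar>real_of_int n\<bar>" by linarith
      moreover have "norm (g y - g x) = 2 * \<bar>real_of_int n\<bar> * pi"
        using n by (simp add: norm_mult)
      ultimately show ?thesis by simp
    qed
    then show "\<exists>e>0. \<forall>y. y \<in> S \<and> g y \<noteq> g x \<longrightarrow> e \<le> norm (g y - g x)"
      by (intro exI[of _ "2 * pi"]) auto
  qed
  then show ?thesis using assms(4,5) unfolding constant_on_def by metis
qed

lemma legsD: "legs a b \<Longrightarrow> s \<in> {0..1} \<Longrightarrow> t \<in> {0..1} \<Longrightarrow> a s = b t \<Longrightarrow> s = 0 \<and> t = 0"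
  by (simp add: legs_def)

lemma legs_cont: "legs a b \<Longrightarrow> continuous_on {0..1} a" "legs a b \<Longrightarrow> continuous_on {0..1} b"
  and legs_0: "legs a b \<Longrightarrow> a 0 = b 0"
  by (simp_all add: legs_def)

lemma diff_logD: "diff_log a b L \<Longrightarrow> (s, t) \<in> quad \<Longrightarrow> exp (L (s, t)) = a s - b t"
  and diff_log_cont: "diff_log a b L \<Longrightarrow> continuous_on quad L"
  by (simp_all add: diff_log_def)

lemma diff_logI:
  assumes "continuous_on quad L" "\<And>s t. (s, t) \<in> quad \<Longrightarrow> exp (L (s, t)) = a s - b t"
  shows "diff_log a b L"
  using assms by (simp add: diff_log_def)

lemma diff_log_ex:
  assumes "legs a b"
  shows "\<exists>L. diff_log a b L"
proof -
  have cont: "continuous_on quad (\<lambda>z. a (fst z) - b (snd z))"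
    by (intro continuous_intros continuous_on_compose2[OF legs_cont(1)[OF assms]] continuous_on_compose2[OF legs_cont(2)[OF assms]])
      (auto simp: quad_def)
  have nz: "a (fst z) - b (snd z) \<noteq> 0" if "z \<in> quad" for z
  proof
    assume "a (fst z) - b (snd z) = 0"
    then have "a (fst z) = b (snd z)" by simp
    moreover have "fst z \<in> {0..1}" "snd z \<in> {0..1}" "z \<noteq> (0, 0)" using that by (auto simp: quad_def)
    ultimately show False using legsD[OF assms] by (metis prod.collapse)
  qed
  obtain L where L: "continuous_on quad L" "\<And>z. z \<in> quad \<Longrightarrow> a (fst z) - b (snd z) = exp (L z)"
    using continuous_logarithm_on_contractible[OF cont contractible_quad nz] by metis
  have "exp (L (s, t)) = a s - b t" if "(s, t) \<in> quad" for s t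
    using L(2)[OF that] by simp
  then show ?thesis using L(1) diff_logI by blast
qed

lemma diff_log_unique:
  assumes "diff_log a b L" "diff_log a b L'"
  shows "turn L = turn L'"
proof -
  have "(\<lambda>z. L z - L' z) (0, 1) = (\<lambda>z. L z - L' z) (1, 0)"
  proof (rule exp_eq_const[where S = quad and k = 1])
    show "connected quad" using contractible_quad by (rule contractible_imp_connected)
    show "continuous_on quad (\<lambda>z. L z - L' z)"
      using assms by (intro continuous_intros diff_log_cont)
    fix z assume z: "z \<in> quad"
    then have "exp (L z) = exp (L' z)" using diff_logD[OF assms(1)] diff_logD[OF assms(2)] by (cases z) simp
    then show "exp (L z - L' z) = 1" by (simp add: exp_diff)
  qed auto
  then have "L (0, 1) - L (1, 0) = L' (0, 1) - L' (1, 0)" by (simp add: algebra_simps)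
  then show ?thesis unfolding turn_def by (metis minus_complex.sel(2))
qed

lemma tri_unique: "tri a b c n \<Longrightarrow> tri a b c m \<Longrightarrow> n = m"
  unfolding tri_def by (elim exE conjE) (metis diff_log_unique mult_cancel_right pi_neq_zero)

lemma tri_ex:
  assumes "legs a b" "legs b c" "legs c a"
  shows "\<exists>n. tri a b c n"
proof -
  obtain L1 L2 L3 where "diff_log a b L1" "diff_log b c L2" "diff_log c a L3"
    using assms diff_log_ex by metis
  then show ?thesis unfolding tri_def
    by (intro exI[of _ "(turn L1 + turn L2 + turn L3) / pi"] exI[of _ L1] exI[of _ L2] exI[of _ L3]) simp
qed

text \<open>On one side of each square the logarithms belong to \<open>a s - b 0\<close> and to
  \<open>c 0 - a s\<close>, which are negatives of each other when \<open>b\<close> and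
  \<open>c\<close> start at the same point. Their difference is a logarithm of -1 and hence constant
  along \<open>a\<close>.\<close>

lemma diff_log_bracket:
  assumes "diff_log a b L" "diff_log c a L'" "b 0 = c 0" and s: "0 < s" "s \<le> 1" "0 < s'" "s' \<le> 1"
  shows "L' (0, s) - L (s, 0) = L' (0, s') - L (s', 0)"
    and "exp (L' (0, s) - L (s, 0)) = -1"
proof -
  have 1: "exp (L' (0, s) - L (s, 0)) = -1" if "s \<in> {0<..1}" for s
  proof -
    have "exp (L' (0, s)) = c 0 - a s" "exp (L (s, 0)) = a s - b 0"
      using diff_logD[OF assms(2), of 0 s] diff_logD[OF assms(1), of s 0] that by auto
    moreover have "a s - b 0 \<noteq> 0" using exp_not_eq_zero[of "L (s, 0)"] calculation(2) by metis
    ultimately show ?thesis using assms(3) by (simp add: exp_diff divide_simps)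
  qed
  show "exp (L' (0, s) - L (s, 0)) = -1" using 1 s by auto
  show "L' (0, s) - L (s, 0) = L' (0, s') - L (s', 0)"
  proof (rule exp_eq_const[where S = "{0<..1}" and k = "-1" and g = "\<lambda>s. L' (0, s) - L (s, 0)"])
    show "continuous_on {0<..1} (\<lambda>s. L' (0, s) - L (s, 0))"
      by (intro continuous_intros continuous_on_compose2[OF diff_log_cont[OF assms(1)]]
          continuous_on_compose2[OF diff_log_cont[OF assms(2)]]) auto
  qed (use 1 s in auto)
qed

text \<open>The cyclic sum of turnings is regrouped into three brackets, one for each arc, by
  collecting the two terms in which this arc is at its end point and the other arc at the common
  origin. By \<open>diff_log_bracket\<close> a bracket is constant along its arc, so shortening and
  reparametrizing do not change the sum.\<close>

lemma tri_reparam: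
  assumes T: "tri a b c n" and z: "a 0 = b 0" "b 0 = c 0"
    and cont: "continuous_on {0..1} f" "continuous_on {0..1} g" "continuous_on {0..1} h"
    and range: "\<And>s. s \<in> {0..1} \<Longrightarrow> f s \<in> {0..1} \<and> g s \<in> {0..1} \<and> h s \<in> {0..1}"
    and zero: "f 0 = 0" "g 0 = 0" "h 0 = 0"
    and pos: "\<And>s. s \<in> {0<..1} \<Longrightarrow> 0 < f s \<and> 0 < g s \<and> 0 < h s"
  shows "tri (a \<circ> f) (b \<circ> g) (c \<circ> h) n"
proof -
  from T obtain L1 L2 L3 where L: "diff_log a b L1" "diff_log b c L2" "diff_log c a L3"
    "turn L1 + turn L2 + turn L3 = n * pi"
    unfolding tri_def by blast
  have comp: "diff_log (a \<circ> f) (b \<circ> g) (\<lambda>z. L (f (fst z), g (snd z)))"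
    if dl: "diff_log a b L" and cf: "continuous_on {0..1} f" and cg: "continuous_on {0..1} g"
      and rg: "\<And>s. s \<in> {0..1} \<Longrightarrow> f s \<in> {0..1} \<and> g s \<in> {0..1}"
      and ps: "\<And>s. s \<in> {0<..1} \<Longrightarrow> 0 < f s \<and> 0 < g s" for a b f g L
  proof -
    have mem: "(f s, g t) \<in> quad" if st: "(s, t) \<in> quad" for s t
    proof -
      have "0 < f s \<or> 0 < g t" using st ps[of s] ps[of t]
        by (cases "s = 0") (auto simp: quad_def)
      then show ?thesis using st rg[of s] rg[of t] by (auto simp: quad_def)
    qed
    have "continuous_on quad (\<lambda>z. L (f (fst z), g (snd z)))"
    proof (rule continuous_on_compose2[OF diff_log_cont[OF dl]])
      show "continuous_on quad (\<lambda>z. (f (fst z), g (snd z)))"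
        by (intro continuous_intros continuous_on_compose2[OF cf] continuous_on_compose2[OF cg])
          (auto simp: quad_def)
      show "(\<lambda>z. (f (fst z), g (snd z))) ` quad \<subseteq> quad" using mem by auto
    qed
    then show ?thesis using diff_logD[OF dl mem] by (intro diff_logI) simp_all
  qed
  let ?L1 = "\<lambda>z. L1 (f (fst z), g (snd z))" and ?L2 = "\<lambda>z. L2 (g (fst z), h (snd z))"
    and ?L3 = "\<lambda>z. L3 (h (fst z), f (snd z))"
  have "diff_log (a \<circ> f) (b \<circ> g) ?L1" "diff_log (b \<circ> g) (c \<circ> h) ?L2" "diff_log (c \<circ> h) (a \<circ> f) ?L3"
    by (rule comp[OF L(1) cont(1,2)] comp[OF L(2) cont(2,3)] comp[OF L(3) cont(3,1)];
        use range pos in blast)+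
  moreover have "turn ?L1 + turn ?L2 + turn ?L3 = n * pi"
  proof -
    have 1: "0 < f 1" "f 1 \<le> 1" "0 < g 1" "g 1 \<le> 1" "0 < h 1" "h 1 \<le> 1"
      using range[of 1] pos[of 1] by auto
    have "L3 (0, f 1) - L1 (f 1, 0) = L3 (0, 1) - L1 (1, 0)"
      "L1 (0, g 1) - L2 (g 1, 0) = L1 (0, 1) - L2 (1, 0)"
      "L2 (0, h 1) - L3 (h 1, 0) = L2 (0, 1) - L3 (1, 0)"
      using diff_log_bracket(1)[OF L(1,3), of "f 1" 1] diff_log_bracket(1)[OF L(2,1), of "g 1" 1]
        diff_log_bracket(1)[OF L(3,2), of "h 1" 1] 1 z by simp_all
    then have "Im (L3 (0, f 1)) - Im (L1 (f 1, 0)) = Im (L3 (0, 1)) - Im (L1 (1, 0))"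
      "Im (L1 (0, g 1)) - Im (L2 (g 1, 0)) = Im (L1 (0, 1)) - Im (L2 (1, 0))"
      "Im (L2 (0, h 1)) - Im (L3 (h 1, 0)) = Im (L2 (0, 1)) - Im (L3 (1, 0))"
      by (metis minus_complex.sel(2))+
    then show ?thesis using L(4) by (simp add: turn_def zero)
  qed
  ultimately show ?thesis unfolding tri_def by blast
qed

text \<open>
  Points \<open>c + exp z\<close>, \<open>c - exp z\<close> parametrize all pairs of distinct points of the plane by a
  convex set.
\<close>

lemma diff_log_center:
  assumes f: "continuous_on UNIV f" "inj f"
  obtains \<Psi> :: "complex \<times> complex \<Rightarrow> complex" and d :: real where
    "continuous_on UNIV \<Psi>" "\<And>c z. exp (\<Psi> (c, z)) = f (c + exp z) - f (c - exp z)"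
    "\<And>c z m. \<Psi> (c, z + of_int m * pi * \<i>) = \<Psi> (c, z) + of_int m * d * pi * \<i>"
proof -
  have cf: "continuous_on UNIV (\<lambda>x. f (g x))" if "continuous_on UNIV g" for g :: "complex \<times> complex \<Rightarrow> complex"
    using continuous_on_compose2[OF f(1) that] by auto
  have cont: "continuous_on UNIV (\<lambda>x::complex \<times> complex. f (fst x + exp (snd x)) - f (fst x - exp (snd x)))"
    by (intro continuous_intros cf)
  have nz: "f (fst x + exp (snd x)) - f (fst x - exp (snd x)) \<noteq> 0" for x :: "complex \<times> complex"
  proof
    assume "f (fst x + exp (snd x)) - f (fst x - exp (snd x)) = 0"
    then have "fst x + exp (snd x) = fst x - exp (snd x)" using f(2) by (simp add: inj_eq)
    then show False using exp_not_eq_zero[of "snd x"] by (simp add: eq_diff_eq)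
  qed
  obtain \<Psi> where \<Psi>: "continuous_on UNIV \<Psi>"
      "\<And>x. x \<in> UNIV \<Longrightarrow> f (fst x + exp (snd x)) - f (fst x - exp (snd x)) = exp (\<Psi> x)"
    using continuous_logarithm_on_contractible[OF cont _ nz] convex_imp_contractible[OF convex_UNIV] by blast
  have \<Psi>e: "exp (\<Psi> (c, z)) = f (c + exp z) - f (c - exp z)" for c z using \<Psi>(2)[of "(c, z)"] by simp
  \<comment> \<open>Adding pi i to \<open>z\<close> exchanges the two points and negates the
    difference of their images. So \<open>D\<close> is a continuous logarithm of -1 and therefore
    constant; \<open>d\<close> is its value in units of pi i.\<close>
  define D where "D x = \<Psi> (fst x, snd x + pi * \<i>) - \<Psi> x" for x
  have expD: "exp (D x) = -1" for x
  proof -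
    obtain c z where x: "x = (c, z)" by (cases x)
    have "exp (z + pi * \<i>) = - exp z" by (simp add: exp_add)
    then have "exp (\<Psi> (c, z + pi * \<i>)) = - exp (\<Psi> (c, z))" by (simp add: \<Psi>e)
    then show ?thesis by (simp add: D_def x exp_diff)
  qed
  have contD: "continuous_on UNIV D"
    unfolding D_def using \<Psi>(1)
    by (intro continuous_intros continuous_on_compose2[OF \<Psi>(1)]) auto
  have const: "D x = D y" for x y
    by (rule exp_eq_const[OF _ contD, where k = "-1"]) (auto simp: expD intro: convex_connected)
  define d where "d = Im (D 0) / pi"
  have "norm (exp (D 0)) = 1" by (simp add: expD)
  then have "Re (D 0) = 0" by simp
  then have D0: "D 0 = d * pi * \<i>" by (simp add: d_def complex_eq_iff)
  have step: "\<Psi> (c, z + pi * \<i>) = \<Psi> (c, z) + d * pi * \<i>" for c z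
    using const[of "(c, z)" 0] D0 by (simp add: D_def algebra_simps)
  have nat: "\<Psi> (c, z + of_nat m * pi * \<i>) = \<Psi> (c, z) + of_nat m * d * pi * \<i>" for c z m
  proof (induction m)
    case (Suc m)
    have "z + of_nat (Suc m) * pi * \<i> = (z + of_nat m * pi * \<i>) + pi * \<i>" by (simp add: algebra_simps)
    then show ?case using step[of c "z + of_nat m * pi * \<i>"] Suc by (simp add: algebra_simps)
  qed simp
  have int: "\<Psi> (c, z + of_int m * pi * \<i>) = \<Psi> (c, z) + of_int m * d * pi * \<i>" for c z m
  proof (cases "0 \<le> m")
    case True
    then show ?thesis using nat[of c z "nat m"] by simp
  next
    case False
    have "of_nat (nat (- m)) = - (of_int m :: complex)" using False by (simp add: of_nat_nat)
    then show ?thesis using nat[of c "z + of_int m * pi * \<i>" "nat (- m)"] by (simp add: algebra_simps)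
  qed
  show thesis using that[OF \<Psi>(1) \<Psi>e int] .
qed

text \<open>The two logarithms in a bracket belong to the same pair of points in opposite order, so
  they differ by an odd multiple of pi i, and their images under \<Psi> differ by \<open>d\<close>
  times this multiple. Hence every total turning is multiplied by the same \<open>d\<close>.\<close>

theorem tri_map:
  assumes f: "continuous_on UNIV f" "inj f"
  obtains d :: real where "\<And>a b c n. legs a b \<Longrightarrow> legs b c \<Longrightarrow> legs c a \<Longrightarrow> tri a b c n \<Longrightarrow> tri (f \<circ> a) (f \<circ> b) (f \<circ> c) (d * n)"
proof -
  obtain \<Psi> :: "complex \<times> complex \<Rightarrow> complex" and d :: real where
    \<Psi>: "continuous_on UNIV \<Psi>" "\<And>c z. exp (\<Psi> (c, z)) = f (c + exp z) - f (c - exp z)"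
    "\<And>c z m. \<Psi> (c, z + of_int m * pi * \<i>) = \<Psi> (c, z) + of_int m * d * pi * \<i>"
    using diff_log_center[OF f] by blast
  \<comment> \<open>The centre is the midpoint and \<open>exp z\<close> is half the difference,
    whence the subtraction of \<open>Ln 2\<close>.\<close>
  define F where "F a b L = (\<lambda>z. \<Psi> ((a (fst z) + b (snd z)) / 2, L z - Ln 2))"
    for a b :: "real \<Rightarrow> complex" and L :: "real \<times> real \<Rightarrow> complex"
  have exp2: "exp (Ln 2 :: complex) = 2" by simp
  have F: "diff_log (f \<circ> a) (f \<circ> b) (F a b L)" if ab: "legs a b" and L: "diff_log a b L" for a b L
  proof (rule diff_logI)
    note c = legs_cont[OF ab] diff_log_cont[OF L]
    show "continuous_on quad (F a b L)"
      unfolding F_def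
      by (intro continuous_on_compose2[OF \<Psi>(1)] continuous_intros continuous_on_compose2[OF c(1)] continuous_on_compose2[OF c(2)] c(3))
        (auto simp: quad_def)
    fix s t assume "(s, t) \<in> quad"
    then have e: "exp (L (s, t) - Ln 2) = (a s - b t) / 2" using diff_logD[OF L] by (simp add: exp_diff)
    then show "exp (F a b L (s, t)) = (f \<circ> a) s - (f \<circ> b) t"
    proof -
      have "(a s + b t) / 2 + (a s - b t) / 2 = a s" "(a s + b t) / 2 - (a s - b t) / 2 = b t"
        by (simp_all add: field_simps)
      then show ?thesis by (simp only: F_def \<Psi>(2) fst_conv snd_conv e o_apply)
    qed
  qed
  have bracket: "Im (F c a L' (0, 1)) - Im (F a b L (1, 0)) = d * (Im (L' (0, 1)) - Im (L (1, 0)))"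
    if L: "diff_log a b L" "diff_log c a L'" "b 0 = c 0" for a b c L L'
  proof -
    have "exp (L' (0, 1)) = exp (L (1, 0) + pi * \<i>)"
      using diff_log_bracket(2)[OF L, of 1 1] by (simp add: exp_diff exp_add divide_simps)
    then obtain k :: int where k: "L' (0, 1) = L (1, 0) + pi * \<i> + of_int (2 * k) * pi * \<i>"
      by (auto simp: exp_eq)
    define m where "m = 2 * k + 1"
    have m: "L' (0, 1) = L (1, 0) + of_int m * pi * \<i>" using k by (simp add: m_def algebra_simps)
    have "F c a L' (0, 1) = \<Psi> ((a 1 + b 0) / 2, (L (1, 0) - Ln 2) + of_int m * pi * \<i>)"
      using L(3) by (simp add: F_def m algebra_simps)
    also have "\<dots> = F a b L (1, 0) + of_int m * d * pi * \<i>"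
      by (simp only: \<Psi>(3)) (simp add: F_def)
    finally show ?thesis using m by simp
  qed
  show thesis
  proof (rule that)
    fix a b c n assume l: "legs a b" "legs b c" "legs c a" and t: "tri a b c n"
    then obtain L1 L2 L3 where L: "diff_log a b L1" "diff_log b c L2" "diff_log c a L3"
      "turn L1 + turn L2 + turn L3 = n * pi"
      unfolding tri_def by blast
    have z: "a 0 = b 0" "b 0 = c 0" "c 0 = a 0" using l legs_0 by blast+
    have "turn (F a b L1) + turn (F b c L2) + turn (F c a L3) = d * (turn L1 + turn L2 + turn L3)"
      using bracket[OF L(1,3) z(2)] bracket[OF L(2,1) z(3)] bracket[OF L(3,2) z(1)]
      by (simp add: turn_def algebra_simps)
    then show "tri (f \<circ> a) (f \<circ> b) (f \<circ> c) (d * n)"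
      unfolding tri_def using F[OF l(1) L(1)] F[OF l(2) L(2)] F[OF l(3) L(3)] L(4)
      by (intro exI[of _ "F a b L1"] exI[of _ "F b c L2"] exI[of _ "F c a L3"]) simp
  qed
qed

section \<open>Arcs in a round disk that end on its boundary\<close>

lemma half_plane_disk:
  assumes p: "norm (p - z0) = \<rho>" and x: "norm (x - z0) \<le> \<rho>" "x \<noteq> p" and "\<rho> > 0"
  shows "Re ((p - x) / (p - z0)) > 0"
proof -
  define u where "u = (x - z0) / (p - z0)"
  have nz: "p - z0 \<noteq> 0" using p assms(4) by auto
  have "(p - x) / (p - z0) = 1 - u"
    using nz by (simp add: u_def field_simps)
  moreover have "norm u \<le> 1" using p x assms(4) by (simp add: u_def norm_divide)
  moreover have "u \<noteq> 1" using x(2) nz by (auto simp: u_def field_simps)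
  ultimately have u: "Re ((p - x) / (p - z0)) = 1 - Re u" "norm u \<le> 1" "u \<noteq> 1" by auto
  \<comment> \<open>The closed unit disk touches the line of real part 1 only in the point
    1.\<close>
  have "Re u < 1"
  proof (rule ccontr)
    assume "\<not> Re u < 1"
    moreover have "Re u \<le> norm u" by (rule complex_Re_le_cmod)
    ultimately have "Re u = 1" "norm u = 1" using u by auto
    then have "Im u = 0" using cmod_power2[of u] by simp
    then show False using \<open>Re u = 1\<close> u(3) by (simp add: complex_eq_iff)
  qed
  then show ?thesis using u by simp
qed

text \<open>The turning is computed along the sides from \<open>(1, 0)\<close> to
  \<open>(1, 1)\<close> and on to \<open>(0, 1)\<close>. On each of them one point stays on the
  boundary circle, so the difference vector remains in a half-plane bounded by the tangent direction
  there, and the principal logarithm measures the change of direction.\<close>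

lemma turn_disk:
  assumes ab: "legs a b" and L: "diff_log a b L" and "\<rho> > 0"
    and ball: "\<And>t. t \<in> {0..1} \<Longrightarrow> norm (a t - z0) \<le> \<rho> \<and> norm (b t - z0) \<le> \<rho>"
    and sph: "norm (a 1 - z0) = \<rho>" "norm (b 1 - z0) = \<rho>"
  shows "turn L = 2 * Arg (1 - (b 1 - z0) / (a 1 - z0))
    - Arg ((a 1 - a 0) / (a 1 - z0)) + Arg ((b 1 - b 0) / (b 1 - z0))"
proof -
  have nz: "a 1 - z0 \<noteq> 0" "b 1 - z0 \<noteq> 0" using sph assms(3) by auto
  have one: "Im (L (1, 1)) - Im (L (1, 0)) = Arg ((a 1 - b 1) / (a 1 - z0)) - Arg ((a 1 - b 0) / (a 1 - z0))"
  proof -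
    let ?g = "\<lambda>t. L (1, t) - Ln ((a 1 - b t) / (a 1 - z0))"
    have ne: "b t \<noteq> a 1" if "t \<in> {0..1}" for t
      using legsD[OF ab, of 1 t] that by force
    have re: "Re ((a 1 - b t) / (a 1 - z0)) > 0" if "t \<in> {0..1}" for t
      using half_plane_disk[OF sph(1) _ ne[OF that] assms(3)] ball[OF that] by blast
    have eq: "?g 1 = ?g 0"
    proof (rule exp_eq_const[where S = "{0..1}" and k = "a 1 - z0" and g = ?g and x = 1 and y = 0])
      show "continuous_on {0..1} ?g"
        using re nz
        by (intro continuous_intros continuous_on_compose2[OF diff_log_cont[OF L]] legs_cont(2)[OF ab])
          (force simp: complex_nonpos_Reals_iff)+
      fix t :: real assume t: "t \<in> {0..1}"
      have "a 1 - b t \<noteq> 0" using ne[OF t] by simp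
      then show "exp (?g t) = a 1 - z0"
        using diff_logD[OF L, of 1 t] t nz by (simp add: exp_diff)
    qed auto
    have "(a 1 - b 1) / (a 1 - z0) \<noteq> 0" "(a 1 - b 0) / (a 1 - z0) \<noteq> 0"
      using ne[of 1] ne[of 0] nz by auto
    then show ?thesis using arg_cong[OF eq, of Im] by (simp add: Arg_eq_Im_Ln)
  qed
  have two: "Im (L (0, 1)) - Im (L (1, 1)) = Arg ((b 1 - a 0) / (b 1 - z0)) - Arg ((b 1 - a 1) / (b 1 - z0))"
  proof -
    let ?g = "\<lambda>t. L (t, 1) - Ln ((b 1 - a t) / (b 1 - z0))"
    have ne: "a t \<noteq> b 1" if "t \<in> {0..1}" for t
      using legsD[OF ab, of t 1] that by force
    have re: "Re ((b 1 - a t) / (b 1 - z0)) > 0" if "t \<in> {0..1}" for t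
      using half_plane_disk[OF sph(2) _ ne[OF that] assms(3)] ball[OF that] by blast
    have eq: "?g 1 = ?g 0"
    proof (rule exp_eq_const[where S = "{0..1}" and k = "- (b 1 - z0)" and g = ?g and x = 1 and y = 0])
      show "continuous_on {0..1} ?g"
        using re nz
        by (intro continuous_intros continuous_on_compose2[OF diff_log_cont[OF L]] legs_cont(1)[OF ab])
          (force simp: complex_nonpos_Reals_iff)+
      fix t :: real assume t: "t \<in> {0..1}"
      have "b 1 - a t \<noteq> 0" using ne[OF t] by simp
      then show "exp (?g t) = - (b 1 - z0)"
        using diff_logD[OF L, of t 1] t nz by (simp add: exp_diff divide_simps) (simp add: algebra_simps)
    qed auto
    have "(b 1 - a 1) / (b 1 - z0) \<noteq> 0" "(b 1 - a 0) / (b 1 - z0) \<noteq> 0"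
      using ne[of 1] ne[of 0] nz by auto
    then show ?thesis using arg_cong[OF eq, of Im] by (simp add: Arg_eq_Im_Ln)
  qed
  define w where "w = (b 1 - z0) / (a 1 - z0)"
  have w1: "norm w = 1" using sph assms(3) by (simp add: w_def norm_divide)
  have pos: "Re (1 - w) > 0"
  proof -
    have "b 1 \<noteq> a 1" using legsD[OF ab, of 1 1] by force
    then have "Re ((a 1 - b 1) / (a 1 - z0)) > 0"
      using half_plane_disk[OF sph(1) _ _ assms(3), of "b 1"] sph by simp
    moreover have "(a 1 - b 1) / (a 1 - z0) = 1 - w" using nz by (simp add: w_def field_simps)
    ultimately show ?thesis by simp
  qed
  have e1: "(a 1 - b 1) / (a 1 - z0) = 1 - w" using nz by (simp add: w_def field_simps)
  have "(b 1 - a 1) / (b 1 - z0) = 1 - inverse w" using nz by (simp add: w_def field_simps)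
  also have "inverse w = cnj w"
    using w1 complex_norm_square[of w] by (intro inverse_unique) simp
  finally have e2: "(b 1 - a 1) / (b 1 - z0) = cnj (1 - w)" by simp
  have "1 - w \<notin> \<real>\<^sub>\<le>\<^sub>0" "1 - w \<noteq> 0" using pos by (auto simp: complex_nonpos_Reals_iff)
  then have "Arg (cnj (1 - w)) = - Arg (1 - w)"
    using cnj_Ln[of "1 - w", symmetric] by (simp add: Arg_eq_Im_Ln)
  then show ?thesis
    using one two legs_0[OF ab] unfolding turn_def e1 e2 w_def by simp
qed

text \<open>The sign of \<open>Im (cnj (q - p) * (r - p))\<close> tells whether the triangle \<open>p q r\<close> is
  positively oriented.\<close>

lemma triangle_Arg_sum:
  assumes n: "norm p = \<rho>" "norm q = \<rho>" "norm r = \<rho>" "\<rho> > 0" and ne: "p \<noteq> q" "q \<noteq> r" "r \<noteq> p"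
  shows "Arg (1 - q / p) + Arg (1 - r / q) + Arg (1 - p / r) = - sgn (Im (cnj (q - p) * (r - p))) * (pi / 2)
    \<and> Im (cnj (q - p) * (r - p)) \<noteq> 0"
proof -
  have nz: "p \<noteq> 0" "q \<noteq> 0" "r \<noteq> 0" using n by auto
  have pos: "Re (1 - x / y) > 0 \<and> 1 - x / y \<noteq> 0" if "norm x = \<rho>" "norm y = \<rho>" "x \<noteq> y" for x y
  proof -
    have y0: "y \<noteq> 0" using that n by auto
    have "Re ((y - x) / (y - 0)) > 0"
      using half_plane_disk[of y 0 \<rho> x] that n(4) by simp
    moreover have "(y - x) / (y - 0) = 1 - x / y" using y0 by (simp add: field_simps)
    ultimately show ?thesis by auto
  qed
  define A where "A = 1 - q / p"
  define B where "B = 1 - r / q"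
  define C where "C = 1 - p / r"
  have ABC: "Re A > 0" "Re B > 0" "Re C > 0" "A \<noteq> 0" "B \<noteq> 0" "C \<noteq> 0"
    using pos n ne by (auto simp: A_def B_def C_def)
  define S where "S = Arg A + Arg B + Arg C"
  have bound: "\<bar>Arg A\<bar> < pi / 2" "\<bar>Arg B\<bar> < pi / 2" "\<bar>Arg C\<bar> < pi / 2"
    using ABC(1-3) Arg_Re_pos by blast+
  have cnjx: "cnj x = of_real (\<rho>\<^sup>2) / x" if "norm x = \<rho>" "x \<noteq> 0" for x
    using that complex_norm_square[of x] by (simp add: field_simps)
  have prod: "A * B * C = (p - q) * (q - r) * (r - p) / (p * q * r)"
    using nz by (simp add: A_def B_def C_def field_simps)
  \<comment> \<open>On the circle the conjugate of \<open>x\<close> is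
    \<open>\<rho>\<^sup>2 / x\<close>. This turns the cross product of the sides into a rational
    expression and shows that the product \<open>A * B * C\<close> is purely imaginary.\<close>
  have im: "A * B * C = - 2 * \<i> * of_real (Im (cnj (q - p) * (r - p)) / \<rho>\<^sup>2)"
  proof -
    define z where "z = cnj (q - p) * (r - p)"
    have "2 * \<i> * of_real (Im z) = z - cnj z" by (simp add: complex_eq_iff)
    also have "\<dots> = (cnj q - cnj p) * (r - p) - (q - p) * (cnj r - cnj p)" by (simp add: z_def)
    also have "\<dots> = of_real (\<rho>\<^sup>2) * ((1 / q - 1 / p) * (r - p) - (q - p) * (1 / r - 1 / p))"
      using cnjx[OF n(1) nz(1)] cnjx[OF n(2) nz(2)] cnjx[OF n(3) nz(3)] by (simp add: algebra_simps)
    also have "(1 / q - 1 / p) * (r - p) - (q - p) * (1 / r - 1 / p) = - ((p - q) * (q - r) * (r - p) / (p * q * r))"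
      using nz by (simp add: field_simps)
    finally have "2 * \<i> * of_real (Im z) = - (of_real (\<rho>\<^sup>2) * (A * B * C))" using prod by simp
    then show ?thesis using n(4) by (simp add: z_def field_simps)
  qed
  have nz3: "A * B * C \<noteq> 0" using ABC by simp
  define k where "k = Im (cnj (q - p) * (r - p))"
  have imk: "A * B * C = - 2 * \<i> * of_real (k / \<rho>\<^sup>2)" unfolding k_def by (rule im)
  have k: "k \<noteq> 0" using nz3 unfolding imk by auto
  have expS: "A * B * C = of_real (norm (A * B * C)) * exp (\<i> * S)"
  proof -
    have "A * B * C = (of_real (norm A) * exp (\<i> * Arg A)) * (of_real (norm B) * exp (\<i> * Arg B)) * (of_real (norm C) * exp (\<i> * Arg C))"
      using Arg_eq[OF ABC(4)] Arg_eq[OF ABC(5)] Arg_eq[OF ABC(6)] by (metis)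
    then show ?thesis by (simp add: S_def exp_add norm_mult algebra_simps)
  qed
  have re0: "Re (A * B * C) = 0" and im0: "Im (A * B * C) = - 2 * k / \<rho>\<^sup>2"
    unfolding imk by simp_all
  have npos: "norm (A * B * C) > 0" using nz3 by simp
  have "Re (A * B * C) = norm (A * B * C) * cos S" "Im (A * B * C) = norm (A * B * C) * sin S"
    by (subst expS, simp add: Re_exp Im_exp)+
  then have cosS: "cos S = 0" and sinS: "norm (A * B * C) * sin S = - 2 * k / \<rho>\<^sup>2"
    using re0 im0 npos by auto
  \<comment> \<open>Each argument is less than pi/2 in absolute value, so of the zeros of the cosine
    only pi/2 and -pi/2 remain; the sine decides between them.\<close>
  have Sb: "\<bar>S\<bar> < 3 * (pi / 2)" using bound unfolding S_def by linarith
  from cosS obtain i :: int where i: "odd i" "S = of_int i * (pi / 2)" by (auto simp: cos_zero_iff_int)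
  have "\<bar>real_of_int i\<bar> * (pi / 2) < 3 * (pi / 2)" using Sb i(2) by (simp add: abs_mult)
  then have "\<bar>i\<bar> < 3" by simp
  then have "i = 1 \<or> i = -1" using i(1) by presburger
  moreover have "k < 0" if "i = 1"
  proof -
    have "S = pi / 2" using that i(2) by simp
    then have "sin S = 1" by (simp only: sin_pi_half)
    then have "0 < - 2 * k / \<rho>\<^sup>2" using sinS npos by simp
    then show ?thesis using n(4) by (simp add: field_simps zero_less_mult_iff)
  qed
  moreover have "k > 0" if "i = -1"
  proof -
    have "S = - (pi / 2)" using that i(2) by simp
    then have "sin S = -1" by (simp only: sin_minus sin_pi_half)
    then have "- 2 * k / \<rho>\<^sup>2 < 0" using sinS npos by simp
    then show ?thesis using n(4) by (simp add: field_simps zero_less_mult_iff)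
  qed
  ultimately have "S = - sgn k * (pi / 2)" using i(2) by auto
  then show ?thesis using k by (simp add: S_def A_def B_def C_def k_def)
qed

text \<open>The arguments in \<open>turn_disk\<close> that involve the common starting point cancel
  in the cyclic sum; only those of the triangle of end points remain.\<close>

theorem tri_disk:
  assumes l: "legs a b" "legs b c" "legs c a" and "\<rho> > 0"
    and ball: "\<And>t. t \<in> {0..1} \<Longrightarrow> norm (a t - z0) \<le> \<rho> \<and> norm (b t - z0) \<le> \<rho> \<and> norm (c t - z0) \<le> \<rho>"
    and sph: "norm (a 1 - z0) = \<rho>" "norm (b 1 - z0) = \<rho>" "norm (c 1 - z0) = \<rho>"
  shows "tri a b c (- sgn (Im (cnj (b 1 - a 1) * (c 1 - a 1)))) \<and> Im (cnj (b 1 - a 1) * (c 1 - a 1)) \<noteq> 0"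
proof -
  obtain L1 L2 L3 where L: "diff_log a b L1" "diff_log b c L2" "diff_log c a L3"
    using l diff_log_ex by metis
  have ne: "a 1 \<noteq> b 1" "b 1 \<noteq> c 1" "c 1 \<noteq> a 1"
    using legsD[OF l(1), of 1 1] legsD[OF l(2), of 1 1] legsD[OF l(3), of 1 1] by auto
  have "turn L1 + turn L2 + turn L3 = 2 * (Arg (1 - (b 1 - z0) / (a 1 - z0)) +
      Arg (1 - (c 1 - z0) / (b 1 - z0)) + Arg (1 - (a 1 - z0) / (c 1 - z0)))"
    using turn_disk[OF l(1) L(1) assms(4), of z0] turn_disk[OF l(2) L(2) assms(4), of z0]
      turn_disk[OF l(3) L(3) assms(4), of z0] ball sph by simp
  then show ?thesis
    unfolding tri_def using L triangle_Arg_sum[OF sph assms(4)] ne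
    by (intro conjI exI[of _ L1] exI[of _ L2] exI[of _ L3]) (auto simp: algebra_simps)
qed

section \<open>Stereographic projection\<close>

text \<open>A right-handed orthonormal basis. The pole \<open>N\<close> is kept free because it has
  to avoid the part of the sphere under study.\<close>

definition frame :: "real ^ 3 \<Rightarrow> real ^ 3 \<Rightarrow> real ^ 3 \<Rightarrow> bool" where
  "frame i j N \<longleftrightarrow> i \<bullet> i = 1 \<and> j \<bullet> j = 1 \<and> N \<bullet> N = 1 \<and> i \<bullet> j = 0 \<and> i \<bullet> N = 0 \<and> j \<bullet> N = 0 \<and>
     cross3 i j = N \<and> cross3 j N = i \<and> cross3 N i = j"

lemma frame_ex:
  assumes "N \<in> S2"
  obtains i j where "frame i j N"
proof -
  have N: "N \<bullet> N = 1" using assms by (simp add: dot_square_norm)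
  obtain y where y: "y \<noteq> 0" "orthogonal N y"
    using orthogonal_to_vector_exists[of N] by auto
  define i where "i = y /\<^sub>R norm y"
  define j where "j = cross3 N i"
  have i: "i \<bullet> i = 1" "i \<bullet> N = 0" "N \<bullet> i = 0"
    using y by (simp_all add: i_def orthogonal_def inner_commute dot_square_norm power2_eq_square)
  have ij: "cross3 i j = N" using Lagrange[of i N i] i by (simp add: j_def)
  have jN: "cross3 j N = i" using Lagrange[of N N i] i N cross_skew[of j N] by (simp add: j_def)
  have "(norm j)\<^sup>2 = 1" using norm_cross_dot[of N i] i N by (simp add: j_def norm_eq_sqrt_inner)
  then have "j \<bullet> j = 1" by (simp add: dot_square_norm)
  then have "frame i j N"
    unfolding frame_def using i ij jN N dot_cross_self[of N i] by (auto simp: j_def inner_commute)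
  then show thesis by (rule that)
qed

locale framed =
  fixes i j N :: "real ^ 3"
  assumes fr: "frame i j N"
begin

lemma fr_simps [simp]:
  "i \<bullet> i = 1" "j \<bullet> j = 1" "N \<bullet> N = 1" "i \<bullet> j = 0" "j \<bullet> i = 0" "i \<bullet> N = 0" "N \<bullet> i = 0" "j \<bullet> N = 0" "N \<bullet> j = 0"
  "cross3 i j = N" "cross3 j N = i" "cross3 N i = j" "cross3 j i = - N" "cross3 N j = - i" "cross3 i N = - j"
  using fr cross_skew[of j i] cross_skew[of N j] cross_skew[of i N] by (auto simp: frame_def inner_commute)

lemma expand: "x = (x \<bullet> i) *\<^sub>R i + (x \<bullet> j) *\<^sub>R j + (x \<bullet> N) *\<^sub>R N"
proof -
  define z where "z = x - ((x \<bullet> i) *\<^sub>R i + (x \<bullet> j) *\<^sub>R j + (x \<bullet> N) *\<^sub>R N)"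
  have z: "z \<bullet> i = 0" "z \<bullet> j = 0" "z \<bullet> N = 0"
    by (simp_all add: z_def inner_diff_left inner_add_left)
  have "cross3 z N = 0" using Lagrange[of z i j] z by simp
  then have "(norm z)\<^sup>2 = 0" using norm_cross_dot[of z N] z by (simp add: norm_eq_sqrt_inner)
  then show ?thesis by (simp add: z_def)
qed

lemma inner_expand: "x \<bullet> y = (x \<bullet> i) * (y \<bullet> i) + (x \<bullet> j) * (y \<bullet> j) + (x \<bullet> N) * (y \<bullet> N)"
proof -
  have "x \<bullet> y = x \<bullet> ((y \<bullet> i) *\<^sub>R i + (y \<bullet> j) *\<^sub>R j + (y \<bullet> N) *\<^sub>R N)"
    using expand[of y] by simp
  then show ?thesis by (simp add: inner_add_right algebra_simps)
qed

lemma triple_expand: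
  "x \<bullet> cross3 y z = (x \<bullet> i) * ((y \<bullet> j) * (z \<bullet> N) - (y \<bullet> N) * (z \<bullet> j)) +
    (x \<bullet> j) * ((y \<bullet> N) * (z \<bullet> i) - (y \<bullet> i) * (z \<bullet> N)) + (x \<bullet> N) * ((y \<bullet> i) * (z \<bullet> j) - (y \<bullet> j) * (z \<bullet> i))"
proof -
  have "cross3 y z = cross3 ((y \<bullet> i) *\<^sub>R i + (y \<bullet> j) *\<^sub>R j + (y \<bullet> N) *\<^sub>R N) ((z \<bullet> i) *\<^sub>R i + (z \<bullet> j) *\<^sub>R j + (z \<bullet> N) *\<^sub>R N)"
    using expand[of y] expand[of z] by simp
  also have "\<dots> = ((y \<bullet> j) * (z \<bullet> N) - (y \<bullet> N) * (z \<bullet> j)) *\<^sub>R i +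
    ((y \<bullet> N) * (z \<bullet> i) - (y \<bullet> i) * (z \<bullet> N)) *\<^sub>R j + ((y \<bullet> i) * (z \<bullet> j) - (y \<bullet> j) * (z \<bullet> i)) *\<^sub>R N"
    by (simp add: cross_add_left cross_add_right cross_mult_left cross_mult_right algebra_simps)
  finally have *: "cross3 y z = \<dots>" .
  show ?thesis unfolding * by (simp add: inner_add_right algebra_simps)
qed

definition stereo :: "real ^ 3 \<Rightarrow> complex" where
  "stereo x = Complex ((x \<bullet> i) / (1 - x \<bullet> N)) ((x \<bullet> j) / (1 - x \<bullet> N))"

definition unstereo :: "complex \<Rightarrow> real ^ 3" where
  "unstereo z = (2 * Re z / ((norm z)\<^sup>2 + 1)) *\<^sub>R i + (2 * Im z / ((norm z)\<^sup>2 + 1)) *\<^sub>R j +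
     (((norm z)\<^sup>2 - 1) / ((norm z)\<^sup>2 + 1)) *\<^sub>R N"

lemma N_S2: "N \<in> S2"
  by (simp add: norm_eq_1)

lemma less_1:
  assumes "x \<in> S2" "y \<in> S2" "x \<noteq> y"
  shows "x \<bullet> y < 1"
proof -
  have "0 < (norm (x - y))\<^sup>2" using assms by simp
  also have "(norm (x - y))\<^sup>2 = 2 - 2 * (x \<bullet> y)"
    using assms by (simp add: power2_norm_eq_inner inner_diff_left inner_diff_right inner_commute norm_eq_1)
  finally show ?thesis by simp
qed

lemma den_pos: "(norm (z::complex))\<^sup>2 + 1 > 0"
  by (simp add: add_nonneg_pos)

lemma unstereo_coords:
  "unstereo z \<bullet> i = 2 * Re z / ((norm z)\<^sup>2 + 1)" "unstereo z \<bullet> j = 2 * Im z / ((norm z)\<^sup>2 + 1)"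
  "unstereo z \<bullet> N = ((norm z)\<^sup>2 - 1) / ((norm z)\<^sup>2 + 1)"
  by (simp_all add: unstereo_def inner_add_left)

lemma unstereo_S2: "unstereo z \<in> S2 - {N}"
proof -
  let ?D = "(norm z)\<^sup>2 + 1"
  have D: "?D \<noteq> 0" using den_pos[of z] by simp
  have "unstereo z \<bullet> unstereo z = ((2 * Re z)\<^sup>2 + (2 * Im z)\<^sup>2 + ((norm z)\<^sup>2 - 1)\<^sup>2) / ?D\<^sup>2"
    by (subst inner_expand) (simp add: unstereo_coords power2_eq_square add_divide_distrib)
  also have "(2 * Re z)\<^sup>2 + (2 * Im z)\<^sup>2 + ((norm z)\<^sup>2 - 1)\<^sup>2 = ?D\<^sup>2"
    unfolding cmod_power2 by (simp add: power2_eq_square algebra_simps)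
  finally have "unstereo z \<bullet> unstereo z = 1" using D by simp
  moreover have "unstereo z \<noteq> N"
  proof
    assume "unstereo z = N"
    then have "((norm z)\<^sup>2 - 1) / ?D = 1" using unstereo_coords(3)[of z] by simp
    then show False using D by (simp add: field_simps)
  qed
  ultimately show ?thesis by (simp add: norm_eq_1)
qed

lemma stereo_unstereo [simp]: "stereo (unstereo z) = z"
proof -
  have D: "(norm z)\<^sup>2 + 1 \<noteq> 0" using den_pos[of z] by simp
  have "1 - unstereo z \<bullet> N = 2 / ((norm z)\<^sup>2 + 1)"
    using D by (simp add: unstereo_coords field_simps)
  then show ?thesis using D by (simp add: stereo_def unstereo_coords complex_eq_iff)
qed

lemma norm_stereo:
  assumes "x \<in> S2" "x \<noteq> N"
  shows "(norm (stereo x))\<^sup>2 + 1 = 2 / (1 - x \<bullet> N)"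
proof -
  have D: "1 - x \<bullet> N > 0" using less_1[OF assms(1) N_S2 assms(2)] by simp
  have "(x \<bullet> i)\<^sup>2 + (x \<bullet> j)\<^sup>2 + (x \<bullet> N)\<^sup>2 = 1"
    using inner_expand[of x x] assms(1) by (simp add: power2_eq_square norm_eq_1)
  then have "(x \<bullet> i)\<^sup>2 + (x \<bullet> j)\<^sup>2 = (1 - x \<bullet> N) * (1 + x \<bullet> N)"
    by (simp add: power2_eq_square algebra_simps)
  moreover have "(norm (stereo x))\<^sup>2 = ((x \<bullet> i)\<^sup>2 + (x \<bullet> j)\<^sup>2) / (1 - x \<bullet> N)\<^sup>2"
    by (simp add: stereo_def cmod_power2 power_divide add_divide_distrib)
  ultimately have "(norm (stereo x))\<^sup>2 = (1 + x \<bullet> N) / (1 - x \<bullet> N)"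
    using D by (simp add: power2_eq_square)
  then show ?thesis using D by (simp add: field_simps)
qed

lemma stereo_coords:
  assumes "x \<in> S2" "x \<noteq> N"
  shows "x \<bullet> i = 2 * Re (stereo x) / ((norm (stereo x))\<^sup>2 + 1)"
    "x \<bullet> j = 2 * Im (stereo x) / ((norm (stereo x))\<^sup>2 + 1)"
    "x \<bullet> N = ((norm (stereo x))\<^sup>2 - 1) / ((norm (stereo x))\<^sup>2 + 1)"
proof -
  have D: "1 - x \<bullet> N > 0" using less_1[OF assms(1) N_S2 assms(2)] by simp
  have n: "(norm (stereo x))\<^sup>2 = 2 / (1 - x \<bullet> N) - 1" using norm_stereo[OF assms] by simp
  show "x \<bullet> i = 2 * Re (stereo x) / ((norm (stereo x))\<^sup>2 + 1)"
    "x \<bullet> j = 2 * Im (stereo x) / ((norm (stereo x))\<^sup>2 + 1)"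
    unfolding n using D by (simp_all add: stereo_def)
  show "x \<bullet> N = ((norm (stereo x))\<^sup>2 - 1) / ((norm (stereo x))\<^sup>2 + 1)"
    unfolding n using D by (simp add: field_simps)
qed

lemma unstereo_stereo [simp]:
  assumes "x \<in> S2 - {N}"
  shows "unstereo (stereo x) = x"
  using assms expand[of x] stereo_coords[of x] by (simp add: unstereo_def)

lemma continuous_on_stereo: "continuous_on (S2 - {N}) stereo"
proof -
  have "1 - x \<bullet> N \<noteq> 0" if "x \<in> S2 - {N}" for x
    using less_1[of x N] that N_S2 by auto
  then show ?thesis unfolding stereo_def
    by (intro continuous_intros continuous_on_Complex) auto
qed

lemma continuous_on_unstereo: "continuous_on UNIV unstereo"
proof -
  have "(norm (z::complex))\<^sup>2 + 1 \<noteq> 0" for z using den_pos[of z] by simp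
  then show ?thesis unfolding unstereo_def by (intro continuous_intros) auto
qed

lemma inj_on_stereo: "inj_on stereo (S2 - {N})"
  using unstereo_stereo by (rule inj_on_inverseI)

text \<open>By \<open>u \<bullet> N < c\<close> the cap around \<open>u\<close> omits the pole, so
  its image is a bounded round disk.\<close>

lemma stereo_cap:
  assumes u: "u \<in> S2" and c: "u \<bullet> N < c" "c < 1"
  obtains z0 \<rho> where "\<rho> > 0"
    "\<And>x. x \<in> S2 - {N} \<Longrightarrow> c \<le> x \<bullet> u \<Longrightarrow> norm (stereo x - z0) \<le> \<rho>"
    "\<And>x. x \<in> S2 - {N} \<Longrightarrow> c = x \<bullet> u \<Longrightarrow> norm (stereo x - z0) = \<rho>"
proof -
  define k where "k = c - u \<bullet> N"
  have k: "k > 0" using c by (simp add: k_def)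
  \<comment> \<open>Centre and radius come from completing the square in the equation
    \<open>x \<bullet> u = c\<close>, written in the coordinate \<open>stereo x\<close>.\<close>
  define z0 where "z0 = Complex ((u \<bullet> i) / k) ((u \<bullet> j) / k)"
  have uu: "(u \<bullet> i)\<^sup>2 + (u \<bullet> j)\<^sup>2 + (u \<bullet> N)\<^sup>2 = 1"
    using inner_expand[of u u] u by (simp add: power2_eq_square norm_eq_1)
  have "u \<bullet> N \<ge> -1" using Cauchy_Schwarz_ineq2[of u N] u N_S2 by (simp add: abs_le_iff)
  then have c1: "c > -1" using c by simp
  have csq: "1 - c\<^sup>2 > 0"
  proof -
    have "0 < (1 - c) * (1 + c)" using c c1 by simp
    then show ?thesis by (simp add: power2_eq_square algebra_simps)
  qed
  define \<rho> where "\<rho> = sqrt (1 - c\<^sup>2) / k"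
  have \<rho>: "\<rho> > 0" "\<rho>\<^sup>2 = (1 - c\<^sup>2) / k\<^sup>2" using k csq by (simp_all add: \<rho>_def power_divide)
  have key: "(norm (stereo x - z0))\<^sup>2 = \<rho>\<^sup>2 + (c - x \<bullet> u) * ((norm (stereo x))\<^sup>2 + 1) / k" if x: "x \<in> S2 - {N}" for x
  proof -
    let ?z = "stereo x"
    define n where "n = (norm ?z)\<^sup>2"
    have D: "n + 1 > 0" using den_pos[of ?z] by (simp add: n_def)
    have xu: "(x \<bullet> u) * (n + 1) = 2 * Re ?z * (u \<bullet> i) + 2 * Im ?z * (u \<bullet> j) + (n - 1) * (u \<bullet> N)"
    proof -
      have "2 * Re ?z = (x \<bullet> i) * (n + 1)" "2 * Im ?z = (x \<bullet> j) * (n + 1)" "n - 1 = (x \<bullet> N) * (n + 1)"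
        using stereo_coords[of x] x D by (simp_all add: n_def[symmetric])
      then show ?thesis by (simp only:) (subst inner_expand, simp add: algebra_simps)
    qed
    have n2: "n = (Re ?z)\<^sup>2 + (Im ?z)\<^sup>2" by (simp add: n_def cmod_power2)
    have "(norm (?z - z0))\<^sup>2 = (Re ?z - (u \<bullet> i) / k)\<^sup>2 + (Im ?z - (u \<bullet> j) / k)\<^sup>2"
      by (simp add: cmod_power2 z0_def)
    also have "\<dots> = n - (2 * Re ?z * (u \<bullet> i) + 2 * Im ?z * (u \<bullet> j)) / k + ((u \<bullet> i)\<^sup>2 + (u \<bullet> j)\<^sup>2) / k\<^sup>2"
      using k by (simp add: n2 power2_eq_square field_simps)
    also have "2 * Re ?z * (u \<bullet> i) + 2 * Im ?z * (u \<bullet> j) = (x \<bullet> u) * (n + 1) - (n - 1) * (u \<bullet> N)"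
      using xu by simp
    also have "(u \<bullet> i)\<^sup>2 + (u \<bullet> j)\<^sup>2 = 1 - (c - k)\<^sup>2"
      using uu by (simp add: k_def)
    also have "u \<bullet> N = c - k" by (simp add: k_def)
    also have "n - ((x \<bullet> u) * (n + 1) - (n - 1) * (c - k)) / k + (1 - (c - k)\<^sup>2) / k\<^sup>2 =
        (1 - c\<^sup>2) / k\<^sup>2 + (c - x \<bullet> u) * (n + 1) / k"
      using k by (simp add: power2_eq_square field_simps)
    finally show ?thesis by (simp add: \<rho>(2) n_def)
  qed
  show thesis
  proof (rule that[OF \<rho>(1), of z0])
    fix x assume x: "x \<in> S2 - {N}" and "c \<le> x \<bullet> u"
    then have "(c - x \<bullet> u) * ((norm (stereo x))\<^sup>2 + 1) / k \<le> 0"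
      using k den_pos[of "stereo x"] by (simp add: divide_le_0_iff mult_le_0_iff)
    then have "(norm (stereo x - z0))\<^sup>2 \<le> \<rho>\<^sup>2" using key[OF x] by simp
    then show "norm (stereo x - z0) \<le> \<rho>" using \<rho>(1) by (simp add: power2_le_iff_abs_le)
  next
    fix x assume x: "x \<in> S2 - {N}" and "c = x \<bullet> u"
    then have "(norm (stereo x - z0))\<^sup>2 = \<rho>\<^sup>2" using key[OF x] by simp
    then show "norm (stereo x - z0) = \<rho>" using \<rho>(1) by (simp add: power2_eq_iff_nonneg)
  qed
qed

text \<open>With \<open>P = 1 - p \<bullet> N\<close> and likewise for \<open>Q\<close> and
  \<open>R\<close>, the first factor is twice the signed area of the projected triangle, and the
  right side is minus the triple product of \<open>p - N\<close>, \<open>q - p\<close> and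
  \<open>r - p\<close>.\<close>

lemma projected_det:
  fixes P Q R p1 p2 q1 q2 r1 r2 :: real
  assumes "P \<noteq> 0" "Q \<noteq> 0" "R \<noteq> 0"
  shows "((q1 / Q - p1 / P) * (r2 / R - p2 / P) - (q2 / Q - p2 / P) * (r1 / R - p1 / P)) * (P * Q * R) =
    - (p1 * ((q2 - p2) * (P - R) - (P - Q) * (r2 - p2)) + p2 * ((P - Q) * (r1 - p1) - (q1 - p1) * (P - R)) +
       (- P) * ((q1 - p1) * (r2 - p2) - (q2 - p2) * (r1 - p1)))"
proof -
  define a b c d e f where "a = q1 / Q" and "b = q2 / Q" and "c = r1 / R" and "d = r2 / R" and "e = p1 / P" and "f = p2 / P"
  have "q1 = a * Q" "q2 = b * Q" "r1 = c * R" "r2 = d * R" "p1 = e * P" "p2 = f * P"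
    using assms by (simp_all add: a_def b_def c_def d_def e_def f_def)
  then show ?thesis using assms by (simp add: algebra_simps)
qed

text \<open>Central projection from \<open>N\<close> reverses the orientation of small triangles on the sphere, as
  seen from outside.\<close>

lemma stereo_orientation:
  assumes p: "p \<in> S2 - {N}" and q: "q \<in> S2 - {N}" and r: "r \<in> S2 - {N}" and u: "u \<in> S2"
    and c: "p \<bullet> u = c" "q \<bullet> u = c" "r \<bullet> u = c" "u \<bullet> N < c"
  shows "sgn (Im (cnj (stereo q - stereo p) * (stereo r - stereo p))) = - sgn (u \<bullet> cross3 (q - p) (r - p))"
proof -
  define n where "n = cross3 (q - p) (r - p)"
  \<comment> \<open>The three points lie in a plane orthogonal to \<open>u\<close>, so the normal of
    their triangle is parallel to \<open>u\<close>.\<close>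
  have n: "n = (n \<bullet> u) *\<^sub>R u"
  proof -
    have "cross3 u n = 0"
      using Lagrange[of u "q - p" "r - p"] c by (simp add: n_def inner_diff_right inner_commute)
    then have "cross3 u (cross3 u n) = 0" by simp
    then show ?thesis using Lagrange[of u u n] u by (simp add: norm_eq_1 inner_commute)
  qed
  have pos: "1 - p \<bullet> N > 0" "1 - q \<bullet> N > 0" "1 - r \<bullet> N > 0"
    using less_1[of p N] less_1[of q N] less_1[of r N] p q r N_S2 by auto
  let ?P = "(1 - p \<bullet> N) * (1 - q \<bullet> N) * (1 - r \<bullet> N)"
  have "Im (cnj (stereo q - stereo p) * (stereo r - stereo p)) * ?P = - ((p - N) \<bullet> n)"
  proof -
    have "Im (cnj (stereo q - stereo p) * (stereo r - stereo p)) =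
        ((q \<bullet> i) / (1 - q \<bullet> N) - (p \<bullet> i) / (1 - p \<bullet> N)) * ((r \<bullet> j) / (1 - r \<bullet> N) - (p \<bullet> j) / (1 - p \<bullet> N)) -
        ((q \<bullet> j) / (1 - q \<bullet> N) - (p \<bullet> j) / (1 - p \<bullet> N)) * ((r \<bullet> i) / (1 - r \<bullet> N) - (p \<bullet> i) / (1 - p \<bullet> N))"
    proof -
      have "Im (cnj a * b) = Re a * Im b - Im a * Re b" for a b by simp
      then show ?thesis by (simp only: minus_complex.sel stereo_def complex.sel)
    qed
    moreover have "(p - N) \<bullet> n = (p \<bullet> i) * ((q \<bullet> j - p \<bullet> j) * (r \<bullet> N - p \<bullet> N) - (q \<bullet> N - p \<bullet> N) * (r \<bullet> j - p \<bullet> j)) +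
      (p \<bullet> j) * ((q \<bullet> N - p \<bullet> N) * (r \<bullet> i - p \<bullet> i) - (q \<bullet> i - p \<bullet> i) * (r \<bullet> N - p \<bullet> N)) +
      (p \<bullet> N - 1) * ((q \<bullet> i - p \<bullet> i) * (r \<bullet> j - p \<bullet> j) - (q \<bullet> j - p \<bullet> j) * (r \<bullet> i - p \<bullet> i))"
    proof -
      have "(p - N) \<bullet> i = p \<bullet> i" "(p - N) \<bullet> j = p \<bullet> j" "(p - N) \<bullet> N = p \<bullet> N - 1"
        by (simp_all add: inner_diff_left)
      then show ?thesis unfolding n_def by (subst triple_expand) (simp only: inner_diff_left)
    qed
    moreover have "(1 - p \<bullet> N) - (1 - r \<bullet> N) = r \<bullet> N - p \<bullet> N" "(1 - p \<bullet> N) - (1 - q \<bullet> N) = q \<bullet> N - p \<bullet> N"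
      "- (1 - p \<bullet> N) = p \<bullet> N - 1" by simp_all
    ultimately show ?thesis
      using projected_det[of "1 - p \<bullet> N" "1 - q \<bullet> N" "1 - r \<bullet> N" "q \<bullet> i" "p \<bullet> i" "r \<bullet> j" "p \<bullet> j" "q \<bullet> j" "r \<bullet> i"] pos
      by (metis less_irrefl)
  qed
  \<comment> \<open>The vector \<open>p - N\<close> has the positive component
    \<open>c - u \<bullet> N\<close> along \<open>u\<close>.\<close>
  also have "(p - N) \<bullet> n = (n \<bullet> u) * (c - u \<bullet> N)"
  proof -
    have "(p - N) \<bullet> n = (n \<bullet> u) * ((p - N) \<bullet> u)" by (subst n) simp
    also have "(p - N) \<bullet> u = c - u \<bullet> N" using c by (simp add: inner_diff_left inner_commute[of N u])
    finally show ?thesis .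
  qed
  finally have eq: "Im (cnj (stereo q - stereo p) * (stereo r - stereo p)) * ?P = - ((u \<bullet> n) * (c - u \<bullet> N))"
    by (simp add: inner_commute)
  have "sgn (Im (cnj (stereo q - stereo p) * (stereo r - stereo p))) =
      sgn (Im (cnj (stereo q - stereo p) * (stereo r - stereo p)) * ?P)"
    using pos by (simp add: sgn_mult)
  also have "\<dots> = - sgn (u \<bullet> n)" unfolding eq using c(4) by (simp add: sgn_mult sgn_minus)
  finally show ?thesis by (simp add: n_def)
qed

end

section \<open>The order of three arcs on the sphere\<close>

text \<open>The set of times at distance \<epsilon> is closed, so the infimum in
  \<open>exit_point\<close> is attained. An earlier time at larger distance would produce a smaller
  member by the intermediate value theorem.\<close>

lemma exit_time:
  fixes g :: "real \<Rightarrow> real ^ 3"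
  assumes g: "continuous_on {0..1} g" and "0 < \<epsilon>" and k: "0 < k" "k \<le> 1" "\<epsilon> < dist (g 0) (g k)"
  obtains T where "0 < T" "T \<le> k" "exit_point g \<epsilon> = g T" "dist (g 0) (g T) = \<epsilon>"
    "\<And>t. t \<in> {0..T} \<Longrightarrow> dist (g 0) (g t) \<le> \<epsilon>"
proof -
  define S where "S = {t \<in> {0..1}. dist (g 0) (g t) = \<epsilon>}"
  have S: "t \<in> S \<longleftrightarrow> 0 \<le> t \<and> t \<le> 1 \<and> dist (g 0) (g t) = \<epsilon>" for t by (auto simp: S_def)
  have cont: "continuous_on {0..1} (\<lambda>t. dist (g 0) (g t))"
    using g by (intro continuous_intros) auto
  have ivt: "\<exists>s\<in>S. s < t" if "0 \<le> t" "t \<le> 1" "\<epsilon> < dist (g 0) (g t)" for t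
  proof -
    have "\<exists>s\<ge>0. s \<le> t \<and> dist (g 0) (g s) = \<epsilon>"
      using that \<open>0 < \<epsilon>\<close> by (intro IVT' continuous_on_subset[OF cont]) auto
    then obtain s where s: "0 \<le> s" "s \<le> t" "dist (g 0) (g s) = \<epsilon>" by blast
    then have "s \<noteq> t" using that by auto
    then show ?thesis using s that by (intro bexI[of _ s]) (auto simp: S)
  qed
  have "closed S"
  proof -
    have "S = {0..1} \<inter> (\<lambda>t. dist (g 0) (g t)) -` {\<epsilon>}" by (auto simp: S_def)
    then show ?thesis using continuous_closed_preimage[OF cont, of "{\<epsilon>}"] by simp
  qed
  moreover obtain s where s: "s \<in> S" "s < k" using ivt[of k] k by auto
  moreover have bdd: "bdd_below S" by (auto simp: S_def bdd_below_def)
  ultimately have T: "Inf S \<in> S" using closed_contains_Inf by blast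
  have Tk: "Inf S \<le> k" using cInf_lower[OF s(1) bdd] s(2) by simp
  show thesis
  proof (rule that[of "Inf S"])
    show d: "dist (g 0) (g (Inf S)) = \<epsilon>" using T S by blast
    have "0 \<le> Inf S" using T S by blast
    moreover have "Inf S \<noteq> 0" using d \<open>0 < \<epsilon>\<close> by force
    ultimately show "0 < Inf S" by simp
    show "exit_point g \<epsilon> = g (Inf S)" by (simp add: exit_point_def S_def)
    fix t assume t: "t \<in> {0..Inf S}"
    show "dist (g 0) (g t) \<le> \<epsilon>"
    proof (rule ccontr)
      assume "\<not> dist (g 0) (g t) \<le> \<epsilon>"
      then obtain s where "s \<in> S" "s < t" using ivt[of t] t Tk k by auto
      then show False using cInf_lower[OF _ bdd, of s] t by simp
    qed
  qed (use Tk in auto)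
qed

lemma dist_S2:
  assumes "x \<in> S2" "u \<in> S2"
  shows "(dist u x)\<^sup>2 = 2 - 2 * (x \<bullet> u)"
  using assms by (simp add: dist_norm power2_norm_eq_inner inner_diff_left inner_diff_right inner_commute norm_eq_1)

definition orient :: "(real \<Rightarrow> real ^ 3) \<Rightarrow> (real \<Rightarrow> real ^ 3) \<Rightarrow> (real \<Rightarrow> real ^ 3) \<Rightarrow> real \<Rightarrow> real" where
  "orient a b c \<epsilon> = a 0 \<bullet> cross3 (exit_point b \<epsilon> - exit_point a \<epsilon>) (exit_point c \<epsilon> - exit_point a \<epsilon>)"

context framed
begin

lemma legs_stereo:
  assumes l: "legs a b" and r: "\<And>t. t \<in> {0..1} \<Longrightarrow> a t \<in> S2 - {N} \<and> b t \<in> S2 - {N}"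
  shows "legs (stereo \<circ> a) (stereo \<circ> b)"
  unfolding legs_def
proof (intro conjI ballI impI)
  show "continuous_on {0..1} (stereo \<circ> a)" "continuous_on {0..1} (stereo \<circ> b)"
    unfolding o_def
    by (rule continuous_on_compose2[OF continuous_on_stereo legs_cont(1)[OF l]]
        continuous_on_compose2[OF continuous_on_stereo legs_cont(2)[OF l]]; use r in blast)+
  show "(stereo \<circ> a) 0 = (stereo \<circ> b) 0" using legs_0[OF l] by simp
  fix s t :: real assume st: "s \<in> {0..1}" "t \<in> {0..1}" "(stereo \<circ> a) s = (stereo \<circ> b) t"
  then have "a s = b t" using r inj_onD[OF inj_on_stereo, of "a s" "b t"] by simp
  then show "s = 0" "t = 0" using legsD[OF l st(1,2)] by auto
qed

lemma legs_scale:
  assumes "legs a b" "0 < s" "s \<le> 1" "0 < t" "t \<le> 1"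
  shows "legs (\<lambda>x. a (s * x)) (\<lambda>x. b (t * x))"
proof -
  have m: "s * x \<in> {0..1}" "t * x \<in> {0..1}" if "x \<in> {0..1}" for x
    using assms that by (auto simp: mult_le_one)
  show ?thesis
    unfolding legs_def
  proof (intro conjI ballI impI)
    show "continuous_on {0..1} (\<lambda>x. a (s * x))" "continuous_on {0..1} (\<lambda>x. b (t * x))"
      by (rule continuous_on_compose2[OF legs_cont(1)[OF assms(1)]]
          continuous_on_compose2[OF legs_cont(2)[OF assms(1)]], intro continuous_intros, use m in blast)+
    show "a (s * 0) = b (t * 0)" using legs_0[OF assms(1)] by simp
    fix x y :: real assume "x \<in> {0..1}" "y \<in> {0..1}" "a (s * x) = b (t * y)"
    then have "s * x = 0 \<and> t * y = 0" using legsD[OF assms(1) m(1) m(2)] by blast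
    then show "x = 0" "y = 0" using assms by auto
  qed
qed

text \<open>The arcs are cut where they first leave the cap of radius \<epsilon>. Projected, the
  pieces lie in a round disk and end on its boundary, so \<open>tri_disk\<close> expresses the
  turning by the exit points, and by \<open>tri_reparam\<close> the cut has not changed it. Thus
  \<open>orient\<close> has the same sign for all small \<epsilon>, however the arcs oscillate. The
  minus sign of \<open>tri_disk\<close> and the reversal by the projection cancel.\<close>

theorem tri_orient:
  assumes cont: "continuous_on {0..1} a" "continuous_on {0..1} b" "continuous_on {0..1} c"
    and k: "0 < k" "k \<le> 1"
    and l: "legs (\<lambda>t. a (k * t)) (\<lambda>t. b (k * t))" "legs (\<lambda>t. b (k * t)) (\<lambda>t. c (k * t))"
      "legs (\<lambda>t. c (k * t)) (\<lambda>t. a (k * t))"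
    and S: "\<And>t. t \<in> {0..1} \<Longrightarrow> a (k * t) \<in> S2 - {N} \<and> b (k * t) \<in> S2 - {N} \<and> c (k * t) \<in> S2 - {N}"
  obtains n where "n = 1 \<or> n = -1"
    "tri (stereo \<circ> (\<lambda>t. a (k * t))) (stereo \<circ> (\<lambda>t. b (k * t))) (stereo \<circ> (\<lambda>t. c (k * t))) n"
    "\<forall>\<^sub>F \<epsilon> in at_right 0. sgn (orient a b c \<epsilon>) = n"
proof -
  define u where "u = a 0"
  have u0: "b 0 = u" "c 0 = u" using legs_0[OF l(1)] legs_0[OF l(3)] by (auto simp: u_def)
  have u: "u \<in> S2" "u \<noteq> N" using S[of 0] by (auto simp: u_def)
  have ls: "legs (stereo \<circ> (\<lambda>t. a (k * t))) (stereo \<circ> (\<lambda>t. b (k * t)))"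
    "legs (stereo \<circ> (\<lambda>t. b (k * t))) (stereo \<circ> (\<lambda>t. c (k * t)))"
    "legs (stereo \<circ> (\<lambda>t. c (k * t))) (stereo \<circ> (\<lambda>t. a (k * t)))"
    using legs_stereo[OF l(1)] legs_stereo[OF l(2)] legs_stereo[OF l(3)] S by blast+
  obtain n where n: "tri (stereo \<circ> (\<lambda>t. a (k * t))) (stereo \<circ> (\<lambda>t. b (k * t))) (stereo \<circ> (\<lambda>t. c (k * t))) n"
    using tri_ex[OF ls] by blast
  have "a k \<noteq> u" "b k \<noteq> u" "c k \<noteq> u"
    using legsD[OF l(1), of 1 0] legsD[OF l(1), of 0 1] legsD[OF l(2), of 0 1] u0 by (auto simp: u_def)
  then have pos: "0 < dist u (a k)" "0 < dist u (b k)" "0 < dist u (c k)" "0 < dist u N"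
    using u by auto
  \<comment> \<open>Below \<open>e\<close> all three arcs reach the boundary of the cap by the time
    \<open>k\<close>, and the cap does not contain \<open>N\<close>.\<close>
  define e where "e = min (min (dist u (a k)) (dist u (b k))) (min (dist u (c k)) (dist u N))"
  have e: "0 < e" using pos by (simp add: e_def)
  have main: "sgn (orient a b c \<epsilon>) = n \<and> n \<noteq> 0" if \<epsilon>: "0 < \<epsilon>" "\<epsilon> < e" for \<epsilon>
  proof -
    have lt: "\<epsilon> < dist (a 0) (a k)" "\<epsilon> < dist (b 0) (b k)" "\<epsilon> < dist (c 0) (c k)" "\<epsilon> < dist u N"
      using \<epsilon> u0 by (auto simp: e_def u_def)
    obtain A where A: "0 < A" "A \<le> k" "exit_point a \<epsilon> = a A" "dist (a 0) (a A) = \<epsilon>"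
      "\<And>t. t \<in> {0..A} \<Longrightarrow> dist (a 0) (a t) \<le> \<epsilon>"
      using exit_time[OF cont(1) \<epsilon>(1) k lt(1)] by blast
    obtain B where B: "0 < B" "B \<le> k" "exit_point b \<epsilon> = b B" "dist (b 0) (b B) = \<epsilon>"
      "\<And>t. t \<in> {0..B} \<Longrightarrow> dist (b 0) (b t) \<le> \<epsilon>"
      using exit_time[OF cont(2) \<epsilon>(1) k lt(2)] by blast
    obtain C where C: "0 < C" "C \<le> k" "exit_point c \<epsilon> = c C" "dist (c 0) (c C) = \<epsilon>"
      "\<And>t. t \<in> {0..C} \<Longrightarrow> dist (c 0) (c t) \<le> \<epsilon>"
      using exit_time[OF cont(3) \<epsilon>(1) k lt(3)] by blast
    \<comment> \<open>On the sphere, distance at most \<epsilon> from \<open>u\<close> means inner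
      product at least \<open>h\<close> with \<open>u\<close>, the form that
      \<open>stereo_cap\<close> requires.\<close>
    define h where "h = 1 - \<epsilon>\<^sup>2 / 2"
    have ip: "dist u x \<le> \<epsilon> \<longleftrightarrow> h \<le> x \<bullet> u" "dist u x = \<epsilon> \<longleftrightarrow> x \<bullet> u = h" if "x \<in> S2" for x
    proof -
      have "dist u x \<le> \<epsilon> \<longleftrightarrow> (dist u x)\<^sup>2 \<le> \<epsilon>\<^sup>2" using \<epsilon>(1) by (simp add: power_mono_iff)
      then show "dist u x \<le> \<epsilon> \<longleftrightarrow> h \<le> x \<bullet> u" unfolding dist_S2[OF that u(1)] h_def by auto
      have "dist u x = \<epsilon> \<longleftrightarrow> (dist u x)\<^sup>2 = \<epsilon>\<^sup>2" using \<epsilon>(1) by (simp add: power2_eq_iff_nonneg)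
      then show "dist u x = \<epsilon> \<longleftrightarrow> x \<bullet> u = h" unfolding dist_S2[OF that u(1)] h_def by auto
    qed
    have hN: "u \<bullet> N < h" "h < 1" using ip(1)[OF N_S2] lt(4) \<epsilon>(1) by (auto simp: inner_commute h_def)
    obtain \<rho> z0 where z0: "\<rho> > 0"
      "\<And>x. x \<in> S2 - {N} \<Longrightarrow> h \<le> x \<bullet> u \<Longrightarrow> norm (stereo x - z0) \<le> \<rho>"
      "\<And>x. x \<in> S2 - {N} \<Longrightarrow> h = x \<bullet> u \<Longrightarrow> norm (stereo x - z0) = \<rho>"
      by (rule stereo_cap[OF u(1) hN]) (rule that)
    have Sk: "a t \<in> S2 - {N}" "b t \<in> S2 - {N}" "c t \<in> S2 - {N}" if "t \<in> {0..k}" for t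
      using S[of "t / k"] that k by auto
    let ?a = "\<lambda>t. a (k * t)" and ?b = "\<lambda>t. b (k * t)" and ?c = "\<lambda>t. c (k * t)"
    let ?A = "stereo \<circ> ?a \<circ> (\<lambda>t. A / k * t)" and ?B = "stereo \<circ> ?b \<circ> (\<lambda>t. B / k * t)" and ?C = "stereo \<circ> ?c \<circ> (\<lambda>t. C / k * t)"
    have ev: "?A t = stereo (a (A * t))" "?B t = stereo (b (B * t))" "?C t = stereo (c (C * t))" for t
      using k by simp_all
    have q: "0 < A / k" "A / k \<le> 1" "0 < B / k" "B / k \<le> 1" "0 < C / k" "C / k \<le> 1"
      using A B C k by auto
    have tn: "tri ?A ?B ?C n"
    proof (rule tri_reparam[OF n])
      show "(stereo \<circ> ?a) 0 = (stereo \<circ> ?b) 0" "(stereo \<circ> ?b) 0 = (stereo \<circ> ?c) 0"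
        using u0 by (simp_all add: u_def)
      fix s :: real assume "s \<in> {0..1}"
      then show "A / k * s \<in> {0..1} \<and> B / k * s \<in> {0..1} \<and> C / k * s \<in> {0..1}"
        using q by (auto intro: mult_le_one simp del: times_divide_eq_left)
    qed (use q in \<open>auto intro!: continuous_intros simp del: times_divide_eq_left\<close>)
    have lAB: "legs ?A ?B" "legs ?B ?C" "legs ?C ?A"
      using legs_scale[OF ls(1) q(1-4)] legs_scale[OF ls(2) q(3-6)] legs_scale[OF ls(3) q(5,6,1,2)]
      by (simp_all add: o_def)
    have m: "A * t \<in> {0..A}" "B * t \<in> {0..B}" "C * t \<in> {0..C}" if "t \<in> {0..1}" for t
      using A(1) B(1) C(1) that by (auto simp: mult_left_le)
    have ball: "norm (?A t - z0) \<le> \<rho> \<and> norm (?B t - z0) \<le> \<rho> \<and> norm (?C t - z0) \<le> \<rho>" if "t \<in> {0..1}" for t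
    proof -
      have "A * t \<in> {0..k}" "B * t \<in> {0..k}" "C * t \<in> {0..k}" using m[OF that] A(2) B(2) C(2) by auto
      note SS = Sk(1)[OF this(1)] Sk(2)[OF this(2)] Sk(3)[OF this(3)]
      have "dist u (a (A * t)) \<le> \<epsilon>" "dist u (b (B * t)) \<le> \<epsilon>" "dist u (c (C * t)) \<le> \<epsilon>"
        using A(5)[OF m(1)[OF that]] B(5)[OF m(2)[OF that]] C(5)[OF m(3)[OF that]] u0 by (simp_all add: u_def)
      then show ?thesis unfolding ev using SS ip(1) by (auto intro!: z0(2))
    qed
    have Sx: "a A \<in> S2 - {N}" "b B \<in> S2 - {N}" "c C \<in> S2 - {N}" using Sk A B C by auto
    have hx: "a A \<bullet> u = h" "b B \<bullet> u = h" "c C \<bullet> u = h"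
      using A(4) B(4) C(4) Sx ip(2) u0 by (auto simp: u_def)
    have sph: "norm (?A 1 - z0) = \<rho>" "norm (?B 1 - z0) = \<rho>" "norm (?C 1 - z0) = \<rho>"
      unfolding ev using Sx hx by (auto intro!: z0(3))
    have td: "tri ?A ?B ?C (- sgn (Im (cnj (?B 1 - ?A 1) * (?C 1 - ?A 1)))) \<and> Im (cnj (?B 1 - ?A 1) * (?C 1 - ?A 1)) \<noteq> 0"
      by (rule tri_disk[OF lAB z0(1) ball sph])
    have so: "sgn (Im (cnj (?B 1 - ?A 1) * (?C 1 - ?A 1))) = - sgn (u \<bullet> cross3 (b B - a A) (c C - a A))"
      unfolding ev mult_1_right by (rule stereo_orientation[OF Sx u(1) hx hN(1)])
    have "orient a b c \<epsilon> = u \<bullet> cross3 (b B - a A) (c C - a A)"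
      by (simp add: orient_def A B C u_def)
    then have "- sgn (Im (cnj (?B 1 - ?A 1) * (?C 1 - ?A 1))) = sgn (orient a b c \<epsilon>)" using so by simp
    moreover have "n = - sgn (Im (cnj (?B 1 - ?A 1) * (?C 1 - ?A 1)))" using tri_unique[OF tn] td by blast
    ultimately show ?thesis using td by (metis neg_equal_0_iff_equal sgn_eq_0_iff)
  qed
  have "sgn (orient a b c (e / 2)) = n" "n \<noteq> 0" using main[of "e / 2"] e by auto
  then have "n = 1 \<or> n = -1" by (metis sgn_real_def)
  moreover have "\<forall>\<^sub>F \<epsilon> in at_right 0. sgn (orient a b c \<epsilon>) = n"
    unfolding eventually_at_right_field using e main by (intro exI[of _ e]) auto
  ultimately show thesis using that n by blast
qed

end

section \<open>Half-edges at a vertex\<close>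

lemma tri_cong:
  assumes "tri a b c n" "\<And>t. t \<in> {0..1} \<Longrightarrow> a t = a' t \<and> b t = b' t \<and> c t = c' t"
  shows "tri a' b' c' n"
proof -
  have *: "diff_log a' b' L" if "diff_log a b L" "\<And>t. t \<in> {0..1} \<Longrightarrow> a t = a' t \<and> b t = b' t" for a b a' b' L
  proof (rule diff_logI[OF diff_log_cont[OF that(1)]])
    fix s t :: real assume st: "(s, t) \<in> quad"
    then have "s \<in> {0..1}" "t \<in> {0..1}" by (auto simp: quad_def)
    then show "exp (L (s, t)) = a' s - b' t" using diff_logD[OF that(1) st] that(2) by simp
  qed
  from assms(1) obtain L1 L2 L3 where L: "diff_log a b L1" "diff_log b c L2" "diff_log c a L3"
    "turn L1 + turn L2 + turn L3 = n * pi"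
    unfolding tri_def by blast
  have "diff_log a' b' L1" "diff_log b' c' L2" "diff_log c' a' L3"
    by (rule *[OF L(1)] *[OF L(2)] *[OF L(3)]; simp add: assms(2))+
  then show ?thesis using L(4) unfolding tri_def by blast
qed

lemma
  assumes P: "plane_graph G P"
  shows pg_inj: "inj_on (vpos P) (verts G)"
    and pg_vert_S2: "v \<in> verts G \<Longrightarrow> vpos P v \<in> S2"
    and pg_simple: "e \<in> links G \<Longrightarrow> simple_path (curve P e)"
    and pg_S2: "e \<in> links G \<Longrightarrow> path_image (curve P e) \<subseteq> S2"
    and pg_ends: "e \<in> links G \<Longrightarrow> curve P e 0 = vpos P (ends G e False)"
      "e \<in> links G \<Longrightarrow> curve P e 1 = vpos P (ends G e True)"
    and pg_verts: "e \<in> links G \<Longrightarrow> path_image (curve P e) \<inter> vpos P ` verts G = vpos P ` range (ends G e)"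
    and pg_disj: "e \<in> links G \<Longrightarrow> f \<in> links G \<Longrightarrow> e \<noteq> f \<Longrightarrow>
      path_image (curve P e) \<inter> path_image (curve P f) \<subseteq> vpos P ` verts G"
proof -
  note c = P[unfolded plane_graph_def]
  note c2 = c[THEN conjunct2, THEN conjunct2]
  note 1 = c[THEN conjunct1] c[THEN conjunct2, THEN conjunct1]
    and 2 = c2[THEN conjunct1]
    and 3 = c2[THEN conjunct2, THEN conjunct1]
    and 4 = c2[THEN conjunct2, THEN conjunct2, THEN conjunct2]
  show "inj_on (vpos P) (verts G)" by (rule 1)
  show "v \<in> verts G \<Longrightarrow> vpos P v \<in> S2" using 1(2) by blast
  show "e \<in> links G \<Longrightarrow> simple_path (curve P e)" "e \<in> links G \<Longrightarrow> path_image (curve P e) \<subseteq> S2"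
    using 2 by simp_all
  show "e \<in> links G \<Longrightarrow> curve P e 0 = vpos P (ends G e False)" "e \<in> links G \<Longrightarrow> curve P e 1 = vpos P (ends G e True)"
    "e \<in> links G \<Longrightarrow> path_image (curve P e) \<inter> vpos P ` verts G = vpos P ` range (ends G e)"
    using 3 by (simp_all add: pathstart_def pathfinish_def)
  show "e \<in> links G \<Longrightarrow> f \<in> links G \<Longrightarrow> e \<noteq> f \<Longrightarrow>
      path_image (curve P e) \<inter> path_image (curve P f) \<subseteq> vpos P ` verts G"
    using 4 by simp
qed

lemma pg_interior:
  assumes P: "plane_graph G P" and e: "e \<in> links G" and t: "0 < t" "t < 1"
  shows "curve P e t \<notin> vpos P ` verts G"
proof
  assume "curve P e t \<in> vpos P ` verts G"
  moreover have "curve P e t \<in> path_image (curve P e)" using t by (auto simp: path_image_def)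
  ultimately have "curve P e t \<in> vpos P ` range (ends G e)" using pg_verts[OF P e] by blast
  then obtain b where "curve P e t = vpos P (ends G e b)" by blast
  then have "curve P e t = curve P e 0 \<or> curve P e t = curve P e 1"
    using pg_ends[OF P e] by (cases b) auto
  moreover have sp: "s = t' \<or> s = 0 \<and> t' = 1 \<or> s = 1 \<and> t' = 0"
    if "s \<in> {0..1}" "t' \<in> {0..1}" "curve P e s = curve P e t'" for s t'
    using pg_simple[OF P e] that unfolding simple_path_def loop_free_def by blast
  ultimately show False using sp[of t 0] sp[of t 1] t by auto
qed

lemma scale_unit:
  fixes \<kappa> t :: real
  assumes "0 \<le> \<kappa>" "\<kappa> \<le> 1" "t \<in> {0..1}"
  shows "0 \<le> \<kappa> * t" "\<kappa> * t \<le> \<kappa>" "\<kappa> * t \<in> {0..1}"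
proof -
  have "\<kappa> * t \<le> \<kappa> * 1" using assms by (intro mult_left_mono) auto
  moreover show "0 \<le> \<kappa> * t" using assms by simp
  ultimately show "\<kappa> * t \<le> \<kappa>" "\<kappa> * t \<in> {0..1}" using assms by auto
qed

lemma half_curve_image: "path_image (half_curve P h) = path_image (curve P (fst h))"
  by (simp add: half_curve_def)

context
  fixes G :: "('v, 'e) mgraph" and P :: "('v, 'e) drawing"
  assumes P: "plane_graph G P"
begin

lemma half_curve_simple:
  assumes "h \<in> half_edges_at G v"
  shows "simple_path (half_curve P h)" "continuous_on {0..1} (half_curve P h)"
    "t \<in> {0..1} \<Longrightarrow> half_curve P h t \<in> S2" "half_curve P h 0 = vpos P v"
proof -
  obtain e b where h: "h = (e, b)" "e \<in> links G" "ends G e b = v"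
    using assms by (auto simp: half_edges_at_def)
  show s: "simple_path (half_curve P h)"
    using pg_simple[OF P h(2)] by (simp add: half_curve_def simple_path_reversepath h(1))
  then show "continuous_on {0..1} (half_curve P h)" by (simp add: simple_path_def path_def)
  show "half_curve P h t \<in> S2" if "t \<in> {0..1}"
  proof -
    have "half_curve P h t \<in> path_image (half_curve P h)" using that by (auto simp: path_image_def)
    then show ?thesis using pg_S2[OF P h(2)] half_curve_image[of P h] h(1) by auto
  qed
  show "half_curve P h 0 = vpos P v"
    using pg_ends[OF P h(2)] h by (cases b) (auto simp: half_curve_def reversepath_def)
qed

text \<open>The two half-edges of a loop run along one curve from opposite ends. The bound 1/3 keeps
  them apart; any bound below 1/2 would do.\<close>

lemma half_curves_meet:
  assumes h: "h \<in> half_edges_at G v" "k \<in> half_edges_at G v" "h \<noteq> k"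
    and st: "0 \<le> s" "s \<le> 1/3" "0 \<le> t" "t \<le> 1/3" and eq: "half_curve P h s = half_curve P k t"
  shows "s = 0 \<and> t = 0"
proof -
  obtain e b where e: "h = (e, b)" "e \<in> links G" using h(1) by (auto simp: half_edges_at_def)
  obtain f c where f: "k = (f, c)" "f \<in> links G" using h(2) by (auto simp: half_edges_at_def)
  have inner: "half_curve P (g, d) x \<notin> vpos P ` verts G" if "g \<in> links G" "0 < x" "x \<le> 1/3" for g d x
    using pg_interior[OF P that(1), of x] pg_interior[OF P that(1), of "1 - x"] that
    by (cases d) (auto simp: half_curve_def reversepath_def)
  show ?thesis
  proof (cases "e = f")
    case False
    have "half_curve P h s \<in> path_image (curve P e)" "half_curve P k t \<in> path_image (curve P f)"
      using half_curve_image[of P h] half_curve_image[of P k] st e f by (auto simp: path_image_def)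
    then have "half_curve P h s \<in> vpos P ` verts G" "half_curve P k t \<in> vpos P ` verts G"
      using pg_disj[OF P e(2) f(2) False] eq by auto
    then show ?thesis using inner[OF e(2), of s b] inner[OF f(2), of t c] st e f by fastforce
  next
    case True
    have sp: "x = y \<or> x = 0 \<and> y = 1 \<or> x = 1 \<and> y = 0"
      if "x \<in> {0..1}" "y \<in> {0..1}" "curve P e x = curve P e y" for x y
      using pg_simple[OF P e(2)] that unfolding simple_path_def loop_free_def by blast
    show ?thesis
    proof (cases b)
      case b: True
      then have "\<not> c" using h(3) e f True by auto
      then have "curve P e (1 - s) = curve P e t"
        using eq e f True b by (simp add: half_curve_def reversepath_def)
      then show ?thesis using sp[of "1 - s" t] st by auto
    next
      case b: False
      then have "c" using h(3) e f True by auto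
      then have "curve P e s = curve P e (1 - t)"
        using eq e f True b by (simp add: half_curve_def reversepath_def)
      then show ?thesis using sp[of s "1 - t"] st by auto
    qed
  qed
qed

lemma half_curves_legs:
  assumes h: "h \<in> half_edges_at G v" "k \<in> half_edges_at G v" "h \<noteq> k" and \<kappa>: "0 < \<kappa>" "\<kappa> \<le> 1/3"
  shows "legs (\<lambda>t. half_curve P h (\<kappa> * t)) (\<lambda>t. half_curve P k (\<kappa> * t))"
  unfolding legs_def
proof (intro conjI ballI impI)
  have m: "\<kappa> * t \<in> {0..1/3}" if "t \<in> {0..1}" for t
    unfolding atLeastAtMost_iff using scale_unit(1,2)[of \<kappa> t] that \<kappa> by linarith
  show "continuous_on {0..1} (\<lambda>t. half_curve P h (\<kappa> * t))" "continuous_on {0..1} (\<lambda>t. half_curve P k (\<kappa> * t))"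
    by (rule continuous_on_compose2[OF half_curve_simple(2)[OF h(1)]]
        continuous_on_compose2[OF half_curve_simple(2)[OF h(2)]];
        use m in \<open>force intro!: continuous_intros\<close>)+
  show "half_curve P h (\<kappa> * 0) = half_curve P k (\<kappa> * 0)"
    using half_curve_simple(4)[OF h(1)] half_curve_simple(4)[OF h(2)] by simp
  fix s t :: real assume st: "s \<in> {0..1}" "t \<in> {0..1}" "half_curve P h (\<kappa> * s) = half_curve P k (\<kappa> * t)"
  have "\<kappa> * s = 0 \<and> \<kappa> * t = 0"
    by (rule half_curves_meet[OF h _ _ _ _ st(3)]) (use m[OF st(1)] m[OF st(2)] in auto)
  then show "s = 0" "t = 0" using \<kappa> by auto
qed

lemma half_curve_near:
  assumes h: "h \<in> half_edges_at G v" and U: "openin (top_of_set S2) U" "vpos P v \<in> U"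
  shows "\<exists>\<kappa>>0. \<forall>t. 0 \<le> t \<and> t \<le> \<kappa> \<and> t \<le> 1 \<longrightarrow> half_curve P h t \<in> U"
proof -
  from U(1) obtain e where e: "e > 0" "\<And>x. x \<in> S2 \<Longrightarrow> dist x (vpos P v) < e \<Longrightarrow> x \<in> U"
    using U(2) unfolding openin_euclidean_subtopology_iff by metis
  have "continuous_on {0..1} (half_curve P h)" by (rule half_curve_simple(2)[OF h])
  then obtain \<delta> where \<delta>: "\<delta> > 0" "\<And>t. t \<in> {0..1} \<Longrightarrow> dist t 0 < \<delta> \<Longrightarrow> dist (half_curve P h t) (half_curve P h 0) < e"
    using e(1) unfolding continuous_on_iff by (metis atLeastAtMost_iff order_refl zero_le_one)
  show ?thesis
  proof (intro exI[of _ "\<delta> / 2"] conjI allI impI)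
    fix t assume "0 \<le> t \<and> t \<le> \<delta> / 2 \<and> t \<le> 1"
    then show "half_curve P h t \<in> U"
      using \<delta> half_curve_simple(3,4)[OF h] by (intro e(2)) (auto simp: dist_real_def)
  qed (use \<delta> in auto)
qed

lemma vertex_tri:
  assumes fr: "framed i j N"
    and h: "h \<in> half_edges_at G v" "x \<in> half_edges_at G v" "y \<in> half_edges_at G v" "distinct [h, x, y]"
    and \<kappa>: "0 < \<kappa>" "\<kappa> \<le> 1/3"
    and U: "\<And>t k. 0 \<le> t \<Longrightarrow> t \<le> \<kappa> \<Longrightarrow> k \<in> {h, x, y} \<Longrightarrow> half_curve P k t \<noteq> N"
  obtains n where "n = 1 \<or> n = -1"
    "tri (framed.stereo i j N \<circ> (\<lambda>t. half_curve P h (\<kappa> * t))) (framed.stereo i j N \<circ> (\<lambda>t. half_curve P x (\<kappa> * t)))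
      (framed.stereo i j N \<circ> (\<lambda>t. half_curve P y (\<kappa> * t))) n"
    "ccw P h x y \<longleftrightarrow> n = 1" "ccw P h y x \<longleftrightarrow> n = -1"
proof -
  interpret framed i j N by (rule fr)
  have m: "0 \<le> \<kappa> * t \<and> \<kappa> * t \<le> \<kappa> \<and> \<kappa> * t \<in> {0..1}" if "t \<in> {0..1}" for t
    using that \<kappa> scale_unit[of \<kappa> t] by simp
  have S: "half_curve P h (\<kappa> * t) \<in> S2 - {N} \<and> half_curve P x (\<kappa> * t) \<in> S2 - {N} \<and> half_curve P y (\<kappa> * t) \<in> S2 - {N}"
    if "t \<in> {0..1}" for t
    using U m[OF that] half_curve_simple(3)[OF h(1)] half_curve_simple(3)[OF h(2)] half_curve_simple(3)[OF h(3)] by blast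
  obtain n where n: "n = 1 \<or> n = -1"
    "tri (stereo \<circ> (\<lambda>t. half_curve P h (\<kappa> * t))) (stereo \<circ> (\<lambda>t. half_curve P x (\<kappa> * t)))
      (stereo \<circ> (\<lambda>t. half_curve P y (\<kappa> * t))) n"
    "\<forall>\<^sub>F \<epsilon> in at_right 0. sgn (orient (half_curve P h) (half_curve P x) (half_curve P y) \<epsilon>) = n"
  proof (rule tri_orient[of "half_curve P h" "half_curve P x" "half_curve P y" \<kappa>])
    show "legs (\<lambda>t. half_curve P h (\<kappa> * t)) (\<lambda>t. half_curve P x (\<kappa> * t))"
      "legs (\<lambda>t. half_curve P x (\<kappa> * t)) (\<lambda>t. half_curve P y (\<kappa> * t))"
      "legs (\<lambda>t. half_curve P y (\<kappa> * t)) (\<lambda>t. half_curve P h (\<kappa> * t))"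
      using h \<kappa> by (auto intro!: half_curves_legs[where v = v])
  qed (use S \<kappa> half_curve_simple(2)[OF h(1)] half_curve_simple(2)[OF h(2)] half_curve_simple(2)[OF h(3)] in auto)
  have nontriv: "(at_right (0::real)) \<noteq> bot" by simp
  have 1: "ccw P h x y \<longleftrightarrow> (\<forall>\<^sub>F \<epsilon> in at_right 0. orient (half_curve P h) (half_curve P x) (half_curve P y) \<epsilon> > 0)"
    by (simp add: ccw_def orient_def Let_def)
  have sw: "orient a c b \<epsilon> = - orient a b c \<epsilon>" for a b c \<epsilon>
    using cross_skew[of "exit_point c \<epsilon> - exit_point a \<epsilon>" "exit_point b \<epsilon> - exit_point a \<epsilon>"]
    by (simp add: orient_def)
  have 2: "ccw P h y x \<longleftrightarrow> (\<forall>\<^sub>F \<epsilon> in at_right 0. orient (half_curve P h) (half_curve P x) (half_curve P y) \<epsilon> < 0)"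
    unfolding neg_0_less_iff_less[symmetric] sw[symmetric] by (simp add: ccw_def orient_def Let_def)
  have "ccw P h x y \<longleftrightarrow> n = 1"
  proof
    assume "ccw P h x y"
    with n(3) have "\<forall>\<^sub>F \<epsilon> in at_right (0::real). n = 1"
      unfolding 1 by eventually_elim simp
    then show "n = 1" using nontriv by simp
  next
    assume "n = 1"
    with n(3) show "ccw P h x y" unfolding 1 by (auto elim!: eventually_mono simp: sgn_1_pos)
  qed
  moreover have "ccw P h y x \<longleftrightarrow> n = -1"
  proof
    assume "ccw P h y x"
    with n(3) have "\<forall>\<^sub>F \<epsilon> in at_right (0::real). n = -1"
      unfolding 2 by eventually_elim simp
    then show "n = -1" using nontriv by simp
  next
    assume "n = -1"
    with n(3) show "ccw P h y x" unfolding 2 by (auto elim!: eventually_mono simp: sgn_1_neg)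
  qed
  ultimately show thesis using that n by blast
qed

text \<open>\<open>ccw\<close> speaks of all small radii, so it is not evident that either order
  holds; the value of \<open>n\<close> in \<open>vertex_tri\<close> decides. The antipode of the
  vertex serves as pole.\<close>

lemma ccw_exclusive:
  assumes h: "h \<in> half_edges_at G v" "x \<in> half_edges_at G v" "y \<in> half_edges_at G v" "distinct [h, x, y]"
    and v: "v \<in> verts G"
  shows "ccw P h x y \<longleftrightarrow> \<not> ccw P h y x"
proof -
  have S: "- vpos P v \<in> S2" using pg_vert_S2[OF P v] by simp
  obtain i j where "frame i j (- vpos P v)" using frame_ex[OF S] .
  then have fr: "framed i j (- vpos P v)" by (simp add: framed_def)
  have ne: "vpos P v \<noteq> - vpos P v"
  proof
    assume "vpos P v = - vpos P v"
    then have "vpos P v + vpos P v = 0" by (metis add.right_inverse)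
    then have "2 *\<^sub>R vpos P v = 0" by (simp only: scaleR_2)
    then have "vpos P v = 0" by simp
    then show False using pg_vert_S2[OF P v] by simp
  qed
  have op: "openin (top_of_set S2) (S2 - {- vpos P v})"
    by (simp add: openin_delete)
  have near: "\<exists>\<kappa>>0. \<forall>t. 0 \<le> t \<and> t \<le> \<kappa> \<and> t \<le> 1 \<longrightarrow> half_curve P k t \<in> S2 - {- vpos P v}" if "k \<in> half_edges_at G v" for k
    using half_curve_near[OF that op] pg_vert_S2[OF P v] ne by blast
  obtain k1 where k1: "k1 > 0" "\<And>t. 0 \<le> t \<and> t \<le> k1 \<and> t \<le> 1 \<Longrightarrow> half_curve P h t \<noteq> - vpos P v"
    using near[OF h(1)] by auto
  obtain k2 where k2: "k2 > 0" "\<And>t. 0 \<le> t \<and> t \<le> k2 \<and> t \<le> 1 \<Longrightarrow> half_curve P x t \<noteq> - vpos P v"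
    using near[OF h(2)] by auto
  obtain k3 where k3: "k3 > 0" "\<And>t. 0 \<le> t \<and> t \<le> k3 \<and> t \<le> 1 \<Longrightarrow> half_curve P y t \<noteq> - vpos P v"
    using near[OF h(3)] by auto
  note k = k1(1) k2(1) k3(1) k1(2) k2(2) k3(2)
  show ?thesis
  proof (rule vertex_tri[OF fr h, of "min (min k1 k2) (min k3 (1/3))"])
    fix n :: real assume "n = 1 \<or> n = -1" "ccw P h x y \<longleftrightarrow> n = 1" "ccw P h y x \<longleftrightarrow> n = -1"
    then show ?thesis by auto
  qed (use k in auto)
qed

end

text \<open>A substitute for the local degree that needs neither smoothness nor homology. That one
  \<open>d\<close> serves all triples of arcs in \<open>U\<close> is what makes reversal a matter of
  all vertices in \<open>U\<close> or none.\<close>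

definition has_degree :: "(real ^ 3 \<Rightarrow> real ^ 3) \<Rightarrow> (real ^ 3) set \<Rightarrow> (real ^ 3 \<Rightarrow> complex) \<Rightarrow> (real ^ 3 \<Rightarrow> complex) \<Rightarrow> real \<Rightarrow> bool" where
  "has_degree F U \<sigma> \<sigma>' d \<longleftrightarrow> (\<forall>a b c n. legs a b \<longrightarrow> legs b c \<longrightarrow> legs c a \<longrightarrow>
     (\<forall>t\<in>{0..1}. a t \<in> U \<and> b t \<in> U \<and> c t \<in> U) \<longrightarrow> tri (\<sigma> \<circ> a) (\<sigma> \<circ> b) (\<sigma> \<circ> c) n \<longrightarrow>
     tri (\<sigma>' \<circ> F \<circ> a) (\<sigma>' \<circ> F \<circ> b) (\<sigma>' \<circ> F \<circ> c) (d * n))"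

text \<open>Plane graphs are compared by point sets, so the image of a half-edge is known only up to
  reparametrization. Equality at 0 excludes the opposite direction.\<close>

lemma arc_reparam:
  fixes a b :: "real \<Rightarrow> real ^ 3"
  assumes "arc a" "arc b" "path_image a = path_image b" "a 0 = b 0"
  obtains f where "continuous_on {0..1} f" "\<And>t. t \<in> {0..1} \<Longrightarrow> f t \<in> {0..1} \<and> b t = a (f t)"
    "f 0 = 0" "\<And>t. t \<in> {0<..1} \<Longrightarrow> 0 < f t"
proof -
  obtain g where g: "homeomorphism {0..1} (path_image a) a g"
    using homeomorphism_arc[OF assms(1)] .
  have b: "continuous_on {0..1} b" "b ` {0..1} = path_image a" "inj_on b {0..1}"
    using assms(2,3) by (auto simp: arc_def path_def path_image_def)
  have c: "continuous_on {0..1} (\<lambda>t. g (b t))"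
    using b by (intro continuous_on_compose2[OF homeomorphism_cont2[OF g]]) auto
  have m: "g (b t) \<in> {0..1} \<and> b t = a (g (b t))" if "t \<in> {0..1}" for t
  proof -
    have "b t \<in> path_image a" using b(2) that by blast
    then show ?thesis using homeomorphism_apply2[OF g] homeomorphism_image2[OF g] by auto
  qed
  have 0: "g (b 0) = 0" using homeomorphism_apply1[OF g, of 0] assms(4) by simp
  have pos: "0 < g (b t)" if t: "t \<in> {0<..1}" for t
  proof -
    have "g (b t) \<noteq> 0"
    proof
      assume "g (b t) = 0"
      then have "b t = b 0" using m[of t] t assms(4) by auto
      then have "t = 0" using inj_onD[OF b(3)] t by auto
      then show False using t by simp
    qed
    then show ?thesis using m[of t] t by auto
  qed
  show thesis by (rule that[OF c m 0 pos])
qed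

text \<open>The three half-edges at \<open>v\<close> have total turning \<open>n\<close> in
  \<open>P\<close> and \<open>m\<close> in \<open>Q\<close>, both 1 or -1, with
  \<open>m = d * n\<close>. So a \<open>d\<close> different from 1 is -1, and the order is
  reversed.\<close>

theorem ccw_transport:
  fixes P Q :: "('v, 'e) drawing"
  assumes P: "plane_graph G P" and Q: "plane_graph G Q"
    and fr: "framed i j N" and fr': "framed i' j' N'"
    and deg: "has_degree F U (framed.stereo i j N) (framed.stereo i' j' N') d"
    and U: "openin (top_of_set S2) U" "U \<subseteq> S2 - {N}" "F ` U \<subseteq> S2 - {N'}" "vpos P v \<in> U"
    and h: "h \<in> half_edges_at G v" "x \<in> half_edges_at G v" "y \<in> half_edges_at G v" "distinct [h, x, y]"
    and arc: "\<And>k. k \<in> {h, x, y} \<Longrightarrow> arc (half_curve Q k) \<and> arc (F \<circ> half_curve P k) \<and>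
      path_image (half_curve Q k) = F ` path_image (half_curve P k) \<and> half_curve Q k 0 = F (half_curve P k 0)"
  shows "if d = 1 then ccw Q h x y = ccw P h x y else ccw Q h x y = ccw P h y x"
proof -
  have near: "\<exists>\<kappa>>0. \<forall>t. 0 \<le> t \<and> t \<le> \<kappa> \<and> t \<le> 1 \<longrightarrow> half_curve P k t \<in> U" if "k \<in> {h, x, y}" for k
    using half_curve_near[OF P _ U(1,4)] h that by blast
  obtain k1 where k1: "k1 > 0" "\<And>t. 0 \<le> t \<and> t \<le> k1 \<and> t \<le> 1 \<Longrightarrow> half_curve P h t \<in> U"
    using near[of h] by auto
  obtain k2 where k2: "k2 > 0" "\<And>t. 0 \<le> t \<and> t \<le> k2 \<and> t \<le> 1 \<Longrightarrow> half_curve P x t \<in> U"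
    using near[of x] by auto
  obtain k3 where k3: "k3 > 0" "\<And>t. 0 \<le> t \<and> t \<le> k3 \<and> t \<le> 1 \<Longrightarrow> half_curve P y t \<in> U"
    using near[of y] by auto
  note k = k1(1) k2(1) k3(1) k1(2) k2(2) k3(2)
  define \<kappa> where "\<kappa> = min (min k1 k2) (min k3 (1/3))"
  have \<kappa>: "0 < \<kappa>" "\<kappa> \<le> 1/3" using k by (auto simp: \<kappa>_def)
  have inU: "half_curve P l t \<in> U" if "0 \<le> t" "t \<le> \<kappa>" "l \<in> {h, x, y}" for l t
    using that k(4-6)[of t] by (auto simp: \<kappa>_def)
  have "\<exists>f. continuous_on {0..1} f \<and> (\<forall>t\<in>{0..1}. f t \<in> {0..1} \<and> half_curve Q l t = F (half_curve P l (f t))) \<and>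
      f 0 = 0 \<and> (\<forall>t\<in>{0<..1}. 0 < f t)" if l: "l \<in> {h, x, y}" for l
  proof -
    have "path_image (F \<circ> half_curve P l) = path_image (half_curve Q l)"
      using arc[OF l] by (simp add: path_image_compose)
    moreover have "(F \<circ> half_curve P l) 0 = half_curve Q l 0" using arc[OF l] by simp
    ultimately obtain f where "continuous_on {0..1} f"
      "\<And>t. t \<in> {0..1} \<Longrightarrow> f t \<in> {0..1} \<and> half_curve Q l t = (F \<circ> half_curve P l) (f t)"
      "f 0 = 0" "\<And>t. t \<in> {0<..1} \<Longrightarrow> 0 < f t"
      using arc_reparam[of "F \<circ> half_curve P l" "half_curve Q l"] arc[OF l] by metis
    then show ?thesis by (intro exI[of _ f]) auto
  qed
  then have "\<forall>l\<in>{h, x, y}. \<exists>f. continuous_on {0..1} f \<and> (\<forall>t\<in>{0..1}. f t \<in> {0..1} \<and>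
      half_curve Q l t = F (half_curve P l (f t))) \<and> f 0 = 0 \<and> (\<forall>t\<in>{0<..1}. 0 < f t)" by blast
  from bchoice[OF this] obtain f where f0: "\<forall>l\<in>{h, x, y}. continuous_on {0..1} (f l) \<and> (\<forall>t\<in>{0..1}. f l t \<in> {0..1} \<and>
      half_curve Q l t = F (half_curve P l (f l t))) \<and> f l 0 = 0 \<and> (\<forall>t\<in>{0<..1}. 0 < f l t)" by blast
  have f: "\<And>l. l \<in> {h, x, y} \<Longrightarrow> continuous_on {0..1} (f l)"
    "\<And>l t. l \<in> {h, x, y} \<Longrightarrow> t \<in> {0..1} \<Longrightarrow> f l t \<in> {0..1} \<and> half_curve Q l t = F (half_curve P l (f l t))"
    "\<And>l. l \<in> {h, x, y} \<Longrightarrow> f l 0 = 0" "\<And>l t. l \<in> {h, x, y} \<Longrightarrow> t \<in> {0<..1} \<Longrightarrow> 0 < f l t"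
    using f0 by blast+
  have "\<exists>\<delta>>0. \<forall>t. 0 \<le> t \<and> t \<le> \<delta> \<and> t \<le> 1 \<longrightarrow> f l t \<le> \<kappa>" if l: "l \<in> {h, x, y}" for l
  proof -
    obtain \<delta> where \<delta>: "\<delta> > 0" "\<And>t. t \<in> {0..1} \<Longrightarrow> dist t 0 < \<delta> \<Longrightarrow> dist (f l t) (f l 0) < \<kappa>"
      using f(1)[OF l] \<kappa>(1) unfolding continuous_on_iff by (metis atLeastAtMost_iff order_refl zero_le_one)
    show ?thesis
    proof (intro exI[of _ "\<delta> / 2"] conjI allI impI)
      fix t assume "0 \<le> t \<and> t \<le> \<delta> / 2 \<and> t \<le> 1"
      then have "dist (f l t) 0 < \<kappa>" using \<delta>(1) \<delta>(2)[of t] f(3)[OF l] by (simp add: dist_real_def)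
      then show "f l t \<le> \<kappa>" by (simp add: dist_real_def)
    qed (use \<delta> in auto)
  qed
  then have "\<forall>l\<in>{h, x, y}. \<exists>\<delta>>0. \<forall>t. 0 \<le> t \<and> t \<le> \<delta> \<and> t \<le> 1 \<longrightarrow> f l t \<le> \<kappa>" by blast
  from bchoice[OF this] obtain D where D0: "\<forall>l\<in>{h, x, y}. D l > 0 \<and> (\<forall>t. 0 \<le> t \<and> t \<le> D l \<and> t \<le> 1 \<longrightarrow> f l t \<le> \<kappa>)" by blast
  have D: "\<And>l. l \<in> {h, x, y} \<Longrightarrow> D l > 0"
    "\<And>l t. l \<in> {h, x, y} \<Longrightarrow> 0 \<le> t \<and> t \<le> D l \<and> t \<le> 1 \<Longrightarrow> f l t \<le> \<kappa>"
    using D0 by blast+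
  \<comment> \<open>Short enough for the initial pieces of the half-edges of \<open>Q\<close> to be
    images of parts of the pieces of \<open>P\<close> up to \<kappa>, which lie in
    \<open>U\<close>.\<close>
  define \<mu> where "\<mu> = min (min (D h) (D x)) (min (D y) (1/3))"
  have \<mu>: "0 < \<mu>" "\<mu> \<le> 1/3" "\<mu> \<le> D l" if "l \<in> {h, x, y}" for l
    using D(1) that by (auto simp: \<mu>_def)
  have \<mu>t: "0 \<le> \<mu> * t \<and> \<mu> * t \<le> \<mu> \<and> \<mu> * t \<in> {0..1}" if "t \<in> {0..1}" for t
    using that \<mu>(1,2)[of h] scale_unit[of \<mu> t] by simp
  have Qeq: "half_curve Q l t = F (half_curve P l (f l t))" "0 \<le> f l t" "f l t \<le> \<kappa>"
    if "l \<in> {h, x, y}" "0 \<le> t" "t \<le> \<mu>" for l t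
    using f(2)[OF that(1), of t] D(2)[OF that(1), of t] \<mu>[OF that(1)] that by auto
  have QN: "half_curve Q l t \<noteq> N'" if "0 \<le> t" "t \<le> \<mu>" "l \<in> {h, x, y}" for l t
    using Qeq[OF that(3,1,2)] inU[OF _ _ that(3)] U(3) by auto
  have PN: "half_curve P l t \<noteq> N" if "0 \<le> t" "t \<le> \<kappa>" "l \<in> {h, x, y}" for l t
    using inU[OF that] U(2) by auto
  let ?\<sigma> = "framed.stereo i j N" and ?\<sigma>' = "framed.stereo i' j' N'"
  let ?p = "\<lambda>l t. half_curve P l (\<kappa> * t)" and ?q = "\<lambda>l t. half_curve Q l (\<mu> * t)"
  obtain n where n: "n = 1 \<or> n = -1" "tri (?\<sigma> \<circ> ?p h) (?\<sigma> \<circ> ?p x) (?\<sigma> \<circ> ?p y) n"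
    "ccw P h x y \<longleftrightarrow> n = 1" "ccw P h y x \<longleftrightarrow> n = -1"
    using vertex_tri[OF P fr h \<kappa> PN] by blast
  obtain m where m: "m = 1 \<or> m = -1" "tri (?\<sigma>' \<circ> ?q h) (?\<sigma>' \<circ> ?q x) (?\<sigma>' \<circ> ?q y) m"
    "ccw Q h x y \<longleftrightarrow> m = 1" "ccw Q h y x \<longleftrightarrow> m = -1"
    using vertex_tri[OF Q fr' h \<mu>(1,2)[of h] QN] by blast
  have "tri (?\<sigma>' \<circ> F \<circ> ?p h) (?\<sigma>' \<circ> F \<circ> ?p x) (?\<sigma>' \<circ> F \<circ> ?p y) (d * n)"
  proof -
    have "legs (?p h) (?p x)" "legs (?p x) (?p y)" "legs (?p y) (?p h)"
      using h \<kappa> by (auto intro!: half_curves_legs[OF P, where v = v])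
    moreover have "\<forall>t\<in>{0..1}. ?p h t \<in> U \<and> ?p x t \<in> U \<and> ?p y t \<in> U"
      using inU \<kappa> scale_unit[of \<kappa>] by simp
    ultimately show ?thesis using deg n(2) unfolding has_degree_def by blast
  qed
  then have "tri (?\<sigma>' \<circ> F \<circ> ?p h \<circ> (\<lambda>t. f h (\<mu> * t) / \<kappa>)) (?\<sigma>' \<circ> F \<circ> ?p x \<circ> (\<lambda>t. f x (\<mu> * t) / \<kappa>))
      (?\<sigma>' \<circ> F \<circ> ?p y \<circ> (\<lambda>t. f y (\<mu> * t) / \<kappa>)) (d * n)"
  proof (rule tri_reparam)
    show "(?\<sigma>' \<circ> F \<circ> ?p h) 0 = (?\<sigma>' \<circ> F \<circ> ?p x) 0" "(?\<sigma>' \<circ> F \<circ> ?p x) 0 = (?\<sigma>' \<circ> F \<circ> ?p y) 0"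
      using half_curve_simple(4)[OF P h(1)] half_curve_simple(4)[OF P h(2)] half_curve_simple(4)[OF P h(3)] by simp_all
    have c: "continuous_on {0..1} (\<lambda>t. f l (\<mu> * t) / \<kappa>)" if "l \<in> {h, x, y}" for l
    proof -
      have "continuous_on {0..1} (\<lambda>t. f l (\<mu> * t))"
        by (rule continuous_on_compose2[OF f(1)[OF that]], intro continuous_intros, use \<mu>t in blast)
      then show ?thesis using \<kappa>(1) by (intro continuous_intros) simp_all
    qed
    show "continuous_on {0..1} (\<lambda>t. f h (\<mu> * t) / \<kappa>)" "continuous_on {0..1} (\<lambda>t. f x (\<mu> * t) / \<kappa>)"
      "continuous_on {0..1} (\<lambda>t. f y (\<mu> * t) / \<kappa>)" by (rule c, simp)+
    fix s :: real
    show "f h (\<mu> * s) / \<kappa> \<in> {0..1} \<and> f x (\<mu> * s) / \<kappa> \<in> {0..1} \<and> f y (\<mu> * s) / \<kappa> \<in> {0..1}" if s: "s \<in> {0..1}"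
      using Qeq(2,3)[of h "\<mu> * s"] Qeq(2,3)[of x "\<mu> * s"] Qeq(2,3)[of y "\<mu> * s"] \<mu>t[OF s] \<kappa> by auto
    show "0 < f h (\<mu> * s) / \<kappa> \<and> 0 < f x (\<mu> * s) / \<kappa> \<and> 0 < f y (\<mu> * s) / \<kappa>" if s: "s \<in> {0<..1}"
    proof -
      have "\<mu> * s \<in> {0<..1}" using \<mu>t[of s] \<mu>(1)[of h] s by auto
      then show ?thesis using f(4)[of h "\<mu> * s"] f(4)[of x "\<mu> * s"] f(4)[of y "\<mu> * s"] \<kappa> by auto
    qed
  qed (use f(3) in auto)
  then have "tri (?\<sigma>' \<circ> ?q h) (?\<sigma>' \<circ> ?q x) (?\<sigma>' \<circ> ?q y) (d * n)"
  proof (rule tri_cong)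
    fix t :: real assume t: "t \<in> {0..1}"
    have "(?\<sigma>' \<circ> F \<circ> ?p l \<circ> (\<lambda>t. f l (\<mu> * t) / \<kappa>)) t = (?\<sigma>' \<circ> ?q l) t" if "l \<in> {h, x, y}" for l
      using Qeq(1)[OF that, of "\<mu> * t"] \<mu>t[OF t] \<kappa> by simp
    then show "(?\<sigma>' \<circ> F \<circ> ?p h \<circ> (\<lambda>t. f h (\<mu> * t) / \<kappa>)) t = (?\<sigma>' \<circ> ?q h) t \<and>
      (?\<sigma>' \<circ> F \<circ> ?p x \<circ> (\<lambda>t. f x (\<mu> * t) / \<kappa>)) t = (?\<sigma>' \<circ> ?q x) t \<and>
      (?\<sigma>' \<circ> F \<circ> ?p y \<circ> (\<lambda>t. f y (\<mu> * t) / \<kappa>)) t = (?\<sigma>' \<circ> ?q y) t"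
      by blast
  qed
  then have "m = d * n" using m(2) tri_unique by blast
  then show ?thesis using n m by auto
qed

section \<open>Isotopies and flip moves\<close>

text \<open>Without the poles the spheres are planes, and \<open>F\<close> becomes a continuous
  injection of the plane, to which \<open>tri_map\<close> applies.\<close>

lemma has_degree_sphere:
  assumes fr: "framed i j N" "framed i' j' N'"
    and F: "continuous_on (S2 - {N}) F" "inj_on F (S2 - {N})" "F ` (S2 - {N}) \<subseteq> S2 - {N'}"
  shows "\<exists>d. has_degree F (S2 - {N}) (framed.stereo i j N) (framed.stereo i' j' N') d"
proof -
  interpret A: framed i j N by (rule fr)
  interpret B: framed i' j' N' by (rule fr)
  let ?f = "\<lambda>z. B.stereo (F (A.unstereo z))"
  have c1: "continuous_on UNIV (\<lambda>z. F (A.unstereo z))"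
    by (rule continuous_on_compose2[OF F(1) A.continuous_on_unstereo])
      (rule image_subsetI, rule A.unstereo_S2)
  have im: "F (A.unstereo z) \<in> S2 - {N'}" for z using F(3) A.unstereo_S2 by blast
  have c2: "continuous_on UNIV ?f"
    by (rule continuous_on_compose2[OF B.continuous_on_stereo c1]) (use im in blast)
  have inj: "inj ?f"
  proof (rule injI)
    fix z w assume "?f z = ?f w"
    then have "F (A.unstereo z) = F (A.unstereo w)" using inj_onD[OF B.inj_on_stereo _ im im] by blast
    then have "A.unstereo z = A.unstereo w" using inj_onD[OF F(2) _ A.unstereo_S2 A.unstereo_S2] by blast
    then have "A.stereo (A.unstereo z) = A.stereo (A.unstereo w)" by (rule arg_cong)
    then show "z = w" by simp
  qed
  obtain d where d: "\<And>a b c n. legs a b \<Longrightarrow> legs b c \<Longrightarrow> legs c a \<Longrightarrow> tri a b c n \<Longrightarrow> tri (?f \<circ> a) (?f \<circ> b) (?f \<circ> c) (d * n)"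
    by (rule tri_map[OF c2 inj]) (rule that)
  have "has_degree F (S2 - {N}) A.stereo B.stereo d"
    unfolding has_degree_def
  proof (intro allI impI)
    fix a b c n
    assume l: "legs a b" "legs b c" "legs c a" and m: "\<forall>t\<in>{0..1}. a t \<in> S2 - {N} \<and> b t \<in> S2 - {N} \<and> c t \<in> S2 - {N}"
      and t: "tri (A.stereo \<circ> a) (A.stereo \<circ> b) (A.stereo \<circ> c) n"
    have "legs (A.stereo \<circ> a) (A.stereo \<circ> b)" "legs (A.stereo \<circ> b) (A.stereo \<circ> c)" "legs (A.stereo \<circ> c) (A.stereo \<circ> a)"
      by (rule A.legs_stereo, rule l, use m in blast)+
    from d[OF this t] show "tri (B.stereo \<circ> F \<circ> a) (B.stereo \<circ> F \<circ> b) (B.stereo \<circ> F \<circ> c) (d * n)"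
      by (rule tri_cong) (use m in simp)
  qed
  then show ?thesis by blast
qed

lemma has_degree_id:
  assumes "\<And>x. x \<in> U \<Longrightarrow> F x = x"
  shows "has_degree F U \<sigma> \<sigma> 1"
  unfolding has_degree_def
proof (intro allI impI)
  fix a b c n
  assume m: "\<forall>t\<in>{0..1}. a t \<in> U \<and> b t \<in> U \<and> c t \<in> U" and t: "tri (\<sigma> \<circ> a) (\<sigma> \<circ> b) (\<sigma> \<circ> c) n"
  have "tri (\<sigma> \<circ> F \<circ> a) (\<sigma> \<circ> F \<circ> b) (\<sigma> \<circ> F \<circ> c) n"
    by (rule tri_cong[OF t]) (use m assms in simp)
  then show "tri (\<sigma> \<circ> F \<circ> a) (\<sigma> \<circ> F \<circ> b) (\<sigma> \<circ> F \<circ> c) (1 * n)" by simp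
qed

lemma has_degree_cong:
  assumes "has_degree F U \<sigma> \<sigma>' d" "\<And>x. x \<in> U \<Longrightarrow> F' x = F x"
  shows "has_degree F' U \<sigma> \<sigma>' d"
  unfolding has_degree_def
proof (intro allI impI)
  fix a b c n
  assume l: "legs a b" "legs b c" "legs c a" and m: "\<forall>t\<in>{0..1}. a t \<in> U \<and> b t \<in> U \<and> c t \<in> U"
    and t: "tri (\<sigma> \<circ> a) (\<sigma> \<circ> b) (\<sigma> \<circ> c) n"
  have "tri (\<sigma>' \<circ> F \<circ> a) (\<sigma>' \<circ> F \<circ> b) (\<sigma>' \<circ> F \<circ> c) (d * n)"
    using assms(1) l m t unfolding has_degree_def by blast
  then show "tri (\<sigma>' \<circ> F' \<circ> a) (\<sigma>' \<circ> F' \<circ> b) (\<sigma>' \<circ> F' \<circ> c) (d * n)"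
    by (rule tri_cong) (use m assms(2) in simp)
qed

lemma openin_restrict:
  assumes "openin (top_of_set S) U" "X \<subseteq> S"
  shows "openin (top_of_set X) (X \<inter> U)"
proof -
  obtain T where T: "open T" "U = S \<inter> T" using assms(1) unfolding openin_open by blast
  have "X \<inter> U = X \<inter> T" using T(2) assms(2) by blast
  then show ?thesis using T(1) by (simp add: openin_open_Int)
qed

lemma S2_point: "axis 1 1 \<in> S2"
  by (simp add: norm_axis_1)

lemma infinite_S2: "infinite S2"
proof
  assume fin: "finite S2"
  obtain i j where "frame i j (axis 1 1)" using frame_ex[OF S2_point] .
  then interpret framed i j "axis 1 1" by (simp add: framed_def)
  have "finite (range unstereo)" by (rule finite_subset[OF _ fin]) (use unstereo_S2 in blast)
  moreover have "inj unstereo" by (rule inj_on_inverseI[of _ stereo]) simp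
  ultimately have "finite (UNIV :: complex set)" by (simp add: finite_image_iff)
  then show False by (simp add: infinite_UNIV_char_0)
qed

section \<open>The interior of a Jordan disk as a copy of the plane\<close>

locale jordan =
  fixes C D :: "(real ^ 3) set" and k k'
  assumes D: "D \<subseteq> S2" and k: "homeomorphism (cball (0::complex) 1) D k k'" and C: "k ` sphere 0 1 = C"
begin

lemma closed_D: "closed D"
proof -
  have "D = k ` cball 0 1" using homeomorphism_image1[OF k] by simp
  then have "compact D" using homeomorphism_cont1[OF k] compact_continuous_image[of "cball 0 1" k] by simp
  then show "closed D" by (rule compact_imp_closed)
qed

lemma C_sub: "C \<subseteq> D"
proof -
  have "sphere (0::complex) 1 \<subseteq> cball 0 1" by auto
  then show ?thesis using homeomorphism_image1[OF k] C by blast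
qed

lemma k_inj: "inj_on k (cball 0 1)"
  by (rule inj_on_inverseI[of _ k']) (rule homeomorphism_apply1[OF k])

lemma interior_eq: "D - C = k ` ball 0 1"
proof -
  have "cball (0::complex) 1 - sphere 0 1 = ball 0 1" by auto
  moreover have "k ` (cball 0 1 - sphere 0 1) = k ` cball 0 1 - k ` sphere 0 1"
    by (rule inj_on_image_set_diff[OF k_inj]) auto
  ultimately show ?thesis using homeomorphism_image1[OF k] C by simp
qed

text \<open>A disk is contractible and the sphere is not.\<close>

lemma proper: "\<exists>N. N \<in> S2 \<and> N \<notin> D"
proof (rule ccontr)
  assume "\<not> (\<exists>N. N \<in> S2 \<and> N \<notin> D)"
  then have "D = S2" using D by blast
  then have "cball (0::complex) 1 homeomorphic S2" using k unfolding homeomorphic_def by blast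
  moreover have "contractible (cball (0::complex) 1)" by (simp add: convex_imp_contractible)
  ultimately have "contractible S2" by (metis homeomorphic_contractible)
  then show False by (simp add: contractible_sphere)
qed

end

text \<open>\<open>tri_map\<close> concerns maps of the whole plane, so \<kappa> identifies the
  plane with the open disk. As the pole lies outside \<open>D\<close>, one stereographic projection
  covers all of \<open>D\<close>.\<close>

locale jordan_chart = jordan C D k k' + framed i j N for C D k k' i j N +
  fixes \<kappa> \<kappa>' :: "complex \<Rightarrow> complex"
  assumes N: "N \<notin> D" and \<kappa>: "homeomorphism UNIV (ball 0 1) \<kappa> \<kappa>'"
begin

definition chart :: "complex \<Rightarrow> real ^ 3" where
  "chart z = k (\<kappa> z)"

definition unchart :: "real ^ 3 \<Rightarrow> complex" where
  "unchart x = \<kappa>' (k' x)"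

lemma \<kappa>_ball: "\<kappa> z \<in> ball 0 1"
  using homeomorphism_image1[OF \<kappa>] by blast

lemma chart_range: "range chart = D - C"
proof -
  have "range chart = k ` range \<kappa>" by (simp add: chart_def image_image)
  also have "range \<kappa> = ball 0 1" using homeomorphism_image1[OF \<kappa>] .
  finally show ?thesis by (simp only: interior_eq)
qed

lemma chart_in: "chart z \<in> D - C"
  using chart_range by blast

lemma chart_sub: "D - C \<subseteq> S2 - {N}"
  using D N by blast

lemma unchart_chart: "unchart (chart z) = z"
proof -
  have "\<kappa> z \<in> cball 0 1" using \<kappa>_ball[of z] by auto
  then have "k' (k (\<kappa> z)) = \<kappa> z" by (rule homeomorphism_apply1[OF k])
  then show ?thesis using homeomorphism_apply1[OF \<kappa>, of z] by (simp add: chart_def unchart_def)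
qed

lemma chart_unchart: "x \<in> D - C \<Longrightarrow> chart (unchart x) = x"
  using chart_range unchart_chart by (metis imageE)

lemma continuous_chart: "continuous_on UNIV chart"
  unfolding chart_def
  by (rule continuous_on_compose2[OF homeomorphism_cont1[OF k] homeomorphism_cont1[OF \<kappa>]])
    (use \<kappa>_ball ball_subset_cball in blast)

lemma continuous_unchart: "continuous_on (D - C) unchart"
  unfolding unchart_def
proof (rule continuous_on_compose2[OF homeomorphism_cont2[OF \<kappa>]])
  show "continuous_on (D - C) k'" by (rule continuous_on_subset[OF homeomorphism_cont2[OF k]]) blast
  show "k' ` (D - C) \<subseteq> ball 0 1"
  proof
    fix z assume "z \<in> k' ` (D - C)"
    then obtain w where w: "w \<in> ball 0 1" "z = k' (k w)" unfolding interior_eq by blast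
    then have "z = w" using homeomorphism_apply1[OF k, of w] by auto
    then show "z \<in> ball 0 1" using w by simp
  qed
qed

lemma continuous_g: "continuous_on UNIV (\<lambda>z. stereo (chart z))"
  by (rule continuous_on_compose2[OF continuous_on_stereo continuous_chart]) (use chart_in chart_sub in blast)

lemma inj_g: "inj (\<lambda>z. stereo (chart z))"
proof (rule injI)
  fix z w assume "stereo (chart z) = stereo (chart w)"
  then have "chart z = chart w" using inj_onD[OF inj_on_stereo] chart_in chart_sub by blast
  then show "z = w" using unchart_chart by metis
qed

text \<open>Seen through the projection, the interior is the image of the plane under a continuous
  injection, so invariance of domain applies.\<close>

lemma openin_interior: "openin (top_of_set S2) (D - C)"
proof -
  have op: "open (range (\<lambda>z. stereo (chart z)))"
    by (rule invariance_of_domain[OF continuous_g open_UNIV inj_g])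
  have "D - C = (S2 - {N}) \<inter> stereo -` range (\<lambda>z. stereo (chart z))"
  proof
    show "D - C \<subseteq> (S2 - {N}) \<inter> stereo -` range (\<lambda>z. stereo (chart z))"
    proof
      fix x assume x: "x \<in> D - C"
      then have "stereo x = stereo (chart (unchart x))" using chart_unchart by simp
      then show "x \<in> (S2 - {N}) \<inter> stereo -` range (\<lambda>z. stereo (chart z))" using x chart_sub by auto
    qed
    show "(S2 - {N}) \<inter> stereo -` range (\<lambda>z. stereo (chart z)) \<subseteq> D - C"
    proof
      fix x assume "x \<in> (S2 - {N}) \<inter> stereo -` range (\<lambda>z. stereo (chart z))"
      then obtain z where z: "x \<in> S2 - {N}" "stereo x = stereo (chart z)" by auto
      then have "x = chart z" using inj_onD[OF inj_on_stereo z(2) z(1)] chart_in chart_sub by blast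
      then show "x \<in> D - C" using chart_in by simp
    qed
  qed
  then have "openin (top_of_set (S2 - {N})) (D - C)"
    using continuous_openin_preimage_gen[OF continuous_on_stereo op] by simp
  moreover have "openin (top_of_set S2) (S2 - {N})" by (simp add: openin_delete)
  ultimately show ?thesis by (rule openin_trans)
qed

text \<open>In the chart, \<open>r\<close> is a continuous injection of the plane and multiplies
  turnings by \<open>d2\<close>. Passing from the chart to the projection multiplies them by
  \<open>d1\<close> both before and after \<open>r\<close>, so \<open>d2\<close> is also the factor
  in the projection.\<close>

lemma has_degree_disk:
  assumes r: "homeomorphism D D r r'" and rC: "r ` C = C"
  shows "\<exists>d. has_degree r (D - C) stereo stereo d" and "r ` (D - C) \<subseteq> D - C"
proof -
  have inj_r: "inj_on r D" by (rule inj_on_inverseI[of _ r']) (rule homeomorphism_apply1[OF r])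
  have "r ` (D - C) = r ` D - r ` C" by (rule inj_on_image_set_diff[OF inj_r]) (use C_sub in auto)
  then show rDC: "r ` (D - C) \<subseteq> D - C" using homeomorphism_image1[OF r] rC by simp
  let ?g = "\<lambda>z. stereo (chart z)" and ?f = "\<lambda>z. unchart (r (chart z))"
  have rc: "r (chart z) \<in> D - C" for z using rDC chart_in by blast
  have "continuous_on UNIV (\<lambda>z. r (chart z))"
    by (rule continuous_on_compose2[OF homeomorphism_cont1[OF r] continuous_chart]) (use chart_in in blast)
  then have cf: "continuous_on UNIV ?f"
    by (rule continuous_on_compose2[OF continuous_unchart]) (use rc in blast)
  have injf: "inj ?f"
  proof (rule injI)
    fix z w assume "?f z = ?f w"
    then have "r (chart z) = r (chart w)" using chart_unchart[OF rc] by metis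
    then have "chart z = chart w" using inj_onD[OF inj_r] chart_in by blast
    then show "z = w" using unchart_chart by metis
  qed
  obtain d1 where d1: "\<And>a b c n. legs a b \<Longrightarrow> legs b c \<Longrightarrow> legs c a \<Longrightarrow> tri a b c n \<Longrightarrow> tri (?g \<circ> a) (?g \<circ> b) (?g \<circ> c) (d1 * n)"
    by (rule tri_map[OF continuous_g inj_g]) (rule that)
  obtain d2 where d2: "\<And>a b c n. legs a b \<Longrightarrow> legs b c \<Longrightarrow> legs c a \<Longrightarrow> tri a b c n \<Longrightarrow> tri (?f \<circ> a) (?f \<circ> b) (?f \<circ> c) (d2 * n)"
    by (rule tri_map[OF cf injf]) (rule that)
  have lf: "legs (h \<circ> a) (h \<circ> b)"
    if "legs a b" "continuous_on X h" "inj_on h X" "\<And>t. t \<in> {0..1} \<Longrightarrow> a t \<in> X \<and> b t \<in> X"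
    for a b :: "real \<Rightarrow> 'x::topological_space" and h :: "'x \<Rightarrow> 'y::topological_space" and X
    unfolding legs_def
  proof (intro conjI ballI impI)
    show "continuous_on {0..1} (h \<circ> a)" "continuous_on {0..1} (h \<circ> b)"
      unfolding o_def by (rule continuous_on_compose2[OF that(2) legs_cont(1)[OF that(1)]]
          continuous_on_compose2[OF that(2) legs_cont(2)[OF that(1)]], use that(4) in blast)+
    show "(h \<circ> a) 0 = (h \<circ> b) 0" using legs_0[OF that(1)] by simp
    fix s t :: real assume st: "s \<in> {0..1}" "t \<in> {0..1}" "(h \<circ> a) s = (h \<circ> b) t"
    then have "a s = b t" using inj_onD[OF that(3), of "a s" "b t"] that(4) by simp
    then show "s = 0" "t = 0" using legsD[OF that(1) st(1,2)] by auto
  qed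
  have "has_degree r (D - C) stereo stereo d2"
    unfolding has_degree_def
  proof (intro allI impI)
    fix a b c n
    assume l: "legs a b" "legs b c" "legs c a" and m: "\<forall>t\<in>{0..1}. a t \<in> D - C \<and> b t \<in> D - C \<and> c t \<in> D - C"
      and t: "tri (stereo \<circ> a) (stereo \<circ> b) (stereo \<circ> c) n"
    have inju: "inj_on unchart (D - C)" by (rule inj_on_inverseI) (rule chart_unchart)
    have l': "legs (unchart \<circ> a) (unchart \<circ> b)" "legs (unchart \<circ> b) (unchart \<circ> c)" "legs (unchart \<circ> c) (unchart \<circ> a)"
      by (rule lf, rule l, rule continuous_unchart, rule inju, use m in blast)+
    have lff: "legs (?f \<circ> (unchart \<circ> a)) (?f \<circ> (unchart \<circ> b))" "legs (?f \<circ> (unchart \<circ> b)) (?f \<circ> (unchart \<circ> c))"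
      "legs (?f \<circ> (unchart \<circ> c)) (?f \<circ> (unchart \<circ> a))"
      by (rule lf, rule l', rule cf, rule injf, rule conjI; rule UNIV_I)+
    obtain n' where n': "tri (unchart \<circ> a) (unchart \<circ> b) (unchart \<circ> c) n'"
      using tri_ex[OF l'] by blast
    have "tri (stereo \<circ> a) (stereo \<circ> b) (stereo \<circ> c) (d1 * n')"
      by (rule tri_cong[OF d1[OF l' n']]) (use m chart_unchart in simp)
    then have n: "n = d1 * n'" using tri_unique[OF t] by blast
    have "tri (stereo \<circ> r \<circ> a) (stereo \<circ> r \<circ> b) (stereo \<circ> r \<circ> c) (d1 * (d2 * n'))"
    proof (rule tri_cong[OF d1[OF lff d2[OF l' n']]])
      fix t :: real assume t: "t \<in> {0..1}"
      have "(?g \<circ> (?f \<circ> (unchart \<circ> x))) t = (stereo \<circ> r \<circ> x) t" if "x t \<in> D - C" for x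
        using chart_unchart[OF that] chart_unchart[OF rc, of "unchart (x t)"] by simp
      then show "(?g \<circ> (?f \<circ> (unchart \<circ> a))) t = (stereo \<circ> r \<circ> a) t \<and>
        (?g \<circ> (?f \<circ> (unchart \<circ> b))) t = (stereo \<circ> r \<circ> b) t \<and> (?g \<circ> (?f \<circ> (unchart \<circ> c))) t = (stereo \<circ> r \<circ> c) t"
        using m t by blast
    qed
    then show "tri (stereo \<circ> r \<circ> a) (stereo \<circ> r \<circ> b) (stereo \<circ> r \<circ> c) (d2 * n)"
      by (simp add: n mult.left_commute)
  qed
  then show "\<exists>d. has_degree r (D - C) stereo stereo d" by blast
qed

end

lemma jordan_chart_ex:
  assumes "jordan_disk C D"
  obtains k k' i j N \<kappa> \<kappa>' where "jordan_chart C D k k' i j N \<kappa> \<kappa>'"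
proof -
  obtain k k' where "jordan C D k k'"
    using assms unfolding jordan_disk_def jordan_def by blast
  then interpret jordan C D k k' .
  obtain N where N: "N \<in> S2" "N \<notin> D" using proper by blast
  obtain i j where "frame i j N" using frame_ex[OF N(1)] .
  moreover obtain \<kappa> \<kappa>' where "homeomorphism (UNIV :: complex set) (ball (0::complex) 1) \<kappa> \<kappa>'"
  proof -
    have "ball (0::complex) 1 homeomorphic (UNIV :: complex set)" by (rule homeomorphic_ball_UNIV) simp
    then obtain f g where "homeomorphism (ball (0::complex) 1) (UNIV :: complex set) f g" unfolding homeomorphic_def by blast
    then have "homeomorphism (UNIV :: complex set) (ball 0 1) g f" by (rule homeomorphism_symD)
    then show thesis by (rule that)
  qed
  ultimately show thesis
    using that[of k k' i j N \<kappa> \<kappa>'] N jordan_axioms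
    unfolding jordan_chart_def jordan_chart_axioms_def framed_def by blast
qed


section \<open>Cyclic orders before and after a move\<close>

lemma half_curve_end:
  assumes P: "plane_graph G P" and e: "e \<in> links G"
  shows "half_curve P (e, b) 0 = vpos P (ends G e b)" "half_curve P (e, b) 1 = vpos P (ends G e (\<not> b))"
  using pg_ends[OF P e] by (cases b; simp add: half_curve_def reversepath_def)+

text \<open>Different ends make the half-edge an arc and determine its direction in
  \<open>Q\<close>: its starting point is the image of the one in \<open>P\<close>.\<close>

lemma moved_arcs:
  assumes G: "multigraph G" and P: "plane_graph G P" and Q: "plane_graph G Q" and mv: "moved_by G F P Q"
    and h: "h \<in> half_edges_at G v" "ends G (fst h) False \<noteq> ends G (fst h) True"
    and F: "continuous_on (path_image (curve P (fst h))) F" "inj_on F S2"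
  shows "arc (half_curve Q h) \<and> arc (F \<circ> half_curve P h) \<and>
      path_image (half_curve Q h) = F ` path_image (half_curve P h) \<and> half_curve Q h 0 = F (half_curve P h 0)"
proof -
  obtain e b where e: "h = (e, b)" "e \<in> links G" "ends G e b = v"
    using h(1) by (auto simp: half_edges_at_def)
  have V: "ends G e c \<in> verts G" for c using G e(2) by (simp add: multigraph_def)
  have ne: "ends G e b \<noteq> ends G e (\<not> b)" using h(2) e(1) by (cases b) auto
  have arc: "arc (half_curve R h)" if R: "plane_graph G R" for R
  proof -
    have "vpos R (ends G e b) \<noteq> vpos R (ends G e (\<not> b))"
      using ne inj_onD[OF pg_inj[OF R] _ V V] by blast
    then have "pathfinish (half_curve R h) \<noteq> pathstart (half_curve R h)"
      using half_curve_end[OF R e(2), of b] by (simp add: pathstart_def pathfinish_def e(1))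
    then show ?thesis using half_curve_simple(1)[OF R h(1)] by (simp add: simple_path_eq_arc)
  qed
  have im: "path_image (curve Q e) = F ` path_image (curve P e)" and vs: "vpos Q v = F (vpos P v)"
    using mv e V[of b] by (auto simp: moved_by_def)
  have pim: "path_image (half_curve P h) \<subseteq> S2" using pg_S2[OF P e(2)] e(1) by (simp add: half_curve_image)
  have "arc (F \<circ> half_curve P h)"
    unfolding arc_def
  proof
    have "continuous_on (path_image (half_curve P h)) F" using F(1) by (simp add: half_curve_image)
    then show "path (F \<circ> half_curve P h)"
      using half_curve_simple(2)[OF P h(1)] unfolding path_def path_image_def by (intro continuous_on_compose)
    show "inj_on (F \<circ> half_curve P h) {0..1}"
      by (rule comp_inj_on) (use arc[OF P] pim in \<open>auto simp: arc_def path_image_def intro: inj_on_subset[OF F(2)]\<close>)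
  qed
  then show ?thesis
    using arc[OF Q] im vs half_curve_simple(4)[OF P h(1)] half_curve_simple(4)[OF Q h(1)]
    by (simp add: half_curve_image e(1))
qed

text \<open>
  Vertices with a loop are left out: a loop is only determined as a point set, so that its two half-edges
  may be exchanged.
\<close>

definition flips_orders :: "('v, 'e) mgraph \<Rightarrow> ('v, 'e) drawing \<Rightarrow> ('v, 'e) drawing \<Rightarrow> 'v set \<Rightarrow> bool" where
  "flips_orders G P Q W \<longleftrightarrow> W \<subseteq> verts G \<and> card {a \<in> links G. crossing G W a} \<le> 2 \<and>
    (\<forall>v\<in>verts G. \<forall>h\<in>half_edges_at G v. \<forall>x\<in>half_edges_at G v. \<forall>y\<in>half_edges_at G v.
      distinct [h, x, y] \<longrightarrow> (\<forall>k\<in>{h, x, y}. ends G (fst k) False \<noteq> ends G (fst k) True) \<longrightarrow>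
      ccw Q h x y = (if v \<in> W then ccw P h y x else ccw P h x y))"

text \<open>Only the final homeomorphism enters. It has a single degree on the punctured sphere, so
  the orders are kept at all vertices or reversed at all, and no edge leaves the empty set or the
  set of all vertices.\<close>

lemma isotopic_flips_orders:
  assumes G: "multigraph G" and P: "plane_graph G P" and Q: "plane_graph G Q" and iso: "isotopic G P Q"
  shows "\<exists>W. flips_orders G P Q W"
proof -
  from iso obtain H :: "real \<Rightarrow> real ^ 3 \<Rightarrow> real ^ 3" where
    H: "\<forall>t\<in>{0..1}. \<exists>K. homeomorphism S2 S2 (H t) K" and mv: "moved_by G (H 1) P Q"
    unfolding isotopic_def by blast
  define F where "F = H 1"
  obtain K where K: "homeomorphism S2 S2 F K" using H unfolding F_def by (meson atLeastAtMost_iff order_refl zero_le_one)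
  have injF: "inj_on F S2" by (rule inj_on_inverseI[of _ K]) (rule homeomorphism_apply1[OF K])
  have contF: "continuous_on S2 F" by (rule homeomorphism_cont1[OF K])
  have FS: "F x \<in> S2" if "x \<in> S2" for x using homeomorphism_image1[OF K] that by blast
  have fV: "finite (verts G)" using G by (simp add: multigraph_def)
  \<comment> \<open>The pole has to avoid the vertices, which are finite in number.\<close>
  have "\<exists>N. N \<in> S2 \<and> N \<notin> vpos P ` verts G"
  proof (rule ccontr)
    assume "\<not> (\<exists>N. N \<in> S2 \<and> N \<notin> vpos P ` verts G)"
    then have "S2 \<subseteq> vpos P ` verts G" by blast
    then show False using fV finite_subset infinite_S2 by blast
  qed
  then obtain N where N: "N \<in> S2" "N \<notin> vpos P ` verts G" by blast
  obtain i j where "frame i j N" using frame_ex[OF N(1)] .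
  then have fr: "framed i j N" by (simp add: framed_def)
  obtain i' j' where "frame i' j' (F N)" using frame_ex[OF FS[OF N(1)]] .
  then have fr': "framed i' j' (F N)" by (simp add: framed_def)
  have FN: "F ` (S2 - {N}) \<subseteq> S2 - {F N}"
  proof
    fix y assume "y \<in> F ` (S2 - {N})"
    then obtain x where x: "x \<in> S2" "x \<noteq> N" "y = F x" by blast
    have "F x \<noteq> F N" using inj_onD[OF injF _ x(1) N(1)] x(2) by metis
    then show "y \<in> S2 - {F N}" using FS[OF x(1)] x(3) by simp
  qed
  obtain d where d: "has_degree F (S2 - {N}) (framed.stereo i j N) (framed.stereo i' j' (F N)) d"
    using has_degree_sphere[OF fr fr' continuous_on_subset[OF contF] inj_on_subset[OF injF] FN] by blast
  have key: "if d = 1 then ccw Q h x y = ccw P h x y else ccw Q h x y = ccw P h y x"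
    if v: "v \<in> verts G" and h: "h \<in> half_edges_at G v" "x \<in> half_edges_at G v" "y \<in> half_edges_at G v" "distinct [h, x, y]"
      and nl: "\<forall>k\<in>{h, x, y}. ends G (fst k) False \<noteq> ends G (fst k) True" for v h x y
  proof (rule ccw_transport[OF P Q fr fr' d _ subset_refl FN _ h])
    show "openin (top_of_set S2) (S2 - {N})" by (simp add: openin_delete)
    show "vpos P v \<in> S2 - {N}" using pg_vert_S2[OF P v] N(2) v by blast
    fix k assume k: "k \<in> {h, x, y}"
    then have "k \<in> half_edges_at G v" using h by blast
    moreover from this have "fst k \<in> links G" by (auto simp: half_edges_at_def)
    ultimately show "arc (half_curve Q k) \<and> arc (F \<circ> half_curve P k) \<and>
      path_image (half_curve Q k) = F ` path_image (half_curve P k) \<and> half_curve Q k 0 = F (half_curve P k 0)"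
      using nl k by (intro moved_arcs[OF G P Q mv[folded F_def] _ _ continuous_on_subset[OF contF pg_S2[OF P]] injF]) auto
  qed
  have endsV: "ends G a b \<in> verts G" if "a \<in> links G" for a b using G that by (simp add: multigraph_def)
  have none: "{a \<in> links G. crossing G W a} = {}" if "W = {} \<or> W = verts G" for W
    using that endsV by (auto simp: crossing_def)
  define W where "W = (if d = 1 then {} else verts G)"
  have "flips_orders G P Q W"
    unfolding flips_orders_def
  proof (intro conjI ballI impI)
    show "W \<subseteq> verts G" by (simp add: W_def)
    have "W = {} \<or> W = verts G" by (simp add: W_def)
    then show "card {a \<in> links G. crossing G W a} \<le> 2" by (simp only: none card.empty)
    fix v h x y assume "v \<in> verts G" "h \<in> half_edges_at G v" "x \<in> half_edges_at G v" "y \<in> half_edges_at G v"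
      "distinct [h, x, y]" "\<forall>k\<in>{h, x, y}. ends G (fst k) False \<noteq> ends G (fst k) True"
    from key[OF this] \<open>v \<in> verts G\<close> show "ccw Q h x y = (if v \<in> W then ccw P h y x else ccw P h x y)"
      by (simp add: W_def split: if_splits)
  qed
  then show ?thesis by blast
qed

text \<open>\<open>S\<close> stands for the edges that cross \<open>C\<close>. The orders outside
  \<open>D\<close> are kept, those in \<open>D\<close> are all kept or all reversed, and an edge
  that misses \<open>C\<close> cannot leave the set of vertices in \<open>D\<close>.\<close>

lemma reglue_flips_orders:
  assumes G: "multigraph G" and P: "plane_graph G P" and Q: "plane_graph G Q"
    and jd: "jordan_disk C D" and rg: "reglue G C D P Q"
    and S: "S \<subseteq> links G" "card S \<le> 2" "point_set G P \<inter> C \<subseteq> (\<Union>e\<in>S. curve P e ` {0<..<1})"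
  shows "\<exists>W. flips_orders G P Q W"
proof -
  obtain k k' i j N \<kappa> \<kappa>' where "jordan_chart C D k k' i j N \<kappa> \<kappa>'" using jordan_chart_ex[OF jd] .
  then interpret J: jordan_chart C D k k' i j N \<kappa> \<kappa>' .
  from rg obtain h r r' where h: "orientation_reversing_on C h" "\<forall>x\<in>C \<inter> point_set G P. h x = x"
    and r: "homeomorphism D D r r'" "\<forall>x\<in>C. r x = h x"
    and mv: "moved_by G (\<lambda>x. if x \<in> D then r x else x) P Q"
    unfolding reglue_def by blast
  define F where "F = (\<lambda>x. if x \<in> D then r x else x)"
  from h(1) obtain h' where h': "homeomorphism C C h h'" unfolding orientation_reversing_on_def by blast
  have rC: "r ` C = C" using r(2) homeomorphism_image1[OF h'] by simp
  have rD: "r x \<in> D" if "x \<in> D" for x using homeomorphism_image1[OF r(1)] that by blast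
  have injr: "inj_on r D" by (rule inj_on_inverseI[of _ r']) (rule homeomorphism_apply1[OF r(1)])
  have injF: "inj_on F S2"
  proof (rule inj_onI)
    fix x y assume "x \<in> S2" "y \<in> S2" and eq: "F x = F y"
    have "x \<in> D \<longleftrightarrow> y \<in> D"
      using eq rD[of x] rD[of y] by (auto simp: F_def split: if_splits)
    then show "x = y" using eq inj_onD[OF injr, of x y] by (auto simp: F_def split: if_splits)
  qed
  have img: "path_image (curve P e) \<subseteq> point_set G P" if "e \<in> links G" for e
    using that by (auto simp: point_set_def)
  have vimg: "vpos P v \<in> point_set G P" if "v \<in> verts G" for v
    using that by (auto simp: point_set_def)
  have opI: "openin (top_of_set S2) (D - C)" by (rule J.openin_interior)
  have clD: "closedin (top_of_set S2) D" by (rule closed_subset[OF J.D J.closed_D])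
  \<comment> \<open>The glued map may jump across \<open>C\<close>, but an edge meets
    \<open>C\<close> only in points fixed by \<open>h\<close>, so the map is continuous along each
    edge. This is checked on two closed parts of the edge that overlap in \<open>C\<close>.\<close>
  have contF: "continuous_on (path_image (curve P e)) F" if e: "e \<in> links G" for e
  proof -
    let ?X = "path_image (curve P e)"
    have X: "?X \<subseteq> S2" by (rule pg_S2[OF P e])
    have split: "?X = (?X \<inter> D) \<union> (?X - (D - C))" by blast
    have "closedin (top_of_set ?X) (?X \<inter> D)"
      using J.closed_D by (simp add: closedin_closed_Int)
    moreover have "closedin (top_of_set ?X) (?X - (D - C))"
    proof -
      have "openin (top_of_set ?X) (?X \<inter> (D - C))" by (rule openin_restrict[OF opI X])
      then have "closedin (top_of_set ?X) (?X - ?X \<inter> (D - C))" by (intro closedin_diff) auto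
      moreover have "?X - ?X \<inter> (D - C) = ?X - (D - C)" by blast
      ultimately show ?thesis by simp
    qed
    ultimately have "continuous_on ((?X \<inter> D) \<union> (?X - (D - C))) F"
      unfolding F_def
    proof (intro continuous_on_cases_local)
      show "continuous_on (?X \<inter> D) r" by (rule continuous_on_subset[OF homeomorphism_cont1[OF r(1)]]) blast
      fix x assume "x \<in> ?X \<inter> D \<and> x \<notin> D \<or> x \<in> ?X - (D - C) \<and> x \<in> D"
      then have "x \<in> C" "x \<in> point_set G P" using img[OF e] by blast+
      then show "r x = x" using r(2) h(2) by simp
    qed (use split in auto)
    then show ?thesis using split by simp
  qed
  have offC: "vpos P v \<notin> C" if v: "v \<in> verts G" for v
  proof
    assume "vpos P v \<in> C"
    then have "vpos P v \<in> (\<Union>e\<in>S. curve P e ` {0<..<1})" using S(3) vimg[OF v] by blast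
    then obtain e t where e: "e \<in> S" "0 < t" "t < 1" "vpos P v = curve P e t" by auto
    have "curve P e t \<notin> vpos P ` verts G" by (rule pg_interior[OF P _ e(2,3)]) (use S(1) e(1) in blast)
    then show False using imageI[OF v, of "vpos P"] unfolding e(4) by contradiction
  qed
  have meets: "a \<in> S" if a: "a \<in> links G" and x: "x \<in> path_image (curve P a)" "x \<in> C" for a x
  proof (rule ccontr)
    assume "a \<notin> S"
    have "x \<in> (\<Union>e\<in>S. curve P e ` {0<..<1})" using S(3) x img[OF a] by blast
    then obtain e t where e: "e \<in> S" "0 < t" "t < 1" "x = curve P e t" by auto
    have eL: "e \<in> links G" using e(1) S(1) by blast
    have "x \<in> path_image (curve P e)" using e(2-4) by (auto simp: path_image_def)
    moreover have "a \<noteq> e" using e(1) \<open>a \<notin> S\<close> by blast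
    ultimately have "x \<in> vpos P ` verts G" using pg_disj[OF P a eL] x(1) by blast
    then show False using pg_interior[OF P eL e(2,3)] unfolding e(4) by contradiction
  qed
  define V where "V = {v \<in> verts G. vpos P v \<in> D}"
  have endsV: "ends G a b \<in> verts G" if "a \<in> links G" for a b using G that by (simp add: multigraph_def)
  have cross: "a \<in> S" if a: "a \<in> links G" "crossing G V a" for a
  proof (rule ccontr)
    assume "a \<notin> S"
    let ?X = "path_image (curve P a)"
    have XC: "?X \<inter> C = {}" using meets[OF a(1)] \<open>a \<notin> S\<close> by blast
    have X: "?X \<subseteq> S2" by (rule pg_S2[OF P a(1)])
    have conn: "connected ?X" using pg_simple[OF P a(1)] by (simp add: simple_path_def connected_path_image)
    \<comment> \<open>The part of the edge in \<open>D\<close> is both open and closed in the edge,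
      so the edge lies entirely inside or outside.\<close>
    have "openin (top_of_set ?X) (?X \<inter> (D - C))" by (rule openin_restrict[OF opI X])
    moreover have "?X \<inter> (D - C) = ?X \<inter> D" using XC by blast
    moreover have "closedin (top_of_set ?X) (?X \<inter> D)"
      using J.closed_D by (simp add: closedin_closed_Int)
    ultimately have "?X \<inter> D = {} \<or> ?X \<inter> D = ?X" using conn unfolding connected_clopen by metis
    moreover have "vpos P (ends G a b) \<in> ?X" for b
    proof -
      have "curve P a 0 \<in> ?X" "curve P a 1 \<in> ?X" by (auto simp: path_image_def)
      then show ?thesis using pg_ends[OF P a(1)] by (cases b) auto
    qed
    ultimately have "vpos P (ends G a False) \<in> D \<longleftrightarrow> vpos P (ends G a True) \<in> D" by blast
    then show False using a endsV[OF a(1)] by (simp add: crossing_def V_def)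
  qed
  have arcs: "arc (half_curve Q l) \<and> arc (F \<circ> half_curve P l) \<and>
      path_image (half_curve Q l) = F ` path_image (half_curve P l) \<and> half_curve Q l 0 = F (half_curve P l 0)"
    if "l \<in> half_edges_at G v" "ends G (fst l) False \<noteq> ends G (fst l) True" for l v
  proof -
    have "fst l \<in> links G" using that by (auto simp: half_edges_at_def)
    then show ?thesis by (intro moved_arcs[OF G P Q mv[folded F_def] that contF injF])
  qed
  obtain d0 where d0: "has_degree r (D - C) J.stereo J.stereo d0"
    using J.has_degree_disk(1)[OF r(1) rC] by blast
  have d: "has_degree F (D - C) J.stereo J.stereo d0" by (rule has_degree_cong[OF d0]) (simp add: F_def)
  have FI: "F ` (D - C) \<subseteq> S2 - {N}"
  proof -
    have "F ` (D - C) = r ` (D - C)" by (rule image_cong) (simp_all add: F_def)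
    then show ?thesis using J.has_degree_disk(2)[OF r(1) rC] J.chart_sub by blast
  qed
  have fr: "framed i j N" by unfold_locales
  have key_in: "if d0 = 1 then ccw Q h x y = ccw P h x y else ccw Q h x y = ccw P h y x"
    if v: "v \<in> V" and h: "h \<in> half_edges_at G v" "x \<in> half_edges_at G v" "y \<in> half_edges_at G v" "distinct [h, x, y]"
      and nl: "\<forall>k\<in>{h, x, y}. ends G (fst k) False \<noteq> ends G (fst k) True" for v h x y
  proof (rule ccw_transport[OF P Q fr fr d opI J.chart_sub FI _ h])
    show "vpos P v \<in> D - C" using v offC by (auto simp: V_def)
    fix l assume "l \<in> {h, x, y}"
    then show "arc (half_curve Q l) \<and> arc (F \<circ> half_curve P l) \<and>
      path_image (half_curve Q l) = F ` path_image (half_curve P l) \<and> half_curve Q l 0 = F (half_curve P l 0)"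
      using h nl by (intro arcs[of l v]) auto
  qed
  have key_out: "ccw Q h x y = ccw P h x y"
    if v: "v \<in> verts G" "v \<notin> V" and h: "h \<in> half_edges_at G v" "x \<in> half_edges_at G v" "y \<in> half_edges_at G v" "distinct [h, x, y]"
      and nl: "\<forall>k\<in>{h, x, y}. ends G (fst k) False \<noteq> ends G (fst k) True" for v h x y
  proof -
    have "S2 - {vpos P v} \<noteq> {}"
    proof
      assume "S2 - {vpos P v} = {}"
      then have "S2 \<subseteq> {vpos P v}" by blast
      then show False using finite_subset infinite_S2 by blast
    qed
    then obtain N' where N': "N' \<in> S2" "N' \<noteq> vpos P v" by blast
    obtain i' j' where "frame i' j' N'" using frame_ex[OF N'(1)] .
    then have fr': "framed i' j' N'" by (simp add: framed_def)
    \<comment> \<open>Off \<open>D\<close> the map is the identity and has degree 1; the pole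
      \<open>N'\<close> only has to differ from the vertex.\<close>
    let ?U = "S2 - D - {N'}"
    have FU: "F x = x" if "x \<in> ?U" for x using that by (simp add: F_def)
    have "if (1::real) = 1 then ccw Q h x y = ccw P h x y else ccw Q h x y = ccw P h y x"
    proof (rule ccw_transport[OF P Q fr' fr' has_degree_id[OF FU] _ _ _ _ h])
      have "openin (top_of_set S2) (S2 - D)" using clD by (simp add: openin_diff)
      then show "openin (top_of_set S2) ?U" by (rule openin_delete)
      show "?U \<subseteq> S2 - {N'}" by blast
      show "F ` ?U \<subseteq> S2 - {N'}" using FU by auto
      show "vpos P v \<in> ?U" using v N'(2) pg_vert_S2[OF P v(1)] by (simp add: V_def)
      fix l assume "l \<in> {h, x, y}"
      then show "arc (half_curve Q l) \<and> arc (F \<circ> half_curve P l) \<and>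
        path_image (half_curve Q l) = F ` path_image (half_curve P l) \<and> half_curve Q l 0 = F (half_curve P l 0)"
        using h nl by (intro arcs[of l v]) auto
    qed simp
    then show ?thesis by simp
  qed
  have finS: "finite S" using S(1) G finite_subset by (auto simp: multigraph_def)
  define W where "W = (if d0 = 1 then {} else V)"
  have "flips_orders G P Q W"
    unfolding flips_orders_def
  proof (intro conjI ballI impI)
    show "W \<subseteq> verts G" by (auto simp: W_def V_def)
    have "{a \<in> links G. crossing G W a} \<subseteq> S"
      using cross by (auto simp: W_def crossing_def split: if_splits)
    then show "card {a \<in> links G. crossing G W a} \<le> 2" using card_mono[OF finS] S(2) by (meson le_trans)
    fix v h x y assume v: "v \<in> verts G" and h: "h \<in> half_edges_at G v" "x \<in> half_edges_at G v" "y \<in> half_edges_at G v"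
      "distinct [h, x, y]" "\<forall>k\<in>{h, x, y}. ends G (fst k) False \<noteq> ends G (fst k) True"
    show "ccw Q h x y = (if v \<in> W then ccw P h y x else ccw P h x y)"
    proof (cases "v \<in> V")
      case True
      from key_in[OF this h] show ?thesis using True by (simp add: W_def split: if_splits)
    next
      case False
      from key_out[OF v this h] show ?thesis using False by (simp add: W_def)
    qed
  qed
  then show ?thesis by blast
qed

lemma crosses_once_interior:
  assumes "crosses_once G P C D e"
  shows "e \<in> links G" "path_image (curve P e) \<inter> C \<subseteq> curve P e ` {0<..<1}"
  using assms unfolding crosses_once_def by auto

theorem move_flips_orders:
  assumes G: "multigraph G" and mv: "move G P Q"
  shows "\<exists>W. flips_orders G P Q W"
proof -
  have P: "plane_graph G P" and Q: "plane_graph G Q" using mv by (simp_all add: move_def)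
  from mv consider "isotopic G P Q" | "flip0 G P Q" | "flip1 G P Q" | "flip2_connected G P Q"
    unfolding move_def by blast
  then show ?thesis
  proof cases
    case 1
    then show ?thesis by (rule isotopic_flips_orders[OF G P Q])
  next
    case 2
    then obtain C D where "jordan_disk C D" "point_set G P \<inter> C = {}" "reglue G C D P Q"
      unfolding flip0_def by blast
    then show ?thesis by (intro reglue_flips_orders[OF G P Q, of C D "{}"]) auto
  next
    case 3
    then obtain C D e where c: "jordan_disk C D" "crosses_once G P C D e"
      "point_set G P \<inter> C = path_image (curve P e) \<inter> C" "reglue G C D P Q"
      unfolding flip1_def by blast
    show ?thesis
    proof (rule reglue_flips_orders[OF G P Q c(1,4), of "{e}"])
      show "point_set G P \<inter> C \<subseteq> (\<Union>e\<in>{e}. curve P e ` {0<..<1})"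
        unfolding c(3) using crosses_once_interior(2)[OF c(2)] by blast
    qed (use crosses_once_interior(1)[OF c(2)] in simp_all)
  next
    case 4
    then obtain C D e f where c: "jordan_disk C D" "crosses_once G P C D e" "crosses_once G P C D f" "e \<noteq> f"
      "point_set G P \<inter> C = (path_image (curve P e) \<union> path_image (curve P f)) \<inter> C" "reglue G C D P Q"
      unfolding flip2_connected_def by (elim exE conjE) (rule that)
    show ?thesis
    proof (rule reglue_flips_orders[OF G P Q c(1,6), of "{e, f}"])
      show "{e, f} \<subseteq> links G"
        using crosses_once_interior(1)[OF c(2)] crosses_once_interior(1)[OF c(3)] by simp
      show "card {e, f} \<le> 2" using c(4) by simp
      have "path_image (curve P e) \<inter> C \<subseteq> curve P e ` {0<..<1}" "path_image (curve P f) \<inter> C \<subseteq> curve P f ` {0<..<1}"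
        by (rule crosses_once_interior(2)[OF c(2)], rule crosses_once_interior(2)[OF c(3)])
      then show "point_set G P \<inter> C \<subseteq> (\<Union>e\<in>{e, f}. curve P e ` {0<..<1})"
        by (simp only: c(5) Int_Un_distrib2 UN_insert UN_empty Un_empty_right Un_mono)
    qed
  qed
qed

section \<open>Invariance under moves\<close>

text \<open>By \<open>ccw_exclusive\<close> exactly one of the two orders of the other half-edges is
  counterclockwise.\<close>

lemma ccw_rot_ex:
  assumes G: "trivalent G" "perfect_matching G M" and P: "plane_graph G P" and e: "e \<in> M"
  shows "\<exists>x y. ccw_from G P (e, b) x y \<and> (\<forall>x' y'. ccw_from G P (e, b) x' y' \<longrightarrow> x' = x \<and> y' = y)"
proof -
  let ?v = "ends G e b" and ?h = "(e, b)"
  have eL: "e \<in> links G" using G(2) e by (auto simp: perfect_matching_def)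
  have v: "?v \<in> verts G" using G(1) eL by (simp add: trivalent_def multigraph_def)
  have hv: "?h \<in> half_edges_at G ?v" using eL by (simp add: half_edges_at_def)
  have c3: "card (half_edges_at G ?v) = 3" using G(1) v by (simp add: trivalent_def)
  have "card (half_edges_at G ?v - {?h}) = 2" using c3 hv by simp
  then obtain x y where xy: "half_edges_at G ?v - {?h} = {x, y}" "x \<noteq> y" unfolding card_2_iff by blast
  have HE: "half_edges_at G ?v = {?h, x, y}" using xy(1) hv by blast
  have dist: "distinct [?h, x, y]" using xy by auto
  have m: "x \<in> half_edges_at G ?v" "y \<in> half_edges_at G ?v" using HE by auto
  have excl: "ccw P ?h x y \<longleftrightarrow> \<not> ccw P ?h y x" by (rule ccw_exclusive[OF P hv m dist v])
  have main: ?thesis if s: "half_edges_at G ?v = {?h, x, y}" "distinct [?h, x, y]" "ccw P ?h x y" "\<not> ccw P ?h y x" for x y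
  proof (rule exI[of _ x], rule exI[of _ y], intro conjI allI impI)
    show "ccw_from G P ?h x y" using s(1-3) by (simp add: ccw_from_def)
    fix x' y' assume a: "ccw_from G P ?h x' y'"
    then have "{?h, x', y'} = {?h, x, y}" "distinct [?h, x', y']" "ccw P ?h x' y'"
      using s(1) by (auto simp: ccw_from_def)
    then have "{?h, x', y'} - {?h} = {?h, x, y} - {?h}" by simp
    moreover have "{?h, x', y'} - {?h} = {x', y'}" using \<open>distinct [?h, x', y']\<close> by auto
    moreover have "{?h, x, y} - {?h} = {x, y}" using s(2) by auto
    ultimately have "{x', y'} = {x, y}" by simp
    then consider "x' = x" "y' = y" | "x' = y" "y' = x" by (auto simp: doubleton_eq_iff)
    then have "x' = x \<and> y' = y"
      by cases (use \<open>ccw P ?h x' y'\<close> s(4) in simp_all)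
    then show "x' = x" "y' = y" by simp_all
  qed
  show ?thesis
  proof (cases "ccw P ?h x y")
    case True
    show ?thesis by (rule main[OF HE dist True]) (use excl True in simp)
  next
    case False
    have "half_edges_at G ?v = {?h, y, x}" using HE by blast
    moreover have "distinct [?h, y, x]" using dist by auto
    ultimately show ?thesis by (rule main) (use excl False in simp_all)
  qed
qed

text \<open>Circles are recorded as sets of edges, so it makes no difference at which of its two
  ends an edge is met by a smoothing arc.\<close>

lemma state_circles_arcs:
  fixes G :: "('v, 'e) mgraph"
  assumes ex: "\<And>e b. e \<in> M \<Longrightarrow> \<exists>x y. ccw_from G P (e, b) x y"
    and r: "\<And>e b x y. e \<in> M \<Longrightarrow> ccw_from G P (e, b) x y \<Longrightarrow> r (e, b) = (fst x, fst y)"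
  shows "state_circles G P M A = classes ((links G - M) \<union> circs G) (arcs M A r)"
proof -
  have "(\<exists>c d. smoothing_arc G P e (e \<in> A) (a, c) (b, d)) \<longleftrightarrow> (arc_at r (e \<in> A) e a b)"
    (is "?L \<longleftrightarrow> ?R") if e: "e \<in> M" for e a b
  proof
    assume ?L
    then obtain c d x1 x2 y1 y2 where *: "ccw_from G P (e, False) x1 x2" "ccw_from G P (e, True) y1 y2"
      "if e \<in> A then {(a, c), (b, d)} = {x1, y1} \<or> {(a, c), (b, d)} = {x2, y2}
         else {(a, c), (b, d)} = {x1, y2} \<or> {(a, c), (b, d)} = {x2, y1}"
      unfolding smoothing_arc_def by blast
    have im: "{a, b} = {fst z, fst w}" if "{(a, c), (b, d)} = {z, w}" for z w
      using arg_cong[OF that, of "(`) fst"] by simp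
    show ?R
    proof (cases "e \<in> A")
      case True
      then have "{(a, c), (b, d)} = {x1, y1} \<or> {(a, c), (b, d)} = {x2, y2}" using *(3) by (simp only: if_True)
      then have "{a, b} = {fst x1, fst y1} \<or> {a, b} = {fst x2, fst y2}"
        by (rule disj_forward) (rule im, assumption)+
      then show ?thesis using True by (simp only: r[OF e *(1)] r[OF e *(2)] fst_conv snd_conv if_True)
    next
      case False
      then have "{(a, c), (b, d)} = {x1, y2} \<or> {(a, c), (b, d)} = {x2, y1}" using *(3) by (simp only: if_False)
      then have "{a, b} = {fst x1, fst y2} \<or> {a, b} = {fst x2, fst y1}"
        by (rule disj_forward) (rule im, assumption)+
      then show ?thesis using False by (simp only: r[OF e *(1)] r[OF e *(2)] fst_conv snd_conv if_False)
    qed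
  next
    assume R: ?R
    obtain x1 x2 where x: "ccw_from G P (e, False) x1 x2" using ex[OF e] by blast
    obtain y1 y2 where y: "ccw_from G P (e, True) y1 y2" using ex[OF e] by blast
    have ex: "\<exists>c d. {(a, c), (b, d)} = {z, w}" if "{a, b} = {fst z, fst w}" for z w
    proof -
      from that consider "a = fst z" "b = fst w" | "a = fst w" "b = fst z" by (auto simp: doubleton_eq_iff)
      then show ?thesis
      proof cases
        case 1
        then have "{(a, snd z), (b, snd w)} = {z, w}" by simp
        then show ?thesis by iprover
      next
        case 2
        then have "{(a, snd w), (b, snd z)} = {z, w}" by (simp add: insert_commute)
        then show ?thesis by iprover
      qed
    qed
    have "\<exists>c d. if e \<in> A then {(a, c), (b, d)} = {x1, y1} \<or> {(a, c), (b, d)} = {x2, y2}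
         else {(a, c), (b, d)} = {x1, y2} \<or> {(a, c), (b, d)} = {x2, y1}"
    proof (cases "e \<in> A")
      case True
      then have "{a, b} = {fst x1, fst y1} \<or> {a, b} = {fst x2, fst y2}"
        using R by (simp only: r[OF e x] r[OF e y] fst_conv snd_conv if_True)
      then have "(\<exists>c d. {(a, c), (b, d)} = {x1, y1}) \<or> (\<exists>c d. {(a, c), (b, d)} = {x2, y2})"
        by (rule disj_forward) (rule ex, assumption)+
      then show ?thesis using True by (simp only: if_True) iprover
    next
      case False
      then have "{a, b} = {fst x1, fst y2} \<or> {a, b} = {fst x2, fst y1}"
        using R by (simp only: r[OF e x] r[OF e y] fst_conv snd_conv if_False)
      then have "(\<exists>c d. {(a, c), (b, d)} = {x1, y2}) \<or> (\<exists>c d. {(a, c), (b, d)} = {x2, y1})"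
        by (rule disj_forward) (rule ex, assumption)+
      then show ?thesis using False by (simp only: if_False) iprover
    qed
    then show ?L unfolding smoothing_arc_def using x y by iprover
  qed
  then have "(\<lambda>a b. \<exists>e\<in>M. \<exists>c d. smoothing_arc G P e (e \<in> A) (a, c) (b, d)) = arcs M A r"
    unfolding arcs_def by (intro ext bex_cong) auto
  then show ?thesis unfolding state_circles_def classes_def by simp
qed

theorem move_iso_complexes:
  assumes G: "trivalent G" "perfect_matching G M" and mv: "move G P Q"
  shows "iso_complexes G M P Q"
proof -
  have P: "plane_graph G P" and Q: "plane_graph G Q" using mv by (simp_all add: move_def)
  have mg: "multigraph G" using G(1) by (simp add: trivalent_def)
  obtain W where W: "flips_orders G P Q W" using move_flips_orders[OF mg mv] by blast
  define r where "r h = (THE z. \<exists>x y. ccw_from G P h x y \<and> z = (fst x, fst y))" for h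
  \<comment> \<open>The rotation expected for \<open>Q\<close>: that of \<open>P\<close> with the
    orders at \<open>W\<close> reversed.\<close>
  define r' where "r' h = (if ends G (fst h) (snd h) \<in> W then prod.swap (r h) else r h)" for h
  have r: "r (e, b) = (fst x, fst y)" if e: "e \<in> M" and c: "ccw_from G P (e, b) x y" for e b x y
    unfolding r_def
  proof (rule the_equality)
    show "\<exists>x' y'. ccw_from G P (e, b) x' y' \<and> (fst x, fst y) = (fst x', fst y')" using c by blast
    fix z assume "\<exists>x' y'. ccw_from G P (e, b) x' y' \<and> z = (fst x', fst y')"
    then obtain x' y' where z: "ccw_from G P (e, b) x' y'" "z = (fst x', fst y')" by blast
    obtain x0 y0 where u: "\<forall>x' y'. ccw_from G P (e, b) x' y' \<longrightarrow> x' = x0 \<and> y' = y0"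
      using ccw_rot_ex[OF G P e, of b] by (elim exE conjE) (rule that)
    have "x' = x \<and> y' = y" using u[rule_format, OF z(1)] u[rule_format, OF c] by simp
    then show "z = (fst x, fst y)" using z(2) by simp
  qed
  have exP: "\<exists>x y. ccw_from G P (e, b) x y" if "e \<in> M" for e b
    using ccw_rot_ex[OF G P that, of b] by iprover
  have exQ: "\<exists>x y. ccw_from G Q (e, b) x y" if "e \<in> M" for e b
    using ccw_rot_ex[OF G Q that, of b] by iprover
  have rot: "rotation G M r"
    unfolding rotation_def
  proof (intro ballI allI)
    fix e b assume e: "e \<in> M"
    obtain x y where xy: "ccw_from G P (e, b) x y" using exP[OF e, of b] by iprover
    then have "half_edges_at G (ends G e b) = {(e, b), x, y}" "distinct [(e, b), x, y]"
      by (simp_all add: ccw_from_def)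
    then show "\<exists>x y. half_edges_at G (ends G e b) = {(e, b), x, y} \<and> distinct [(e, b), x, y] \<and> r (e, b) = (fst x, fst y)"
      using r[OF e xy] by blast
  qed
  have r': "r' (e, b) = (fst x, fst y)" if e: "e \<in> M" and c: "ccw_from G Q (e, b) x y" for e b x y
  proof -
    let ?v = "ends G e b"
    have eL: "e \<in> links G" and nl: "ends G e False \<noteq> ends G e True"
      using G(2) e by (auto simp: perfect_matching_def)
    have v: "?v \<in> verts G" using mg eL by (simp add: multigraph_def)
    have HE: "half_edges_at G ?v = {(e, b), x, y}" and d: "distinct [(e, b), x, y]" and cQ: "ccw Q (e, b) x y"
      using c by (simp_all add: ccw_from_def)
    have mem: "(e, b) \<in> half_edges_at G ?v" "x \<in> half_edges_at G ?v" "y \<in> half_edges_at G ?v" using HE by auto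
    have HE': "half_edges_at G ?v = {(e, b), y, x}" using HE by (simp add: insert_commute)
    have d': "distinct [(e, b), y, x]" using d by auto
    have excl: "ccw P (e, b) x y \<longleftrightarrow> \<not> ccw P (e, b) y x" by (rule ccw_exclusive[OF P mem d v])
    have rx: "r (e, b) = (fst x, fst y)" if "ccw P (e, b) x y"
      using r[OF e, of b x y] HE d that by (simp add: ccw_from_def)
    have ry: "r (e, b) = (fst y, fst x)" if "ccw P (e, b) y x"
      using r[OF e, of b y x] HE' d' that by (simp add: ccw_from_def)
    show ?thesis
    \<comment> \<open>If both neighbours are halves of one loop, their order is invisible in
      \<open>r\<close>. Otherwise no half-edge at this vertex belongs to a loop, and
      \<open>flips_orders\<close> applies.\<close>
    proof (cases "fst x = fst y")
      case True
      then have "r (e, b) = (fst x, fst y)" using rx ry excl by metis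
      then show ?thesis using True by (simp add: r'_def)
    next
      case False
      have loopfree: "ends G (fst k) False \<noteq> ends G (fst k) True" if k: "k \<in> {(e, b), x, y}" for k
      proof
        assume l: "ends G (fst k) False = ends G (fst k) True"
        have kH: "k \<in> half_edges_at G ?v" using k HE by simp
        then have kv: "fst k \<in> links G" "ends G (fst k) (snd k) = ?v" by (auto simp: half_edges_at_def)
        have "ends G (fst k) (\<not> snd k) = ?v" using kv(2) l by (cases "snd k") auto
        then have k': "(fst k, \<not> snd k) \<in> {(e, b), x, y}" using kv(1) HE by (auto simp: half_edges_at_def)
        have "fst k \<noteq> e" using l nl by auto
        then have "k \<in> {x, y}" "(fst k, \<not> snd k) \<in> {x, y}" using k k' by auto
        moreover have "k \<noteq> (fst k, \<not> snd k)" by (cases k) auto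
        ultimately have "fst x = fst y" by (metis fst_conv insert_iff singletonD)
        then show False using False by contradiction
      qed
      have "ccw Q (e, b) x y = (if ?v \<in> W then ccw P (e, b) y x else ccw P (e, b) x y)"
        using W v mem d loopfree unfolding flips_orders_def by blast
      then have "if ?v \<in> W then ccw P (e, b) y x else ccw P (e, b) x y" using cQ by simp
      then show ?thesis using rx ry by (cases "?v \<in> W") (simp_all add: r'_def)
    qed
  qed
  show ?thesis
  proof (rule mutation_iso_complexes[OF G rot])
    show "W \<subseteq> verts G" "card {a \<in> links G. crossing G W a} \<le> 2" using W by (simp_all add: flips_orders_def)
    show "r' (e, b) = (if ends G e b \<in> W then prod.swap (r (e, b)) else r (e, b))" for e b
      by (simp add: r'_def)
    show "state_circles G P M A = classes ((links G - M) \<union> circs G) (arcs M A r)" for A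
      by (rule state_circles_arcs) (erule exP, erule r, assumption)
    show "state_circles G Q M A = classes ((links G - M) \<union> circs G) (arcs M A r')" for A
      by (rule state_circles_arcs) (erule exQ, erule r', assumption)
  qed
qed

theorem theorem5p1:
  fixes G :: "('v, 'e) mgraph" and M :: "'e set" and \<Gamma> \<Gamma>' :: "('v, 'e) drawing"
  assumes "trivalent G" and "planar G" and "perfect_matching G M"
    and "plane_graph G \<Gamma>" and "plane_graph G \<Gamma>'"
    and "(move G)\<^sup>*\<^sup>* \<Gamma> \<Gamma>'"
  shows "\<exists>S :: nat \<Rightarrow> int \<Rightarrow> 'e cochain \<Rightarrow> 'e cochain. \<forall>i j.
           linear_iso (cochains G \<Gamma> M i j) (cochains G \<Gamma>' M i j) (S i j) \<and>
           (\<forall>c\<in>cochains G \<Gamma> M i j.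
              S (Suc i) j (differential G \<Gamma> M c) = differential G \<Gamma>' M (S i j c))"
proof -
  from assms(6) have "iso_complexes G M \<Gamma> \<Gamma>'"
  proof (induction rule: rtranclp_induct)
    case base
    show ?case by (rule iso_complexes_refl)
  next
    case (step P Q)
    show ?case
      by (rule iso_complexes_trans[OF step.IH move_iso_complexes[OF assms(1,3) step.hyps(2)]])
  qed
  then show ?thesis unfolding iso_complexes_def .
qed

end
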